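(* Let $n\ge1$ be an integer, $0\le\delta<1$, and $s\in\mathbb{R}$. Then $$S^1f(x,t)-f(x)=o(|t|^\delta)\quad\text{as } t\to 0,\qquad \text{for a.e. } x\in\mathbb{R}^n,$$ holds for all $f\in H^s(\mathbb{R}^n)$ if and only if $s>\tfrac12$ and $s\ge\delta$.
   Context: $H^s(\mathbb{R}^n)$ is the inhomogeneous $L^2$-based Sobolev space of order $s$. With $\hat f(\xi)=\int_{\mathbb{R}^n}e^{-ix\cdot\xi}f(x)\,dx$, the operator $S^1$ (the case $a=1$ of the Schrödinger type operators $e^{it(-\Delta)^{a/2}}$, corresponding to the wave operator) is (formally) defined by $$S^1f(x,t)=e^{it(-\Delta)^{1/2}}f(x)=\frac{1}{(2\pi)^n}\int_{\mathbb{R}^n}e^{i(x\cdot\xi+t|\xi|)}\hat f(\xi)\,d\xi ,$$ where for general $f\in H^s(\mathbb{R}^n)$ the integral is understood as an inverse Fourier transform in the usual extended sense. The statement $S^1f(x,t)-f(x)=o(|t|^\delta)$ as $t\to0$ means $\lim_{t\to0}|t|^{-\delta}\,(S^1f(x,t)-f(x))=0$. *)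

theory Defs
  imports "HOL-Analysis.Analysis"
begin

section \<open>Schwartz functions\<close>

text \<open>Iterated partial derivative of a function in the directions listed (last one first).\<close>
primrec iter_deriv :: "'a list \<Rightarrow> ('a::euclidean_space \<Rightarrow> complex) \<Rightarrow> 'a \<Rightarrow> complex" where
  "iter_deriv [] \<phi> = \<phi>"
| "iter_deriv (b # bs) \<phi> = (\<lambda>x. frechet_derivative (iter_deriv bs \<phi>) (at x) b)"

text \<open>If all iterated partial derivatives exist and are Frechet differentiable everywhere,
  the function is smooth.\<close>
definition schwartz :: "('a::euclidean_space \<Rightarrow> complex) \<Rightarrow> bool" where
  "schwartz \<phi> \<longleftrightarrow>
     (\<forall>bs\<in>lists Basis. (\<forall>x. iter_deriv bs \<phi> differentiable (at x)) \<and>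
        (\<forall>N::nat. \<exists>B. \<forall>x. (1 + norm x) ^ N * norm (iter_deriv bs \<phi> x) \<le> B))"

definition schwartz_seminorm :: "nat \<Rightarrow> ('a::euclidean_space \<Rightarrow> complex) \<Rightarrow> real" where
  "schwartz_seminorm N \<phi> =
     (SUP (bs, x) \<in> {bs \<in> lists Basis. length bs \<le> N} \<times> UNIV.
        (1 + norm x) ^ N * norm (iter_deriv bs \<phi> x))"

definition fourier :: "('a::euclidean_space \<Rightarrow> complex) \<Rightarrow> 'a \<Rightarrow> complex" where
  "fourier \<phi> \<xi> = (LINT x|lborel. exp (- \<i> * of_real (x \<bullet> \<xi>)) * \<phi> x)"

definition inv_fourier :: "('a::euclidean_space \<Rightarrow> complex) \<Rightarrow> 'a \<Rightarrow> complex" where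
  "inv_fourier \<phi> x =
     (LINT \<xi>|lborel. exp (\<i> * of_real (x \<bullet> \<xi>)) * \<phi> \<xi>) / of_real ((2 * pi) ^ DIM('a))"


section \<open>Tempered distributions and Sobolev spaces\<close>

text \<open>A distribution is a functional on test functions; only its values on Schwartz functions
  are ever used.\<close>
type_synonym 'a distr = "('a \<Rightarrow> complex) \<Rightarrow> complex"

definition tempered :: "'a::euclidean_space distr \<Rightarrow> bool" where
  "tempered u \<longleftrightarrow>
     (\<forall>\<phi> \<psi>. schwartz \<phi> \<longrightarrow> schwartz \<psi> \<longrightarrow> u (\<lambda>x. \<phi> x + \<psi> x) = u \<phi> + u \<psi>) \<and>
     (\<forall>c \<phi>. schwartz \<phi> \<longrightarrow> u (\<lambda>x. c * \<phi> x) = c * u \<phi>) \<and>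
     (\<exists>N C. \<forall>\<phi>. schwartz \<phi> \<longrightarrow> norm (u \<phi>) \<le> C * schwartz_seminorm N \<phi>)"

text \<open>The distribution \<open>u\<close> is given by the function \<open>f\<close>; such an \<open>f\<close> is unique up to null sets.\<close>
definition represents :: "('a::euclidean_space \<Rightarrow> complex) \<Rightarrow> 'a distr \<Rightarrow> bool" where
  "represents f u \<longleftrightarrow> f \<in> borel_measurable borel \<and>
     (\<forall>\<phi>. schwartz \<phi> \<longrightarrow>
        integrable lborel (\<lambda>x. f x * \<phi> x) \<and> u \<phi> = (LINT x|lborel. f x * \<phi> x))"

definition fourier_distr :: "'a::euclidean_space distr \<Rightarrow> 'a distr" where
  "fourier_distr u = (\<lambda>\<phi>. u (fourier \<phi>))"

definition inv_fourier_distr :: "'a::euclidean_space distr \<Rightarrow> 'a distr" where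
  "inv_fourier_distr u = (\<lambda>\<phi>. u (inv_fourier \<phi>))"

definition distr_of_fun :: "('a::euclidean_space \<Rightarrow> complex) \<Rightarrow> 'a distr" where
  "distr_of_fun g = (\<lambda>\<phi>. LINT x|lborel. g x * \<phi> x)"

definition sobolev :: "real \<Rightarrow> 'a::euclidean_space distr set" where
  "sobolev s = {u. tempered u \<and>
     (\<exists>g. represents g (fourier_distr u) \<and>
          integrable lborel (\<lambda>\<xi>. (1 + (norm \<xi>)\<^sup>2) powr s * (norm (g \<xi>))\<^sup>2))}"


section \<open>The wave operator\<close>

text \<open>The function \<open>\<xi> \<mapsto> \<hat>u(\<xi>)\<close>, for \<open>u\<close> in a Sobolev space; it is determined up to null sets.\<close>
definition fourier_fun :: "'a::euclidean_space distr \<Rightarrow> 'a \<Rightarrow> complex" where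
  "fourier_fun u = (SOME g. represents g (fourier_distr u))"

definition S1 :: "'a::euclidean_space distr \<Rightarrow> real \<Rightarrow> 'a distr" where
  "S1 u t = inv_fourier_distr
     (distr_of_fun (\<lambda>\<xi>. exp (\<i> * of_real (t * norm \<xi>)) * fourier_fun u \<xi>))"

text \<open>For each single \<open>t\<close>, \<open>S1 u t\<close> determines a function of \<open>x\<close> only up to a null set depending
  on \<open>t\<close>, so pointwise values for all \<open>t\<close> simultaneously require choosing a version. A version is
  a jointly measurable function \<open>F\<close> of \<open>(x, t)\<close> with the right time slices; by Fubini, two
  versions agree, for almost every \<open>x\<close>, at almost every \<open>t\<close>. Without joint measurability a version
  could be altered arbitrarily along a set that is null in \<open>x\<close> for every \<open>t\<close>, yet large in \<open>t\<close>
  for every \<open>x\<close>.\<close>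
definition S1_version :: "'a::euclidean_space distr \<Rightarrow> ('a \<Rightarrow> real \<Rightarrow> complex) \<Rightarrow> bool" where
  "S1_version u F \<longleftrightarrow>
     (\<lambda>(x, t). F x t) \<in> borel_measurable borel \<and> (\<forall>t. represents (\<lambda>x. F x t) (S1 u t))"

text \<open>\<open>S\<^sup>1u(x,t) - u(x) = o(|t|\<^sup>\<delta>)\<close> as \<open>t \<rightarrow> 0\<close>, for almost every \<open>x\<close>. In particular \<open>u\<close> has to be
  a function, which is automatic in Sobolev spaces of nonnegative order.\<close>
definition S1_converges :: "real \<Rightarrow> 'a::euclidean_space distr \<Rightarrow> bool" where
  "S1_converges \<delta> u \<longleftrightarrow>
     (\<exists>f F. represents f u \<and> S1_version u F \<and>
        (AE x in lborel. ((\<lambda>t. (\<bar>t\<bar> powr (- \<delta>)) *\<^sub>R (F x t - f x)) \<longlongrightarrow> 0) (at 0)))"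

end

theory Submission
  imports Defs "HOL-Probability.Characteristic_Functions" "HOL-Probability.Sinc_Integral"
begin

text \<open>Sufficiency: one may assume \<open>1/2 < s < 1\<close> and \<open>\<delta> = s\<close>. Split the Fourier transform into pieces
  supported in the dyadic shells \<open>|\<xi>| \<sim> 2 ^ k\<close>, let \<open>W k\<close> be the corresponding waves, and put
  \<open>D k t = W k t - W k 0\<close>. For \<open>|t| \<le> T = 2 ^ (- j)\<close> and any \<open>w > 0\<close>, the fundamental theorem of calculus
  bounds \<open>|D k t| ^ 2\<close> by the integral of \<open>w |D k| ^ 2 + w ^ (- 1) |(W k)'| ^ 2\<close> over \<open>[- T, T]\<close>. With
  \<open>w = 2 ^ max j k\<close> and the Bessel inequality in \<open>x\<close>, the supremum over these \<open>t\<close> has \<open>x\<close>-integral at most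
  \<open>4 ^ (- j s) q ^ |j - k| \<beta> k\<close> with \<open>q < 1\<close> and \<open>\<beta>\<close> summable: the decay for \<open>k < j\<close> uses \<open>s < 1\<close>, that
  for \<open>k > j\<close> uses \<open>s > 1/2\<close>. Summing over \<open>j\<close> and \<open>k\<close> yields \<open>o(|t| ^ s)\<close> almost everywhere.

  Necessity: near the frequency \<open>N e\<close>, with \<open>e\<close> a unit vector, \<open>|\<xi>| = \<xi> \<bullet> e + O(1 / N)\<close>. Hence data of the
  form bump times \<open>G (x \<bullet> e)\<close>, where \<open>G\<close> has positive frequencies, evolve into the translates along \<open>- t e\<close>
  up to \<open>O(|t|)\<close>, and it suffices to find bad functions \<open>G\<close> of one variable: for \<open>s < \<delta>\<close> a Weierstrass
  function \<open>\<Sum>m. R ^ (- m \<delta>) cis (R ^ m y)\<close>, and for \<open>s = 1/2\<close> a sum of translates of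
  \<open>- \<kappa> Ln (1 - r cis y)\<close>, whose real part is bounded below while it has arbitrarily high peaks near
  every point.\<close>


section \<open>Gaussians\<close>

text \<open>Two obstacles shape the proof. First, \<open>S1\<close> is defined by duality on
  Schwartz functions. In place of a Fourier transform on L^2, the transform of the data is cut into
  integrable pieces with summable L^2 norms; the series of their Fourier integrals then converges
  absolutely at almost every point and represents \<open>S1 u t\<close>. The explicit transform of a
  Gaussian yields Bessel's inequality, inversion and uniqueness. Second, at almost every x a version
  is known only for almost every t. A single bad time proves nothing, so each counterexample must be
  bad on nonempty open sets of times arbitrarily close to 0: the Weierstrass function throughout
  intervals of length comparable to \<open>R ^ (- k)\<close>, the logarithms on peaks of positive
  width. The error O(|t|) of the translation approximation is negligible against |t| ^ \<delta>
  because \<delta> < 1. Orders below 1/2 are covered by the example at 1/2, since Sobolev spaces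
  shrink as s grows; 1/2 is the order at which functions of one variable just fail to be locally
  bounded, which is what the logarithms exhibit.\<close>

lemma nn_integral_lborel_affine:
  fixes t :: "'a::euclidean_space"
  assumes [measurable]: "f \<in> borel_measurable borel" and c: "c \<noteq> 0"
  shows "(\<integral>\<^sup>+x. f x \<partial>lborel) = ennreal (\<bar>c\<bar> ^ DIM('a)) * (\<integral>\<^sup>+x. f (t + c *\<^sub>R x) \<partial>lborel)"
  by (subst lborel_affine[OF c, of t])
     (simp add: nn_integral_density nn_integral_distr nn_integral_cmult)

lemma integrable_lborel_affine:
  fixes t :: "'a::euclidean_space" and f :: "'a \<Rightarrow> 'b::{banach, second_countable_topology}"
  assumes f: "integrable lborel f" and c: "c \<noteq> 0"
  shows "integrable lborel (\<lambda>x. f (t + c *\<^sub>R x))"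
proof -
  have [measurable]: "f \<in> borel_measurable borel" using f by simp
  show ?thesis
    using f unfolding integrable_iff_bounded
    by (subst (asm) nn_integral_lborel_affine[OF _ c, of _ t])
       (auto simp: ennreal_mult_less_top c)
qed

lemma integral_lborel_affine:
  fixes t :: "'a::euclidean_space" and f :: "'a \<Rightarrow> 'b::{banach, second_countable_topology}"
  assumes [measurable]: "f \<in> borel_measurable borel" and c: "c \<noteq> 0"
  shows "(\<integral>x. f x \<partial>lborel) = (\<bar>c\<bar> ^ DIM('a)) *\<^sub>R (\<integral>x. f (t + c *\<^sub>R x) \<partial>lborel)"
  by (subst lborel_affine[OF c, of t])
     (simp add: integral_density integral_distr)

lemma measurable_cis [measurable]: "cis \<in> borel_measurable borel"
  by (intro borel_measurable_continuous_onI continuous_intros)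

lemma
  fixes f :: "'a::euclidean_space \<Rightarrow> real \<Rightarrow> 'b::{real_normed_field,banach,second_countable_topology}"
  assumes f: "\<And>b. b \<in> Basis \<Longrightarrow> integrable lborel (f b)"
  shows integrable_lborel_prod: "integrable lborel (\<lambda>x::'a. \<Prod>b\<in>Basis. f b (x \<bullet> b))"
    and integral_lborel_prod:
      "(LINT x::'a|lborel. (\<Prod>b\<in>Basis. f b (x \<bullet> b))) = (\<Prod>b\<in>Basis. LINT y|lborel. f b y)"
proof -
  interpret product_sigma_finite "\<lambda>_::'a. lborel :: real measure" ..
  have [measurable]: "b \<in> Basis \<Longrightarrow> f b \<in> borel_measurable borel" for b using f[of b] by simp
  have eq: "(\<Prod>b\<in>Basis. f b ((\<Sum>b'\<in>Basis. g b' *\<^sub>R b') \<bullet> b)) = (\<Prod>b\<in>Basis. f b (g b))" for g :: "'a \<Rightarrow> real"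
    by (intro prod.cong refl) simp
  show "integrable lborel (\<lambda>x::'a. \<Prod>b\<in>Basis. f b (x \<bullet> b))"
    by (subst lborel_eq, subst integrable_distr_eq)
       (use f in \<open>auto simp: eq intro!: product_integrable_prod\<close>)
  show "(LINT x::'a|lborel. (\<Prod>b\<in>Basis. f b (x \<bullet> b))) = (\<Prod>b\<in>Basis. LINT y|lborel. f b y)"
    by (subst lborel_eq, subst integral_distr)
       (use f in \<open>auto simp: eq intro!: product_integral_prod\<close>)
qed

text \<open>The parameter is the inverse of the width: as \<epsilon> decreases to 0 the function
  increases to 1, while large \<epsilon> concentrates it at the origin. It is not
  normalised.\<close>

definition gaussian :: "real \<Rightarrow> 'a::euclidean_space \<Rightarrow> real" where
  "gaussian \<epsilon> x = exp (- (\<epsilon> * norm x)\<^sup>2 / 2)"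

lemma gaussian_pos [simp]: "gaussian \<epsilon> x > 0" and gaussian_nonneg [simp]: "gaussian \<epsilon> x \<ge> 0"
  and gaussian_le_1: "gaussian \<epsilon> x \<le> 1" and gaussian_minus: "gaussian \<epsilon> (- x) = gaussian \<epsilon> x"
  and gaussian_neq_0 [simp]: "gaussian \<epsilon> x \<noteq> 0"
  by (auto simp: gaussian_def)

lemma measurable_gaussian [measurable]: "gaussian \<epsilon> \<in> borel_measurable borel"
  unfolding gaussian_def by measurable

lemma norm_sq_Basis: "(norm (x::'a::euclidean_space))\<^sup>2 = (\<Sum>b\<in>Basis. (x \<bullet> b)\<^sup>2)"
  by (subst power2_norm_eq_inner, subst euclidean_inner) (simp add: power2_eq_square)

lemma cis_inner: "cis (x \<bullet> \<xi>) = (\<Prod>b\<in>Basis. cis ((x \<bullet> b) * (\<xi> \<bullet> b)))"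
  by (simp add: cis_conv_exp euclidean_inner[of x \<xi>] sum_distrib_left exp_sum)

text \<open>This is the characteristic function of the standard normal law, freed from its
  normalising constant. The Gaussian transform in several dimensions is reduced to it.\<close>

lemma has_bochner_integral_cis_exp:
  "has_bochner_integral lborel (\<lambda>x::real. cis (x * t) * of_real (exp (- x\<^sup>2 / 2))) (of_real (sqrt (2 * pi) * exp (- t\<^sup>2 / 2)))"
proof -
  have 1: "complex_of_real (exp (- t\<^sup>2 / 2)) = (CLINT x|lborel. std_normal_density x *\<^sub>R cis (t * x))"
    using fun_cong[OF char_std_normal_distribution, of t] unfolding char_def
    by (subst (asm) integral_density) (auto simp: cis_conv_exp)
  have 2: "integrable lborel (\<lambda>x. std_normal_density x *\<^sub>R cis (t * x))"
    by (rule Bochner_Integration.integrable_bound[of _ std_normal_density]) auto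
  have "has_bochner_integral lborel (\<lambda>x. std_normal_density x *\<^sub>R cis (t * x)) (of_real (exp (- t\<^sup>2 / 2)))"
    using 1 2 by (simp add: has_bochner_integral_iff)
  from has_bochner_integral_scaleR_right[OF this, of "sqrt (2 * pi)"]
  show ?thesis
    by (simp add: std_normal_density_def scaleR_conv_of_real mult_ac)
qed

lemma gaussian_prod: "gaussian 1 x = (\<Prod>b\<in>Basis. exp (- (x \<bullet> b)\<^sup>2 / 2))"
  by (simp add: gaussian_def norm_sq_Basis exp_sum[symmetric] sum_negf sum_divide_distrib)

text \<open>For \<epsilon> = 1 both the phase and the Gaussian factor over the coordinates; other
  widths follow by dilation.\<close>

lemma has_bochner_integral_cis_gaussian:
  assumes \<epsilon>: "\<epsilon> > 0"
  shows "has_bochner_integral lborel (\<lambda>x::'a::euclidean_space. cis (x \<bullet> \<xi>) * of_real (gaussian \<epsilon> x))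
    (of_real ((sqrt (2 * pi) / \<epsilon>) ^ DIM('a) * gaussian (1 / \<epsilon>) \<xi>))"
proof -
  let ?f = "\<lambda>\<eta> b (y::real). cis (y * (\<eta> \<bullet> b)) * of_real (exp (- y\<^sup>2 / 2)) :: complex"
  have eq: "(\<Prod>b\<in>Basis. ?f \<eta> b (x \<bullet> b)) = cis (x \<bullet> \<eta>) * of_real (gaussian 1 x)" for x \<eta> :: 'a
    by (simp add: cis_inner gaussian_prod prod.distrib)
  have int: "integrable lborel (?f \<eta> b)" for \<eta> b :: 'a
    using has_bochner_integral_cis_exp[of "\<eta> \<bullet> b"] by (simp add: has_bochner_integral_iff)
  have "integrable lborel (\<lambda>x::'a. cis (x \<bullet> \<eta>) * of_real (gaussian 1 x))" for \<eta> :: 'a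
    using integrable_lborel_prod[of "?f \<eta>", OF int] by (simp only: eq)
  moreover have "(LINT x::'a|lborel. cis (x \<bullet> \<eta>) * of_real (gaussian 1 x)) =
     of_real (sqrt (2 * pi) ^ DIM('a) * gaussian 1 \<eta>)" for \<eta> :: 'a
    using integral_lborel_prod[of "?f \<eta>", OF int]
    unfolding eq has_bochner_integral_integral_eq[OF has_bochner_integral_cis_exp]
    by (simp add: gaussian_prod prod.distrib)
  ultimately have 1: "integrable lborel (\<lambda>x::'a. cis (x \<bullet> \<eta>) * of_real (gaussian 1 x))"
    "(LINT x::'a|lborel. cis (x \<bullet> \<eta>) * of_real (gaussian 1 x)) = of_real (sqrt (2 * pi) ^ DIM('a) * gaussian 1 \<eta>)" for \<eta> :: 'a
    by auto
  have *: "cis (x \<bullet> \<xi>) * of_real (gaussian \<epsilon> x) = (\<lambda>x. cis (x \<bullet> ((1/\<epsilon>) *\<^sub>R \<xi>)) * of_real (gaussian 1 x)) (0 + \<epsilon> *\<^sub>R x)" for x :: 'a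
    using \<epsilon> by (simp add: gaussian_def)
  have "integrable lborel (\<lambda>x::'a. cis (x \<bullet> \<xi>) * of_real (gaussian \<epsilon> x))"
    unfolding * by (rule integrable_lborel_affine[OF 1(1)]) (use \<epsilon> in auto)
  moreover have "(LINT x::'a|lborel. cis (x \<bullet> \<xi>) * of_real (gaussian \<epsilon> x)) = of_real ((sqrt (2 * pi) / \<epsilon>) ^ DIM('a) * gaussian (1 / \<epsilon>) \<xi>)"
    using 1(2)[of "(1/\<epsilon>) *\<^sub>R \<xi>"] \<epsilon>
    by (subst (asm) integral_lborel_affine[where t=0 and c=\<epsilon>])
       (simp_all add: * gaussian_def field_simps scaleR_conv_of_real)
  ultimately show ?thesis by (simp add: has_bochner_integral_iff)
qed

lemma
  assumes \<epsilon>: "\<epsilon> > 0"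
  shows integrable_gaussian: "integrable lborel (gaussian \<epsilon> :: 'a::euclidean_space \<Rightarrow> real)"
    and integral_gaussian: "(LINT x::'a|lborel. gaussian \<epsilon> x) = (sqrt (2 * pi) / \<epsilon>) ^ DIM('a)"
proof -
  note * = has_bochner_integral_cis_gaussian[OF \<epsilon>, of "0::'a"]
  have "integrable lborel (\<lambda>x::'a. complex_of_real (gaussian \<epsilon> x))" using * by (simp add: has_bochner_integral_iff)
  then show i: "integrable lborel (gaussian \<epsilon> :: 'a \<Rightarrow> real)" by (simp only: complex_of_real_integrable_eq)
  have "complex_of_real (LINT x::'a|lborel. gaussian \<epsilon> x) = of_real ((sqrt (2 * pi) / \<epsilon>) ^ DIM('a))"
    using * by (simp add: has_bochner_integral_iff gaussian_def)
  then show "(LINT x::'a|lborel. gaussian \<epsilon> x) = (sqrt (2 * pi) / \<epsilon>) ^ DIM('a)" by (simp only: of_real_eq_iff)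
qed

lemma nn_integral_gaussian:
  assumes \<epsilon>: "\<epsilon> > 0"
  shows "(\<integral>\<^sup>+(x::'a::euclidean_space). ennreal (gaussian \<epsilon> x) \<partial>lborel) = ennreal ((sqrt (2 * pi) / \<epsilon>) ^ DIM('a))"
  by (subst nn_integral_eq_integral[OF integrable_gaussian[OF \<epsilon>]]) (auto simp: integral_gaussian[OF \<epsilon>])

text \<open>The integrand is dominated by \<open>norm (a x) * norm (b y)\<close>, which is
  integrable on the product. The kernels in mind are exponential phases: Bessel's inequality,
  duality and Fourier inversion all exchange integrals through this lemma.\<close>

lemma bounded_kernel_Fubini:
  fixes a :: "'a::euclidean_space \<Rightarrow> complex" and b :: "'b::euclidean_space \<Rightarrow> complex"
  assumes a: "integrable lborel a" and b: "integrable lborel b"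
    and K [measurable]: "(\<lambda>(x, y). K x y) \<in> borel_measurable (borel \<Otimes>\<^sub>M borel)"
    and bound: "\<And>x y. norm (K x y) \<le> 1"
  shows "(LINT x|lborel. a x * (LINT y|lborel. K x y * b y)) = (LINT y|lborel. b y * (LINT x|lborel. K x y * a x))"
proof -
  have [measurable]: "a \<in> borel_measurable borel" "b \<in> borel_measurable borel" using a b by auto
  let ?f = "\<lambda>x y. a x * (K x y * b y)"
  have *: "norm (?f x y) \<le> norm (a x) * norm (b y)" for x y
    using mult_right_mono[OF bound[of x y], of "norm (a x) * norm (b y)"] by (simp add: norm_mult mult_ac)
  have int_y: "integrable lborel (\<lambda>y. ?f x y)" for x
    by (rule Bochner_Integration.integrable_bound[of _ "\<lambda>y. norm (a x) * norm (b y)"])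
       (use b * in \<open>auto intro!: integrable_mult_right\<close>)
  have "integrable lborel (\<lambda>x. LINT y|lborel. norm (?f x y))"
  proof (rule Bochner_Integration.integrable_bound[of _ "\<lambda>x. norm (a x) * (LINT y|lborel. norm (b y))"])
    have "(LINT y|lborel. norm (?f x y)) \<le> (LINT y|lborel. norm (a x) * norm (b y))" for x
      by (rule integral_mono) (use int_y b * in auto)
    then show "AE x in lborel. norm (LINT y|lborel. norm (?f x y)) \<le> norm (norm (a x) * (LINT y|lborel. norm (b y)))"
      by (intro AE_I2) (simp add: integral_nonneg_AE order_trans[OF _ abs_ge_self])
  qed (use a in auto)
  then have int: "integrable (lborel \<Otimes>\<^sub>M lborel) (\<lambda>(x, y). ?f x y)"
    using int_y by (intro lborel_pair.Fubini_integrable) auto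
  have "(LINT x|lborel. LINT y|lborel. ?f x y) = (LINT y|lborel. LINT x|lborel. ?f x y)"
    using lborel_pair.Fubini_integral[OF int] by simp
  also have "\<dots> = (LINT y|lborel. LINT x|lborel. b y * (K x y * a x))"
    by (simp add: mult_ac)
  finally show "(LINT x|lborel. a x * (LINT y|lborel. K x y * b y)) = (LINT y|lborel. b y * (LINT x|lborel. K x y * a x))"
    by simp
qed

section \<open>Bessel's inequality for the Fourier integral\<close>

lemma measurable_cnj [measurable]: "cnj \<in> borel_measurable borel"
  by (intro borel_measurable_continuous_onI continuous_intros)

text \<open>Holds for all functions because the Bochner integral of a non-integrable function is 0
  by convention.\<close>

lemma norm_integral_le_nn_integral:
  fixes f :: "'a \<Rightarrow> 'b::{banach, second_countable_topology}"
  shows "ennreal (norm (LINT x|M. f x)) \<le> (\<integral>\<^sup>+x. ennreal (norm (f x)) \<partial>M)"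
  by (cases "integrable M f") (auto simp: integral_norm_bound_ennreal not_integrable_integral_eq)

lemma norm_fourier_integral_le:
  fixes h :: "'a::euclidean_space \<Rightarrow> complex"
  assumes h: "integrable lborel h"
  shows "norm (LINT \<xi>|lborel. cis (f \<xi>) * h \<xi>) \<le> (LINT \<xi>|lborel. norm (h \<xi>))"
  by (rule order_trans[OF integral_norm_bound]) (simp add: norm_mult)

lemma gaussian_tendsto: "(\<lambda>i. gaussian (1 / Suc i) x) \<longlonglongrightarrow> 1"
proof -
  have "(\<lambda>i. gaussian (1 / Suc i) x) \<longlonglongrightarrow> exp (- (0 * norm x)\<^sup>2 / 2)"
    unfolding gaussian_def by (intro tendsto_intros LIMSEQ_inverse_real_of_nat[unfolded inverse_eq_divide]) auto
  then show ?thesis by simp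
qed

text \<open>Expanding the square gives a double integral of \<open>h \<xi> * cnj (h \<eta>)\<close>
  against the transform \<open>K\<close> of the Gaussian at \<open>\<xi> - \<eta>\<close>. As
  \<open>K\<close> is nonnegative and even with total mass \<open>(2 * pi) ^ DIM('a)\<close>, the
  inequality of arithmetic and geometric means bounds it by the L^2 norm (Schur's test). The damping
  makes the left side finite; the right side does not depend on \<epsilon>.\<close>

lemma bessel_gaussian:
  fixes h :: "'a::euclidean_space \<Rightarrow> complex"
  assumes h: "integrable lborel h" and \<epsilon>: "\<epsilon> > 0"
  shows "(\<integral>\<^sup>+x. ennreal ((norm (LINT \<xi>|lborel. cis (x \<bullet> \<xi>) * h \<xi>))\<^sup>2 * gaussian \<epsilon> x) \<partial>lborel)
    \<le> ennreal ((2 * pi) ^ DIM('a)) * (\<integral>\<^sup>+\<xi>. ennreal ((norm (h \<xi>))\<^sup>2) \<partial>lborel)"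
proof -
  have [measurable]: "h \<in> borel_measurable borel" using h by simp
  define F where "F x = (LINT \<xi>|lborel. cis (x \<bullet> \<xi>) * h \<xi>)" for x
  have [measurable]: "F \<in> borel_measurable borel" unfolding F_def by measurable
  define K where "K \<zeta> = (sqrt (2 * pi) / \<epsilon>) ^ DIM('a) * gaussian (1 / \<epsilon>) \<zeta>" for \<zeta> :: 'a
  have [measurable]: "K \<in> borel_measurable borel" unfolding K_def by measurable
  have K_nonneg: "K \<zeta> \<ge> 0" for \<zeta> unfolding K_def using \<epsilon> by auto
  define N where "N = (\<integral>\<^sup>+\<xi>. ennreal ((norm (h \<xi>))\<^sup>2) \<partial>lborel)"
  have F_le: "norm (F x) \<le> (LINT \<xi>|lborel. norm (h \<xi>))" for x
    unfolding F_def by (rule norm_fourier_integral_le[OF h])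
  have FG: "integrable lborel (\<lambda>x. of_real (gaussian \<epsilon> x) * cnj (F x))"
    by (rule Bochner_Integration.integrable_bound[of _ "\<lambda>x. gaussian \<epsilon> x * (LINT \<xi>|lborel. norm (h \<xi>))"])
       (use F_le integrable_gaussian[OF \<epsilon>] in \<open>auto simp: norm_mult intro!: mult_left_mono order_trans[OF F_le]\<close>)
  have gi: "integrable lborel (\<lambda>x::'a. complex_of_real (gaussian \<epsilon> x))"
    using integrable_gaussian[OF \<epsilon>] by (simp only: complex_of_real_integrable_eq)
  have cnjF: "cnj (F x) = (LINT \<eta>|lborel. cis (- (x \<bullet> \<eta>)) * cnj (h \<eta>))" for x
    unfolding F_def by (subst Bochner_Integration.integral_cnj[symmetric]) (simp add: cis_cnj)
  have hc: "integrable lborel (\<lambda>x. cnj (h x))" using h by simp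
  have gft: "(LINT x|lborel. cis (x \<bullet> \<zeta>) * of_real (gaussian \<epsilon> x)) = of_real (K \<zeta>)" for \<zeta> :: 'a
    using has_bochner_integral_cis_gaussian[OF \<epsilon>, of \<zeta>] by (simp only: has_bochner_integral_iff K_def)
  have inner: "(LINT x|lborel. cis (x \<bullet> \<xi>) * (of_real (gaussian \<epsilon> x) * cnj (F x)))
      = (LINT \<eta>|lborel. cnj (h \<eta>) * of_real (K (\<xi> - \<eta>)))" for \<xi>
  proof -
    have c: "cis (x \<bullet> (\<xi> - \<eta>)) = cis (x \<bullet> \<xi>) * cis (- (x \<bullet> \<eta>))" for x \<eta>
      by (simp add: cis_mult inner_diff_right)
    have "(LINT x|lborel. cis (x \<bullet> \<xi>) * (of_real (gaussian \<epsilon> x) * cnj (F x)))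
        = (LINT x|lborel. of_real (gaussian \<epsilon> x) * (LINT \<eta>|lborel. cis (x \<bullet> (\<xi> - \<eta>)) * cnj (h \<eta>)))"
      unfolding cnjF
      by (rule Bochner_Integration.integral_cong)
         (simp_all add: c mult_ac flip: integral_mult_right_zero)
    also have "\<dots> = (LINT \<eta>|lborel. cnj (h \<eta>) * (LINT x|lborel. cis (x \<bullet> (\<xi> - \<eta>)) * of_real (gaussian \<epsilon> x)))"
      by (rule bounded_kernel_Fubini[OF gi hc]) (simp_all, measurable)
    also have "\<dots> = (LINT \<eta>|lborel. cnj (h \<eta>) * of_real (K (\<xi> - \<eta>)))"
      by (simp only: gft)
    finally show ?thesis .
  qed
  have "(LINT x|lborel. (of_real (gaussian \<epsilon> x) * cnj (F x)) * F x)
      = (LINT \<xi>|lborel. h \<xi> * (LINT x|lborel. cis (x \<bullet> \<xi>) * (of_real (gaussian \<epsilon> x) * cnj (F x))))"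
    using bounded_kernel_Fubini[OF FG h, of "\<lambda>x \<xi>. cis (x \<bullet> \<xi>)"] by (simp add: F_def[symmetric])
  also have "\<dots> = (LINT \<xi>|lborel. (LINT \<eta>|lborel. h \<xi> * (cnj (h \<eta>) * of_real (K (\<xi> - \<eta>)))))"
    by (simp add: inner)
  finally have eq: "(LINT x|lborel. (of_real (gaussian \<epsilon> x) * cnj (F x)) * F x) =
     (LINT \<xi>|lborel. (LINT \<eta>|lborel. h \<xi> * (cnj (h \<eta>) * of_real (K (\<xi> - \<eta>)))))" .
  have sq: "(of_real (gaussian \<epsilon> x) * cnj (F x)) * F x = complex_of_real ((norm (F x))\<^sup>2 * gaussian \<epsilon> x)" for x
    by (simp add: complex_norm_square mult_ac del: of_real_power)
  have "integrable lborel (\<lambda>x. (of_real (gaussian \<epsilon> x) * cnj (F x)) * F x)"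
    by (rule Bochner_Integration.integrable_bound[OF integrable_mult_left[OF integrable_norm[OF FG], of "LINT \<xi>|lborel. norm (h \<xi>)"]])
       (use F_le in \<open>auto simp: norm_mult intro!: mult_left_mono order_trans[OF F_le]\<close>)
  then have int: "integrable lborel (\<lambda>x. (norm (F x))\<^sup>2 * gaussian \<epsilon> x)"
    unfolding sq complex_of_real_integrable_eq .
  \<comment> \<open>The widths \<epsilon> and \<open>1 / \<epsilon>\<close> cancel, so the mass of
    \<open>K\<close> is the same for every \<epsilon>; this makes the bound uniform.\<close>
  have K_int: "(\<integral>\<^sup>+\<eta>. ennreal (K (\<xi> - \<eta>)) \<partial>lborel) = ennreal ((2 * pi) ^ DIM('a))" for \<xi> :: 'a
  proof -
    have "(\<integral>\<^sup>+\<eta>. ennreal (K (\<xi> - \<eta>)) \<partial>lborel) = (\<integral>\<^sup>+\<eta>. ennreal (K \<eta>) \<partial>lborel)"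
      using nn_integral_lborel_affine[where f="\<lambda>\<eta>. ennreal (K \<eta>)" and t=\<xi> and c="-1"] by simp
    also have "\<dots> = ennreal ((sqrt (2 * pi) / \<epsilon>) ^ DIM('a)) * (\<integral>\<^sup>+(\<eta>::'a). ennreal (gaussian (1 / \<epsilon>) \<eta>) \<partial>lborel)"
      unfolding K_def using \<epsilon> by (subst nn_integral_cmult[symmetric]) (auto simp: ennreal_mult)
    also have "\<dots> = ennreal ((sqrt (2 * pi) / \<epsilon>) ^ DIM('a) * (sqrt (2 * pi) / (1 / \<epsilon>)) ^ DIM('a))"
      using \<epsilon> by (subst nn_integral_gaussian) (auto simp: ennreal_mult)
    also have "(sqrt (2 * pi) / \<epsilon>) ^ DIM('a) * (sqrt (2 * pi) / (1 / \<epsilon>)) ^ DIM('a) = (2 * pi) ^ DIM('a)"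
      unfolding power_mult_distrib[symmetric] using \<epsilon> by simp
    finally show ?thesis .
  qed
  have K_sym: "K (\<xi> - \<eta>) = K (\<eta> - \<xi>)" for \<xi> \<eta> 
    using gaussian_minus[of _ "\<xi> - \<eta>"] by (simp add: K_def)
  have am: "norm (h \<xi>) * norm (h \<eta>) * K (\<xi> - \<eta>) \<le> (norm (h \<xi>))\<^sup>2 * (K (\<xi> - \<eta>) / 2) + (norm (h \<eta>))\<^sup>2 * (K (\<xi> - \<eta>) / 2)" for \<xi> \<eta>
  proof -
    have "norm (h \<xi>) * norm (h \<eta>) \<le> ((norm (h \<xi>))\<^sup>2 + (norm (h \<eta>))\<^sup>2) / 2"
      using sum_squares_bound[of "norm (h \<xi>)" "norm (h \<eta>)"] by simp
    from mult_right_mono[OF this K_nonneg[of "\<xi> - \<eta>"]] show ?thesis by (simp add: field_simps)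
  qed
  have half: "(\<integral>\<^sup>+\<xi>. \<integral>\<^sup>+\<eta>. ennreal ((norm (h \<xi>))\<^sup>2 * (K (\<xi> - \<eta>) / 2)) \<partial>lborel \<partial>lborel) = ennreal ((2 * pi) ^ DIM('a) / 2) * N"
  proof -
    have "(\<integral>\<^sup>+\<eta>. ennreal ((norm (h \<xi>))\<^sup>2 * (K (\<xi> - \<eta>) / 2)) \<partial>lborel) = ennreal ((2 * pi) ^ DIM('a) / 2) * ennreal ((norm (h \<xi>))\<^sup>2)" for \<xi>
    proof -
      have "(\<integral>\<^sup>+\<eta>. ennreal ((norm (h \<xi>))\<^sup>2 * (K (\<xi> - \<eta>) / 2)) \<partial>lborel) = (\<integral>\<^sup>+\<eta>. ennreal ((norm (h \<xi>))\<^sup>2 / 2) * ennreal (K (\<xi> - \<eta>)) \<partial>lborel)"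
        by (intro nn_integral_cong) (use K_nonneg in \<open>simp add: ennreal_mult[symmetric]\<close>)
      also have "\<dots> = ennreal ((norm (h \<xi>))\<^sup>2 / 2) * ennreal ((2 * pi) ^ DIM('a))"
        by (subst nn_integral_cmult) (auto simp: K_int)
      finally show ?thesis by (simp add: ennreal_mult[symmetric] mult_ac)
    qed
    then show ?thesis unfolding N_def by (simp add: nn_integral_cmult)
  qed
  have half2: "(\<integral>\<^sup>+\<xi>. \<integral>\<^sup>+\<eta>. ennreal ((norm (h \<eta>))\<^sup>2 * (K (\<xi> - \<eta>) / 2)) \<partial>lborel \<partial>lborel) = ennreal ((2 * pi) ^ DIM('a) / 2) * N"
  proof -
    have "(\<integral>\<^sup>+\<xi>. \<integral>\<^sup>+\<eta>. ennreal ((norm (h \<eta>))\<^sup>2 * (K (\<xi> - \<eta>) / 2)) \<partial>lborel \<partial>lborel)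
        = (\<integral>\<^sup>+\<eta>. \<integral>\<^sup>+\<xi>. ennreal ((norm (h \<eta>))\<^sup>2 * (K (\<xi> - \<eta>) / 2)) \<partial>lborel \<partial>lborel)"
      by (rule lborel_pair.Fubini'[symmetric]) measurable
    also have "\<dots> = (\<integral>\<^sup>+\<eta>. \<integral>\<^sup>+\<xi>. ennreal ((norm (h \<eta>))\<^sup>2 * (K (\<eta> - \<xi>) / 2)) \<partial>lborel \<partial>lborel)"
    proof (intro nn_integral_cong)
      fix \<xi> \<eta> show "ennreal ((norm (h \<eta>))\<^sup>2 * (K (\<xi> - \<eta>) / 2)) = ennreal ((norm (h \<eta>))\<^sup>2 * (K (\<eta> - \<xi>) / 2))"
        using K_sym[of \<xi> \<eta>] by presburger
    qed
    finally show ?thesis using half by simp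
  qed
  have "ennreal (LINT x|lborel. (norm (F x))\<^sup>2 * gaussian \<epsilon> x) = ennreal (norm (LINT x|lborel. (of_real (gaussian \<epsilon> x) * cnj (F x)) * F x))"
    unfolding sq integral_complex_of_real norm_of_real by (simp add: integral_nonneg_AE)
  also have "\<dots> \<le> (\<integral>\<^sup>+\<xi>. ennreal (norm (LINT \<eta>|lborel. h \<xi> * (cnj (h \<eta>) * of_real (K (\<xi> - \<eta>))))) \<partial>lborel)"
    unfolding eq by (rule norm_integral_le_nn_integral)
  also have "\<dots> \<le> (\<integral>\<^sup>+\<xi>. \<integral>\<^sup>+\<eta>. ennreal ((norm (h \<xi>))\<^sup>2 * (K (\<xi> - \<eta>) / 2)) + ennreal ((norm (h \<eta>))\<^sup>2 * (K (\<xi> - \<eta>) / 2)) \<partial>lborel \<partial>lborel)"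
  proof (rule nn_integral_mono)
    fix \<xi>
    have "ennreal (norm (LINT \<eta>|lborel. h \<xi> * (cnj (h \<eta>) * of_real (K (\<xi> - \<eta>))))) \<le>
      (\<integral>\<^sup>+\<eta>. ennreal (norm (h \<xi> * (cnj (h \<eta>) * of_real (K (\<xi> - \<eta>))))) \<partial>lborel)"
      by (rule norm_integral_le_nn_integral)
    also have "\<dots> \<le> (\<integral>\<^sup>+\<eta>. ennreal ((norm (h \<xi>))\<^sup>2 * (K (\<xi> - \<eta>) / 2)) + ennreal ((norm (h \<eta>))\<^sup>2 * (K (\<xi> - \<eta>) / 2)) \<partial>lborel)"
    proof (rule nn_integral_mono)
      fix \<eta>
      have "norm (h \<xi> * (cnj (h \<eta>) * of_real (K (\<xi> - \<eta>)))) = norm (h \<xi>) * norm (h \<eta>) * K (\<xi> - \<eta>)"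
        by (simp add: norm_mult abs_of_nonneg K_nonneg)
      then show "ennreal (norm (h \<xi> * (cnj (h \<eta>) * of_real (K (\<xi> - \<eta>)))))
        \<le> ennreal ((norm (h \<xi>))\<^sup>2 * (K (\<xi> - \<eta>) / 2)) + ennreal ((norm (h \<eta>))\<^sup>2 * (K (\<xi> - \<eta>) / 2))"
        using am[of \<xi> \<eta>] K_nonneg[of "\<xi> - \<eta>"] by (subst ennreal_plus[symmetric]) (auto intro!: ennreal_leI simp del: ennreal_plus)
    qed
    finally show "ennreal (norm (LINT \<eta>|lborel. h \<xi> * (cnj (h \<eta>) * of_real (K (\<xi> - \<eta>))))) \<le> \<dots>" .
  qed
  also have "\<dots> = (\<integral>\<^sup>+\<xi>. \<integral>\<^sup>+\<eta>. ennreal ((norm (h \<xi>))\<^sup>2 * (K (\<xi> - \<eta>) / 2)) \<partial>lborel \<partial>lborel)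
     + (\<integral>\<^sup>+\<xi>. \<integral>\<^sup>+\<eta>. ennreal ((norm (h \<eta>))\<^sup>2 * (K (\<xi> - \<eta>) / 2)) \<partial>lborel \<partial>lborel)"
    by (simp add: nn_integral_add)
  also have "\<dots> = ennreal ((2 * pi) ^ DIM('a)) * N"
    unfolding half half2
    by (subst distrib_right[symmetric]) (simp add: ennreal_plus[symmetric] mult.commute[of "pi ^ _"] del: ennreal_plus)
  finally show ?thesis
    unfolding F_def[symmetric] N_def[symmetric]
    using int by (subst nn_integral_eq_integral) auto
qed

text \<open>Let the Gaussian damping tend to 1 and apply Fatou's lemma. This is one half of
  Plancherel's theorem.\<close>

lemma bessel:
  fixes h :: "'a::euclidean_space \<Rightarrow> complex"
  assumes h: "integrable lborel h"
  shows "(\<integral>\<^sup>+x. ennreal ((norm (LINT \<xi>|lborel. cis (x \<bullet> \<xi>) * h \<xi>))\<^sup>2) \<partial>lborel)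
    \<le> ennreal ((2 * pi) ^ DIM('a)) * (\<integral>\<^sup>+\<xi>. ennreal ((norm (h \<xi>))\<^sup>2) \<partial>lborel)" (is "_ \<le> ?R")
proof -
  have [measurable]: "h \<in> borel_measurable borel" using h by simp
  define F where "F x = (LINT \<xi>|lborel. cis (x \<bullet> \<xi>) * h \<xi>)" for x
  have [measurable]: "F \<in> borel_measurable borel" unfolding F_def by measurable
  have "(\<lambda>i. ennreal ((norm (F x))\<^sup>2 * gaussian (1 / Suc i) x)) \<longlonglongrightarrow> ennreal ((norm (F x))\<^sup>2 * 1)" for x
    by (intro tendsto_intros gaussian_tendsto)
  then have "ennreal ((norm (F x))\<^sup>2) = liminf (\<lambda>i. ennreal ((norm (F x))\<^sup>2 * gaussian (1 / Suc i) x))" for x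
    by (subst lim_imp_Liminf[where f="\<lambda>i. ennreal ((norm (F x))\<^sup>2 * gaussian (1 / Suc i) x)"]) auto
  then have "(\<integral>\<^sup>+x. ennreal ((norm (F x))\<^sup>2) \<partial>lborel) = (\<integral>\<^sup>+x. liminf (\<lambda>i. ennreal ((norm (F x))\<^sup>2 * gaussian (1 / Suc i) x)) \<partial>lborel)"
    by simp
  also have "\<dots> \<le> liminf (\<lambda>i. \<integral>\<^sup>+x. ennreal ((norm (F x))\<^sup>2 * gaussian (1 / Suc i) x) \<partial>lborel)"
    by (rule nn_integral_liminf) measurable
  also have "\<dots> \<le> liminf (\<lambda>i::nat. ?R)"
    by (rule Liminf_mono, rule always_eventually) (use bessel_gaussian[OF h] in \<open>auto simp: F_def\<close>)
  finally show ?thesis by (simp add: F_def Liminf_const)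
qed


section \<open>Functions are determined by their integrals against translated Gaussians\<close>

lemma AE_zero_if_integral_closed_zero:
  fixes D :: "'a::euclidean_space \<Rightarrow> complex"
  assumes D: "integrable lborel D" and z: "\<And>C. closed C \<Longrightarrow> (LINT x:C|lborel. D x) = 0"
  shows "AE x in lborel. D x = 0"
proof (rule sigma_finite_measure.density_zero[OF sigma_finite_lborel D])
  fix A :: "'a set" assume "A \<in> sets lborel"
  \<comment> \<open>Closed sets form an intersection-stable generator of the Borel sets, so the
    vanishing of the integral spreads from them to all Borel sets by Dynkin's argument.\<close>
  then have "A \<in> sigma_sets UNIV (Collect closed)" by (simp add: borel_eq_closed)
  then show "(LINT x:A|lborel. D x) = 0"
  proof (rule sigma_sets_induct_disjoint[rotated 2])
    show "Int_stable (Collect closed :: 'a set set)" by (auto simp: Int_stable_def)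
  next
    fix A :: "'a set" assume A: "A \<in> sigma_sets UNIV (Collect closed)" "(LINT x:A|lborel. D x) = 0"
    then have [measurable]: "A \<in> sets borel" by (simp add: borel_eq_closed)
    have "(LINT x:UNIV|lborel. D x) = (LINT x:(A \<union> (UNIV - A))|lborel. D x)" by simp
    also have "\<dots> = (LINT x:A|lborel. D x) + (LINT x:(UNIV - A)|lborel. D x)"
      by (rule set_integral_Un) (use D in \<open>auto simp: set_integrable_def intro!: integrable_mult_indicator\<close>)
    finally show "(LINT x:(UNIV - A)|lborel. D x) = 0" using z[of UNIV] A by simp
  next
    fix A :: "nat \<Rightarrow> 'a set"
    assume A: "disjoint_family A" "range A \<subseteq> sigma_sets UNIV (Collect closed)" "\<And>i. (LINT x:A i|lborel. D x) = 0"
    have [measurable]: "A i \<in> sets borel" for i using A(2) by (auto simp: borel_eq_closed)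
    have "(LINT x:(\<Union>i. A i)|lborel. D x) = (\<Sum>i. (LINT x:(A i)|lborel. D x))"
      by (rule lebesgue_integral_countable_add)
        (use A(1) D in \<open>auto simp: disjoint_family_on_def set_integrable_def intro!: integrable_mult_indicator\<close>)
    then show "(LINT x:(\<Union>i. A i)|lborel. D x) = 0" using A(3) by simp
  qed (use z in \<open>auto simp: set_lebesgue_integral_def\<close>)
qed

text \<open>The dilation sits in the argument of \<open>\<kappa>\<close> instead of in the kernel,
  so that dominated convergence applies with one fixed integrable majorant.\<close>

lemma gaussian_approx_identity:
  fixes \<kappa> :: "'a::euclidean_space \<Rightarrow> complex"
  assumes "continuous_on UNIV \<kappa>" and bd: "\<And>x. norm (\<kappa> x) \<le> B"
  shows "(\<lambda>i. LINT z|lborel. \<kappa> (x + (1 / Suc i) *\<^sub>R z) * of_real (gaussian 1 z))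
     \<longlonglongrightarrow> \<kappa> x * of_real (sqrt (2 * pi) ^ DIM('a))"
proof -
  have [measurable]: "\<kappa> \<in> borel_measurable borel"
    using assms(1) by (rule borel_measurable_continuous_onI)
  have "(\<lambda>i. LINT z|lborel. \<kappa> (x + (1 / Suc i) *\<^sub>R z) * of_real (gaussian 1 z))
     \<longlonglongrightarrow> (LINT z|lborel. \<kappa> x * of_real (gaussian 1 (z::'a)))"
  proof (rule integral_dominated_convergence[where w="\<lambda>z::'a. B * gaussian 1 z"])
    show "integrable lborel (\<lambda>z::'a. B * gaussian 1 z)" by (simp add: integrable_gaussian)
    show "AE z in lborel. (\<lambda>i. \<kappa> (x + (1 / Suc i) *\<^sub>R z) * of_real (gaussian 1 z)) \<longlonglongrightarrow> \<kappa> x * of_real (gaussian 1 z)"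
    proof (intro AE_I2 tendsto_intros)
      fix z :: 'a
      have "(\<lambda>i. x + (1 / Suc i) *\<^sub>R z) \<longlonglongrightarrow> x + 0 *\<^sub>R z"
        by (intro tendsto_intros LIMSEQ_inverse_real_of_nat[unfolded inverse_eq_divide])
      moreover have "isCont \<kappa> (x + 0 *\<^sub>R z)" using assms(1) by (simp add: continuous_on_eq_continuous_at)
      ultimately have "(\<lambda>i. \<kappa> (x + (1 / Suc i) *\<^sub>R z)) \<longlonglongrightarrow> \<kappa> (x + 0 *\<^sub>R z)" by (rule isCont_tendsto_compose[rotated])
      then show "(\<lambda>i. \<kappa> (x + (1 / Suc i) *\<^sub>R z)) \<longlonglongrightarrow> \<kappa> x" by simp
    qed
  qed (use bd in \<open>auto simp: norm_mult intro!: mult_right_mono\<close>)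
  also have "(LINT z|lborel. \<kappa> x * of_real (gaussian 1 (z::'a))) = \<kappa> x * of_real (sqrt (2 * pi) ^ DIM('a))"
    using integral_gaussian[of 1, where 'a='a]
    by (simp only: integral_mult_right_zero integral_complex_of_real zero_less_one div_by_1)
  finally show ?thesis .
qed

text \<open>Narrow Gaussian averages of a bounded continuous integrable \<open>b\<close> are
  superpositions of the given test functions, hence integrate to 0 against \<open>D\<close>; in the
  limit so does \<open>b\<close>. Indicators of closed sets, multiplied by a Gaussian, are limits of
  such \<open>b\<close>.\<close>

lemma AE_zero_if_gaussian_convolution_zero:
  fixes D :: "'a::euclidean_space \<Rightarrow> complex"
  assumes D: "integrable lborel D"
    and z: "\<And>\<epsilon> y. \<epsilon> > 0 \<Longrightarrow> (LINT x|lborel. D x * of_real (gaussian \<epsilon> (x - y))) = 0"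
  shows "AE x in lborel. D x = 0"
proof -
  have [measurable]: "D \<in> borel_measurable borel" using D by simp
  have test: "(LINT x|lborel. D x * b x) = 0"
    if b: "integrable lborel b" and c: "continuous_on UNIV b" and bd: "\<And>x. norm (b x) \<le> 1" for b :: "'a \<Rightarrow> complex"
  proof -
    have [measurable]: "b \<in> borel_measurable borel" using b by simp
    define R where "R i x = (LINT z|lborel. b (x + (1 / Suc i) *\<^sub>R z) * of_real (gaussian 1 z))" for i :: nat and x :: 'a
    have [measurable]: "R i \<in> borel_measurable borel" for i unfolding R_def by measurable
    have R_le: "norm (R i x) \<le> sqrt (2 * pi) ^ DIM('a)" for i x
    proof -
      have "norm (R i x) \<le> (LINT z|lborel. gaussian 1 (z::'a))"
        unfolding R_def
        by (rule Bochner_Integration.integral_norm_bound_integral)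
          (use bd integrable_gaussian in \<open>auto simp: norm_mult mult_left_le_one_le
             intro!: Bochner_Integration.integrable_bound[OF integrable_gaussian[of 1]]\<close>)
      then show ?thesis by (simp add: integral_gaussian)
    qed
    have 0: "(LINT x|lborel. D x * R i x) = 0" for i
    proof -
      have R_eq: "R i x = of_nat (Suc i) ^ DIM('a) * (LINT y|lborel. of_real (gaussian (Suc i) (x - y)) * b y)" for x
        by (subst integral_lborel_affine[where c="1 / Suc i" and t=x])
           (simp_all add: R_def gaussian_def scaleR_conv_of_real field_simps del: of_nat_Suc)
      have "(LINT x|lborel. D x * (LINT y|lborel. of_real (gaussian (Suc i) (x - y)) * b y))
         = (LINT y|lborel. b y * (LINT x|lborel. of_real (gaussian (Suc i) (x - y)) * D x))"
        by (rule bounded_kernel_Fubini[OF D b]) (simp_all add: gaussian_le_1)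
      also have "\<dots> = 0" using z[of "Suc i"] by (simp add: mult.commute)
      finally have "of_nat (Suc i) ^ DIM('a) * (LINT x|lborel. D x * (LINT y|lborel. of_real (gaussian (Suc i) (x - y)) * b y)) = 0"
        by simp
      then show ?thesis unfolding R_eq by (simp only: mult.left_commute[of "D _"] integral_mult_right_zero)
    qed
    have "(\<lambda>i. LINT x|lborel. D x * R i x) \<longlonglongrightarrow> (LINT x|lborel. D x * (b x * of_real (sqrt (2 * pi) ^ DIM('a))))"
    proof (rule integral_dominated_convergence[where w="\<lambda>x. norm (D x) * sqrt (2 * pi) ^ DIM('a)"])
      show "AE x in lborel. (\<lambda>i. D x * R i x) \<longlonglongrightarrow> D x * (b x * of_real (sqrt (2 * pi) ^ DIM('a)))"
        unfolding R_def by (intro AE_I2 tendsto_mult_left gaussian_approx_identity[OF c bd])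
    qed (use D R_le in \<open>auto simp: norm_mult intro!: mult_left_mono\<close>)
    then have "(LINT x|lborel. D x * (b x * of_real (sqrt (2 * pi) ^ DIM('a)))) = 0"
      unfolding 0 by (simp add: LIMSEQ_const_iff)
    then show ?thesis by (simp add: mult.assoc[symmetric] del: of_real_power)
  qed
  have "AE x in lborel. D x * of_real (gaussian 1 x) = 0"
  proof (rule AE_zero_if_integral_closed_zero)
    show Dg: "integrable lborel (\<lambda>x. D x * of_real (gaussian 1 x))"
      by (rule Bochner_Integration.integrable_bound[OF D]) (auto simp: norm_mult mult_left_le gaussian_le_1)
    fix C :: "'a set" assume C: "closed C"
    then have [measurable]: "C \<in> sets borel" by simp
    show "(LINT x:C|lborel. D x * of_real (gaussian 1 x)) = 0"
    proof (cases "C = {}")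
      case False
      \<comment> \<open>Tent functions decreasing to the indicator of the closed set
        \<open>C\<close>; the factor \<open>gaussian 1\<close> below makes them integrable.\<close>
      define \<kappa> where "\<kappa> i x = max 0 (1 - real i * infdist x C)" for i and x :: 'a
      have c\<kappa>: "continuous_on UNIV (\<kappa> i)" for i unfolding \<kappa>_def by (intro continuous_intros)
      then have [measurable]: "\<kappa> i \<in> borel_measurable borel" for i by (rule borel_measurable_continuous_onI)
      have \<kappa>01: "0 \<le> \<kappa> i x" "\<kappa> i x \<le> 1" for i x unfolding \<kappa>_def by (auto simp: infdist_nonneg)
      have lim: "(\<lambda>i. \<kappa> i x) \<longlonglongrightarrow> indicator C x" for x
      proof (cases "x \<in> C")
        case True then show ?thesis by (simp add: \<kappa>_def)
      next
        case F: False
        then have pos: "infdist x C > 0" using C False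
          by (metis infdist_nonneg in_closed_iff_infdist_zero less_eq_real_def)
        obtain n where n: "real n * infdist x C > 1" using reals_Archimedean3[OF pos] by blast
        have "\<forall>\<^sub>F i in sequentially. \<kappa> i x = 0"
          using eventually_ge_at_top[of n]
        proof eventually_elim
          case (elim i)
          then have "real n * infdist x C \<le> real i * infdist x C" by (intro mult_right_mono) (auto simp: infdist_nonneg)
          then show ?case using n by (simp add: \<kappa>_def)
        qed
        then show ?thesis using F by (auto intro: tendsto_eventually)
      qed
      have z0: "(LINT x|lborel. D x * of_real (\<kappa> i x * gaussian 1 x)) = 0" for i
      proof (rule test)
        show "integrable lborel (\<lambda>x. complex_of_real (\<kappa> i x * gaussian 1 x))"
          unfolding complex_of_real_integrable_eq
          by (rule Bochner_Integration.integrable_bound[OF integrable_gaussian[of 1]])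
            (use \<kappa>01 in \<open>auto simp: abs_mult mult_left_le_one_le\<close>)
        show "continuous_on UNIV (\<lambda>x. complex_of_real (\<kappa> i x * gaussian 1 x))"
          unfolding gaussian_def by (intro continuous_intros c\<kappa>) auto
        show "norm (complex_of_real (\<kappa> i x * gaussian 1 x)) \<le> 1" for x
          using \<kappa>01[of i x] gaussian_le_1[of 1 x] by (simp only: norm_of_real) (simp add: abs_mult mult_le_one)
      qed
      have "(\<lambda>i. LINT x|lborel. D x * of_real (\<kappa> i x * gaussian 1 x))
         \<longlonglongrightarrow> (LINT x|lborel. D x * of_real (indicator C x * gaussian 1 x))"
      proof (rule integral_dominated_convergence[where w="\<lambda>x. norm (D x)"])
        show "AE x in lborel. (\<lambda>i. D x * of_real (\<kappa> i x * gaussian 1 x)) \<longlonglongrightarrow> D x * of_real (indicator C x * gaussian 1 x)"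
          by (intro AE_I2 tendsto_intros lim)
        show "AE x in lborel. norm (D x * of_real (\<kappa> i x * gaussian 1 x)) \<le> norm (D x)" for i
          using \<kappa>01[of i] gaussian_le_1[of 1] by (intro AE_I2) (auto simp: norm_mult intro!: mult_left_le mult_le_one)
      qed (use D in auto)
      then have "(LINT x|lborel. D x * of_real (indicator C x * gaussian 1 x)) = 0"
        unfolding z0 by (simp add: LIMSEQ_const_iff)
      then show ?thesis by (simp add: set_lebesgue_integral_def scaleR_conv_of_real mult_ac)
    qed (simp add: set_lebesgue_integral_def)
  qed
  then show ?thesis by eventually_elim simp
qed

text \<open>Completing the square: a product of two Gaussians is a multiple of a third. The next
  lemma can therefore pass from \<open>D\<close> to \<open>D\<close> times a Gaussian without
  leaving the class of test functions.\<close>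

lemma gaussian_mult_shifted:
  fixes x y :: "'a::euclidean_space"
  shows "gaussian 1 x * gaussian \<epsilon> (x - y) =
    gaussian (\<epsilon> / sqrt (1 + \<epsilon>\<^sup>2)) y * gaussian (sqrt (1 + \<epsilon>\<^sup>2)) (x - (\<epsilon>\<^sup>2 / (1 + \<epsilon>\<^sup>2)) *\<^sub>R y)"
proof -
  have p: "1 + \<epsilon>\<^sup>2 > 0" by (simp add: add_pos_nonneg)
  have n: "(norm (x - c *\<^sub>R y))\<^sup>2 = (norm x)\<^sup>2 - 2 * c * (x \<bullet> y) + c\<^sup>2 * (norm y)\<^sup>2" for c
    unfolding power2_norm_eq_inner
    by (simp add: inner_diff_left inner_diff_right inner_commute[of y x] power2_eq_square algebra_simps)
  have "(norm x)\<^sup>2 + \<epsilon>\<^sup>2 * (norm (x - 1 *\<^sub>R y))\<^sup>2 =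
     \<epsilon>\<^sup>2 / (1 + \<epsilon>\<^sup>2) * (norm y)\<^sup>2 + (1 + \<epsilon>\<^sup>2) * (norm (x - (\<epsilon>\<^sup>2 / (1 + \<epsilon>\<^sup>2)) *\<^sub>R y))\<^sup>2"
  proof -
    define e c where "e = \<epsilon>\<^sup>2" and "c = e / (1 + e)"
    have "c * (1 + e) = e" using p by (simp add: c_def e_def)
    then have eq: "c + c * e = e" "c * (1 + e) = e" by (simp_all add: algebra_simps)
    have "c * (norm y)\<^sup>2 + (1 + e) * ((norm x)\<^sup>2 - 2 * c * (x \<bullet> y) + c\<^sup>2 * (norm y)\<^sup>2)
      = (1 + e) * (norm x)\<^sup>2 - 2 * (c * (1 + e)) * (x \<bullet> y) + (c + c * (c * (1 + e))) * (norm y)\<^sup>2"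
      by (simp add: algebra_simps power2_eq_square)
    also have "\<dots> = (1 + e) * (norm x)\<^sup>2 - 2 * e * (x \<bullet> y) + e * (norm y)\<^sup>2" unfolding eq ..
    finally show ?thesis unfolding n e_def[symmetric] c_def[symmetric] by (simp add: algebra_simps)
  qed
  then have eq: "(1 * norm x)\<^sup>2 + (\<epsilon> * norm (x - y))\<^sup>2 =
      (\<epsilon> / sqrt (1 + \<epsilon>\<^sup>2) * norm y)\<^sup>2 + (sqrt (1 + \<epsilon>\<^sup>2) * norm (x - (\<epsilon>\<^sup>2 / (1 + \<epsilon>\<^sup>2)) *\<^sub>R y))\<^sup>2"
    unfolding power_mult_distrib power_divide using p by simp
  have "- a / 2 + - b / 2 = - c / 2 + - d / 2" if "a + b = c + d" for a b c d :: real
    using that by simp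
  from this[OF eq] show ?thesis unfolding gaussian_def exp_add[symmetric] by (simp only:)
qed

text \<open>\<open>D\<close> may fail to be integrable, but its product with
  \<open>gaussian 1\<close> is integrable, and the integrals of that product against translated
  Gaussians are multiples of integrals that vanish by assumption.\<close>

lemma AE_zero_if_gaussian_tests_zero:
  fixes D :: "'a::euclidean_space \<Rightarrow> complex"
  assumes i: "\<And>\<epsilon> c. \<epsilon> > 0 \<Longrightarrow> integrable lborel (\<lambda>x. D x * of_real (gaussian \<epsilon> (x - c)))"
    and z: "\<And>\<epsilon> c. \<epsilon> > 0 \<Longrightarrow> (LINT x|lborel. D x * of_real (gaussian \<epsilon> (x - c))) = 0"
  shows "AE x in lborel. D x = 0"
proof -
  have "AE x in lborel. D x * of_real (gaussian 1 x) = 0"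
  proof (rule AE_zero_if_gaussian_convolution_zero)
    show "integrable lborel (\<lambda>x. D x * of_real (gaussian 1 x))" using i[of 1 0] by simp
    fix \<epsilon> :: real and y :: 'a
    have eq: "D x * of_real (gaussian 1 x) * of_real (gaussian \<epsilon> (x - y)) =
      of_real (gaussian (\<epsilon> / sqrt (1 + \<epsilon>\<^sup>2)) y) * (D x * of_real (gaussian (sqrt (1 + \<epsilon>\<^sup>2)) (x - (\<epsilon>\<^sup>2 / (1 + \<epsilon>\<^sup>2)) *\<^sub>R y)))" for x
      using arg_cong[OF gaussian_mult_shifted[of x \<epsilon> y], of complex_of_real] by (simp add: mult_ac)
    show "(LINT x|lborel. D x * of_real (gaussian 1 x) * of_real (gaussian \<epsilon> (x - y))) = 0"
      unfolding eq using z[of "sqrt (1 + \<epsilon>\<^sup>2)"] by (simp add: add_pos_nonneg)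
  qed
  then show ?thesis by eventually_elim simp
qed


section \<open>Schwartz functions\<close>

abbreviation pderiv_dir :: "'a::euclidean_space \<Rightarrow> ('a \<Rightarrow> complex) \<Rightarrow> 'a \<Rightarrow> complex" where
  "pderiv_dir b \<phi> \<equiv> \<lambda>x. frechet_derivative \<phi> (at x) b"

lemma schwartz_has_derivative:
  "schwartz \<phi> \<Longrightarrow> (\<phi> has_derivative frechet_derivative \<phi> (at x)) (at x)"
  unfolding schwartz_def by (metis frechet_derivative_works iter_deriv.simps(1) lists.Nil)

lemma schwartz_differentiable: "schwartz \<phi> \<Longrightarrow> \<phi> differentiable (at x)"
  using schwartz_has_derivative by (rule differentiableI)

lemma differentiable_coord: "(\<lambda>x. complex_of_real (x \<bullet> c)) differentiable (at x)"
  by (rule differentiableI[OF bounded_linear_imp_has_derivative]) (rule bounded_linear_compose[OF bounded_linear_of_real bounded_linear_inner_left])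

lemma schwartz_bound: "schwartz \<phi> \<Longrightarrow> \<exists>B. \<forall>x. (1 + norm x) ^ N * norm (\<phi> x) \<le> B"
  unfolding schwartz_def by (metis iter_deriv.simps(1) lists.Nil)

lemma iter_deriv_append: "iter_deriv bs (iter_deriv cs \<phi>) = iter_deriv (bs @ cs) \<phi>"
  by (induction bs) auto

lemma schwartz_pderiv_dir: "schwartz \<phi> \<Longrightarrow> b \<in> Basis \<Longrightarrow> schwartz (pderiv_dir b \<phi>)"
  using iter_deriv_append[of _ "[b]" \<phi>] unfolding schwartz_def by simp

text \<open>A coinduction principle: membership is proved by exhibiting a class of differentiable,
  rapidly decaying functions closed under partial derivatives. No formula for iterated derivatives
  has to be found.\<close>

lemma schwartz_coinduct:
  assumes "\<phi> \<in> S"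
    and d: "\<And>\<psi> x. \<psi> \<in> S \<Longrightarrow> \<psi> differentiable (at x)"
    and bd: "\<And>\<psi> N. \<psi> \<in> S \<Longrightarrow> \<exists>B. \<forall>x. (1 + norm x) ^ N * norm (\<psi> x) \<le> B"
    and pd: "\<And>\<psi> b. \<psi> \<in> S \<Longrightarrow> b \<in> Basis \<Longrightarrow> pderiv_dir b \<psi> \<in> S"
  shows "schwartz \<phi>"
proof -
  have "iter_deriv bs \<phi> \<in> S" if "bs \<in> lists Basis" for bs
    using that by (induction bs) (auto simp: assms(1) intro: pd)
  then show ?thesis unfolding schwartz_def using d bd by blast
qed

lemma pderiv_dir_eqI: "(\<And>x. (\<phi> has_derivative \<phi>' x) (at x)) \<Longrightarrow> pderiv_dir b \<phi> = (\<lambda>x. \<phi>' x b)"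
  by (metis frechet_derivative_at)

lemma weighted_bound_add:
  assumes "\<exists>B. \<forall>x. (1 + norm x) ^ N * norm (f x :: complex) \<le> B" "\<exists>B. \<forall>x. (1 + norm x) ^ N * norm (g x) \<le> B"
  shows "\<exists>B. \<forall>x. (1 + norm x) ^ N * norm (a * f x + d * g x) \<le> B"
proof -
  obtain B C where B: "\<And>x. (1 + norm x) ^ N * norm (f x) \<le> B" and C: "\<And>x. (1 + norm x) ^ N * norm (g x) \<le> C"
    using assms by auto
  have "(1 + norm x) ^ N * norm (a * f x + d * g x) \<le> norm a * B + norm d * C" for x
  proof -
    have "(1 + norm x) ^ N * norm (a * f x + d * g x) \<le> (1 + norm x) ^ N * (norm a * norm (f x) + norm d * norm (g x))"
      by (intro mult_left_mono) (auto simp: norm_mult[symmetric] norm_triangle_ineq)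
    also have "\<dots> = norm a * ((1 + norm x) ^ N * norm (f x)) + norm d * ((1 + norm x) ^ N * norm (g x))"
      by (simp add: algebra_simps)
    also have "\<dots> \<le> norm a * B + norm d * C" by (intro add_mono mult_left_mono B C) auto
    finally show ?thesis .
  qed
  then show ?thesis by blast
qed

lemma weighted_bound_coord:
  fixes f :: "'a::euclidean_space \<Rightarrow> complex"
  assumes "\<exists>B. \<forall>x. (1 + norm x) ^ Suc N * norm (f x) \<le> B"
  shows "\<exists>B. \<forall>x. (1 + norm x) ^ N * norm (of_real (x \<bullet> c) * f x) \<le> B"
proof -
  obtain B where B: "\<And>x. (1 + norm x) ^ Suc N * norm (f x) \<le> B" using assms by auto
  have "(1 + norm x) ^ N * norm (of_real (x \<bullet> c) * f x) \<le> norm c * B" for x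
  proof -
    have "\<bar>x \<bullet> c\<bar> \<le> norm c * (1 + norm x)"
      using Cauchy_Schwarz_ineq2[of x c] by (simp add: algebra_simps add_increasing)
    then have "(1 + norm x) ^ N * norm (of_real (x \<bullet> c) * f x) \<le> (1 + norm x) ^ N * ((norm c * (1 + norm x)) * norm (f x))"
      by (intro mult_left_mono) (auto simp: norm_mult intro!: mult_right_mono)
    also have "\<dots> = norm c * ((1 + norm x) ^ Suc N * norm (f x))" by simp
    also have "\<dots> \<le> norm c * B" by (intro mult_left_mono B) auto
    finally show ?thesis .
  qed
  then show ?thesis by blast
qed

lemma schwartz_lincomb:
  assumes "schwartz \<phi>" "schwartz \<psi>"
  shows "schwartz (\<lambda>x. a * \<phi> x + d * \<psi> x)"
proof (rule schwartz_coinduct[where S="{\<lambda>x. a * \<phi> x + d * \<psi> x |\<phi> \<psi>. schwartz \<phi> \<and> schwartz \<psi>}"], goal_cases)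
  case (2 f x)
  then obtain \<phi> \<psi> where *: "f = (\<lambda>x. a * \<phi> x + d * \<psi> x)" "schwartz \<phi>" "schwartz \<psi>" by auto
  show ?case
    unfolding *(1) by (rule differentiable_add differentiable_mult differentiable_const schwartz_differentiable *(2,3))+
next
  case (4 f b)
  then obtain \<phi> \<psi> where *: "f = (\<lambda>x. a * \<phi> x + d * \<psi> x)" "schwartz \<phi>" "schwartz \<psi>" by auto
  have eq: "pderiv_dir b f = (\<lambda>x. a * pderiv_dir b \<phi> x + d * pderiv_dir b \<psi> x)"
    unfolding *(1) by (rule pderiv_dir_eqI) (auto intro!: derivative_eq_intros schwartz_has_derivative *)
  show ?case
    unfolding eq
    by (rule CollectI, rule exI[of _ "pderiv_dir b \<phi>"], rule exI[of _ "pderiv_dir b \<psi>"])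
       (intro conjI refl schwartz_pderiv_dir * 4)
next
  case (3 f N)
  then obtain \<phi> \<psi> where *: "f = (\<lambda>x. a * \<phi> x + d * \<psi> x)" "schwartz \<phi>" "schwartz \<psi>" by auto
  then show ?case using weighted_bound_add[OF schwartz_bound schwartz_bound] by simp
next
  case 1 show ?case by (rule CollectI, rule exI[of _ \<phi>], rule exI[of _ \<psi>]) (intro conjI refl assms)
qed

lemma schwartz_cmult: "schwartz \<phi> \<Longrightarrow> schwartz (\<lambda>x. c * \<phi> x)"
  using schwartz_lincomb[of \<phi> \<phi> c 0] by simp

lemma schwartz_reflect:
  assumes "schwartz \<phi>" shows "schwartz (\<lambda>x. \<phi> (- x))"
proof (rule schwartz_coinduct[where S="{\<lambda>x. \<phi> (- x) |\<phi>. schwartz \<phi>}"], goal_cases)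
  case (2 f x)
  then obtain \<phi> where *: "f = (\<lambda>x. \<phi> (- x))" "schwartz \<phi>" by auto
  have "(f has_derivative (\<lambda>h. frechet_derivative \<phi> (at (- x)) (- h))) (at x)"
    unfolding *(1) by (rule has_derivative_compose[OF has_derivative_minus[OF has_derivative_ident]] schwartz_has_derivative *)+
  then show ?case by (auto simp: differentiable_def)
next
  case (3 f N)
  then obtain \<phi> where "f = (\<lambda>x. \<phi> (- x))" "schwartz \<phi>" by auto
  moreover from this(2) obtain B where "\<And>x. (1 + norm x) ^ N * norm (\<phi> x) \<le> B"
    using schwartz_bound by blast
  ultimately have "\<forall>x. (1 + norm x) ^ N * norm (f x) \<le> B" by (metis norm_minus_cancel)
  then show ?case ..
next
  case (4 f b)
  then obtain \<phi> where *: "f = (\<lambda>x. \<phi> (- x))" "schwartz \<phi>" by auto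
  have "pderiv_dir b f = (\<lambda>x. frechet_derivative \<phi> (at (- x)) (- b))"
    unfolding *(1)
    by (rule pderiv_dir_eqI) (rule has_derivative_compose[OF has_derivative_minus[OF has_derivative_ident]] schwartz_has_derivative *)+
  also have "\<dots> = (\<lambda>x. - 1 * pderiv_dir b \<phi> (- x))"
    by (simp add: linear_neg[OF has_derivative_linear[OF schwartz_has_derivative[OF *(2)]]])
  finally have eq: "pderiv_dir b f = (\<lambda>x. - 1 * pderiv_dir b \<phi> (- x))" .
  show ?case
    unfolding eq
    by (intro CollectI exI[of _ "\<lambda>x. - 1 * pderiv_dir b \<phi> x"] conjI refl schwartz_cmult schwartz_pderiv_dir * 4)
next
  case 1 show ?case by (intro CollectI exI[of _ \<phi>] conjI refl assms)
qed

lemma schwartz_coord: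
  assumes "schwartz \<phi>" shows "schwartz (\<lambda>x. of_real (x \<bullet> c) * \<phi> x)"
proof -
  \<comment> \<open>Differentiating \<open>of_real (x \<bullet> c) * \<phi> x\<close> produces a
    further term without the linear factor; the class must contain it in order to be closed.\<close>
  let ?S = "{\<lambda>x. of_real (x \<bullet> c) * \<phi> x + \<psi> x |\<phi> \<psi>. schwartz \<phi> \<and> schwartz \<psi>}"
  have 0: "schwartz (\<lambda>x::'a. 0)" using schwartz_cmult[OF assms, of 0] by simp
  have "schwartz (\<lambda>x. of_real (x \<bullet> c) * \<phi> x + 0)"
  proof (rule schwartz_coinduct[where S="?S"], goal_cases)
    case 1 show ?case by (intro CollectI exI[of _ "\<phi>"] exI[of _ "\<lambda>_. 0"] conjI refl assms 0)
  next
    case (2 f x)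
    then obtain \<phi> \<psi> where *: "f = (\<lambda>x. of_real (x \<bullet> c) * \<phi> x + \<psi> x)" "schwartz \<phi>" "schwartz \<psi>" by auto
    show ?case
      unfolding *(1) by (rule differentiable_add differentiable_mult differentiable_coord schwartz_differentiable *(2,3))+
  next
    case (3 f N)
    then obtain \<phi> \<psi> where *: "f = (\<lambda>x. of_real (x \<bullet> c) * \<phi> x + \<psi> x)" "schwartz \<phi>" "schwartz \<psi>" by auto
    show ?case
      using weighted_bound_add[OF weighted_bound_coord[OF schwartz_bound[OF *(2)]] schwartz_bound[OF *(3)], where a=1 and d=1]
      by (simp add: *(1))
  next
    case (4 f b)
    then obtain \<phi> \<psi> where *: "f = (\<lambda>x. of_real (x \<bullet> c) * \<phi> x + \<psi> x)" "schwartz \<phi>" "schwartz \<psi>" by auto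
    have eq: "pderiv_dir b f = (\<lambda>x. of_real (x \<bullet> c) * pderiv_dir b \<phi> x + (of_real (b \<bullet> c) * \<phi> x + 1 * pderiv_dir b \<psi> x))"
      unfolding *(1) by (rule pderiv_dir_eqI) (auto intro!: derivative_eq_intros schwartz_has_derivative * simp: add.assoc)
    show ?case
      unfolding eq 
      by (rule CollectI, rule exI[of _ "pderiv_dir b \<phi>"], rule exI[of _ "\<lambda>x. of_real (b \<bullet> c) * \<phi> x + 1 * pderiv_dir b \<psi> x"])
         (intro conjI refl schwartz_lincomb schwartz_pderiv_dir * 4)
  qed
  then show ?thesis by simp
qed

text \<open>Polynomials times one fixed Gaussian, generated by rules so that closure under
  derivatives becomes a rule induction.\<close>

inductive poly_gaussian :: "real \<Rightarrow> 'a::euclidean_space \<Rightarrow> ('a \<Rightarrow> complex) \<Rightarrow> bool" for \<epsilon> c where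
  "poly_gaussian \<epsilon> c (\<lambda>x. of_real (gaussian \<epsilon> (x - c)))"
| "poly_gaussian \<epsilon> c f \<Longrightarrow> poly_gaussian \<epsilon> c (\<lambda>x. of_real (x \<bullet> b) * f x)"
| "poly_gaussian \<epsilon> c f \<Longrightarrow> poly_gaussian \<epsilon> c g \<Longrightarrow> poly_gaussian \<epsilon> c (\<lambda>x. a * f x + d * g x)"

lemma gaussian_has_derivative:
  "((\<lambda>x. complex_of_real (gaussian \<epsilon> (x - c))) has_derivative
     (\<lambda>h. - of_real (\<epsilon>\<^sup>2 * ((x - c) \<bullet> h)) * of_real (gaussian \<epsilon> (x - c)))) (at x)"
proof -
  have *: "(\<lambda>x. complex_of_real (gaussian \<epsilon> (x - c))) = (\<lambda>x. of_real (exp (- \<epsilon>\<^sup>2 * ((x - c) \<bullet> (x - c)) / 2)))"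
    by (auto simp: gaussian_def power_mult_distrib power2_norm_eq_inner)
  show ?thesis
    unfolding *
    by (auto intro!: derivative_eq_intros simp: gaussian_def power_mult_distrib power2_norm_eq_inner inner_commute)
qed

text \<open>With r the distance from \<open>c\<close>, the polynomial weight is at most a constant
  times exp (N r), and completing the square bounds the total exponent N r - (\<epsilon> r)^2 /
  2.\<close>

lemma gaussian_decay:
  fixes c :: "'a::euclidean_space"
  assumes "\<epsilon> > 0"
  shows "\<exists>B. \<forall>x. (1 + norm x) ^ N * norm (complex_of_real (gaussian \<epsilon> (x - c))) \<le> B"
proof -
  have "(1 + norm x) ^ N * norm (complex_of_real (gaussian \<epsilon> (x - c))) \<le> (1 + norm c) ^ N * exp ((real N)\<^sup>2 / (2 * \<epsilon>\<^sup>2))" for x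
  proof -
    define r where "r = norm (x - c)"
    have "norm x \<le> norm c + r" unfolding r_def by (metis norm_triangle_sub)
    also have "1 + (norm c + r) \<le> (1 + norm c) * (1 + r)" by (simp add: algebra_simps r_def)
    finally have "(1 + norm x) ^ N \<le> ((1 + norm c) * (1 + r)) ^ N" by (intro power_mono) auto
    also have "\<dots> \<le> (1 + norm c) ^ N * exp (N * r)"
      unfolding power_mult_distrib exp_of_nat_mult
      by (intro mult_left_mono power_mono exp_ge_add_one_self) (auto simp: r_def)
    finally have "(1 + norm x) ^ N * gaussian \<epsilon> (x - c) \<le> (1 + norm c) ^ N * exp (N * r) * gaussian \<epsilon> (x - c)"
      by (intro mult_right_mono) auto
    also have "\<dots> = (1 + norm c) ^ N * exp (N * r - (\<epsilon> * r)\<^sup>2 / 2)"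
      by (simp add: gaussian_def r_def mult.assoc exp_add[symmetric])
    also have "\<dots> \<le> (1 + norm c) ^ N * exp ((real N)\<^sup>2 / (2 * \<epsilon>\<^sup>2))"
    proof -
      have "0 \<le> (N / \<epsilon> - \<epsilon> * r)\<^sup>2" by simp
      also have "\<dots> = (real N)\<^sup>2 / \<epsilon>\<^sup>2 - 2 * (N * r) + (\<epsilon> * r)\<^sup>2"
        using assms by (simp add: power2_diff power_divide)
      finally have "N * r - (\<epsilon> * r)\<^sup>2 / 2 \<le> (real N)\<^sup>2 / (2 * \<epsilon>\<^sup>2)" by (simp add: field_simps)
      then show ?thesis by (intro mult_left_mono) auto
    qed
    finally show ?thesis by simp
  qed
  then show ?thesis by blast
qed

text \<open>The three claims are proved together because the derivative of a compound expression can
  be computed only once its parts are known to be differentiable.\<close>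

lemma poly_gaussian_schwartz_aux:
  fixes f :: "'a::euclidean_space \<Rightarrow> complex"
  assumes "\<epsilon> > 0" "poly_gaussian \<epsilon> c f"
  shows "f differentiable (at x)" "\<exists>B. \<forall>x. (1 + norm x) ^ N * norm (f x) \<le> B" "poly_gaussian \<epsilon> c (pderiv_dir b f)"
proof -
  have "(\<forall>x. f differentiable (at x)) \<and> (\<forall>N. \<exists>B. \<forall>x. (1 + norm x) ^ N * norm (f x) \<le> B) \<and> poly_gaussian \<epsilon> c (pderiv_dir b f)"
    using assms(2)
  proof induction
    case 1
    have "pderiv_dir b (\<lambda>x. complex_of_real (gaussian \<epsilon> (x - c))) =
      (\<lambda>x. of_real (- \<epsilon>\<^sup>2) * (of_real (x \<bullet> b) * of_real (gaussian \<epsilon> (x - c))) + of_real (\<epsilon>\<^sup>2 * (c \<bullet> b)) * of_real (gaussian \<epsilon> (x - c)))"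
      by (subst pderiv_dir_eqI[OF gaussian_has_derivative]) (auto simp: algebra_simps)
    moreover have "poly_gaussian \<epsilon> c \<dots>" by (intro poly_gaussian.intros)
    ultimately have "poly_gaussian \<epsilon> c (pderiv_dir b (\<lambda>x. complex_of_real (gaussian \<epsilon> (x - c))))" by (simp only:)
    then show ?case
      by (intro conjI allI gaussian_decay[OF assms(1)] differentiableI[OF gaussian_has_derivative])
  next
    case (2 f c')
    have d: "(f has_derivative frechet_derivative f (at x)) (at x)" for x
      using 2 frechet_derivative_works by blast
    have "pderiv_dir b (\<lambda>x. of_real (x \<bullet> c') * f x) = (\<lambda>x. of_real (b \<bullet> c') * f x + 1 * (of_real (x \<bullet> c') * pderiv_dir b f x))"
      by (rule pderiv_dir_eqI) (auto intro!: derivative_eq_intros d)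
    moreover have "poly_gaussian \<epsilon> c \<dots>" using 2 by (intro poly_gaussian.intros) auto
    ultimately have "poly_gaussian \<epsilon> c (pderiv_dir b (\<lambda>x. of_real (x \<bullet> c') * f x))" by (simp only:)
    with 2 show ?case
      by (intro conjI allI weighted_bound_coord differentiable_mult differentiable_coord) (auto simp del: power_Suc)
  next
    case (3 f g a d)
    have d: "(f has_derivative frechet_derivative f (at x)) (at x)" "(g has_derivative frechet_derivative g (at x)) (at x)" for x
      using 3 frechet_derivative_works by blast+
    have "pderiv_dir b (\<lambda>x. a * f x + d * g x) = (\<lambda>x. a * pderiv_dir b f x + d * pderiv_dir b g x)"
      by (rule pderiv_dir_eqI) (auto intro!: derivative_eq_intros d)
    moreover have "poly_gaussian \<epsilon> c \<dots>" using 3 by (intro poly_gaussian.intros) auto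
    ultimately have "poly_gaussian \<epsilon> c (pderiv_dir b (\<lambda>x. a * f x + d * g x))" by (simp only:)
    with 3 show ?case
      by (intro conjI allI weighted_bound_add differentiable_add differentiable_mult differentiable_const) auto
  qed
  then show "f differentiable (at x)" "\<exists>B. \<forall>x. (1 + norm x) ^ N * norm (f x) \<le> B" "poly_gaussian \<epsilon> c (pderiv_dir b f)"
    by auto
qed

lemma schwartz_gaussian: "\<epsilon> > 0 \<Longrightarrow> schwartz (\<lambda>x. of_real (gaussian \<epsilon> (x - c)))"
  by (rule schwartz_coinduct[where S="Collect (poly_gaussian \<epsilon> c)"])
     (auto simp: poly_gaussian_schwartz_aux intro: poly_gaussian.intros)

text \<open>Each coordinate takes two of the \<open>2 * DIM('a)\<close> powers, and the resulting
  product of functions \<open>inverse (1 + y\<^sup>2)\<close> is integrable. The exponent recurs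
  wherever decay is turned into integrability.\<close>

lemma integrable_inverse_weight:
  "integrable lborel (\<lambda>x::'a::euclidean_space. 1 / (1 + norm x) ^ (2 * DIM('a)))"
proof (rule Bochner_Integration.integrable_bound)
  have "integrable lborel (\<lambda>x::real. inverse (1 + x\<^sup>2))"
    using integrable_inverse_1_plus_square by (simp add: set_integrable_def)
  then show "integrable lborel (\<lambda>x::'a. \<Prod>b\<in>Basis. inverse (1 + (x \<bullet> b)\<^sup>2))"
    by (intro integrable_lborel_prod)
  have "1 / (1 + norm x) ^ (2 * DIM('a)) \<le> (\<Prod>b\<in>Basis. inverse (1 + (x \<bullet> b)\<^sup>2))" for x :: 'a
  proof -
    have "1 / (1 + norm x) ^ (2 * DIM('a)) = (\<Prod>b\<in>(Basis::'a set). inverse ((1 + norm x)\<^sup>2))"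
      by (simp add: power_mult divide_inverse power_inverse[symmetric])
    also have "\<dots> \<le> (\<Prod>b\<in>Basis. inverse (1 + (x \<bullet> b)\<^sup>2))"
    proof (rule prod_mono, rule conjI)
      fix b :: 'a assume "b \<in> Basis"
      then have "(x \<bullet> b)\<^sup>2 \<le> (norm x)\<^sup>2" by (metis Basis_le_norm abs_le_square_iff abs_norm_cancel)
      also have "1 + (norm x)\<^sup>2 \<le> (1 + norm x)\<^sup>2" by (simp add: power2_eq_square algebra_simps)
      finally have "1 + (x \<bullet> b)\<^sup>2 \<le> (1 + norm x)\<^sup>2" by simp
      then show "inverse ((1 + norm x)\<^sup>2) \<le> inverse (1 + (x \<bullet> b)\<^sup>2)"
        by (intro le_imp_inverse_le) (auto intro: add_pos_nonneg)
    qed auto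
    finally show ?thesis .
  qed
  then show "AE x in lborel. norm (1 / (1 + norm x) ^ (2 * DIM('a))) \<le> norm (\<Prod>b\<in>Basis. inverse (1 + ((x::'a) \<bullet> b)\<^sup>2))"
    by (intro AE_I2) (simp add: prod_nonneg abs_of_nonneg)
qed auto

lemma integrable_of_weighted_bound:
  fixes f :: "'a::euclidean_space \<Rightarrow> complex"
  assumes [measurable]: "f \<in> borel_measurable borel"
    and bd: "\<And>x. (1 + norm x) ^ (2 * DIM('a)) * norm (f x) \<le> B"
  shows "integrable lborel f"
proof (rule Bochner_Integration.integrable_bound)
  show "integrable lborel (\<lambda>x::'a. B * (1 / (1 + norm x) ^ (2 * DIM('a))))"
    by (intro integrable_mult_right integrable_inverse_weight)
  show "AE x in lborel. norm (f x) \<le> norm (B * (1 / (1 + norm x) ^ (2 * DIM('a))))"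
  proof (rule AE_I2)
    fix x :: 'a
    have p: "(1 + norm x) ^ (2 * DIM('a)) > 0" by (intro zero_less_power) (auto intro: add_pos_nonneg)
    have "norm (f x) \<le> B * (1 / (1 + norm x) ^ (2 * DIM('a)))"
      using bd[of x] p by (simp add: pos_le_divide_eq mult.commute)
    then show "norm (f x) \<le> norm (B * (1 / (1 + norm x) ^ (2 * DIM('a))))"
      by (rule order_trans) (simp only: real_norm_def abs_ge_self)
  qed
qed auto

lemma schwartz_measurable [measurable_dest]: "schwartz \<phi> \<Longrightarrow> \<phi> \<in> borel_measurable borel"
  by (intro borel_measurable_continuous_onI differentiable_imp_continuous_on)
     (simp add: differentiable_on_def differentiable_at_withinI schwartz_differentiable)

lemma schwartz_integrable: "schwartz \<phi> \<Longrightarrow> integrable lborel \<phi>"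
  using schwartz_bound[of \<phi>] integrable_of_weighted_bound[OF schwartz_measurable] by blast

lemma schwartz_integrable_weighted:
  fixes \<phi> :: "'a::euclidean_space \<Rightarrow> complex"
  assumes "schwartz \<phi>"
  shows "integrable lborel (\<lambda>x. norm x ^ k * norm (\<phi> x))"
proof -
  have [measurable]: "\<phi> \<in> borel_measurable borel" using assms by measurable
  obtain B where B: "\<And>x. (1 + norm x) ^ (k + 2 * DIM('a)) * norm (\<phi> x) \<le> B" using schwartz_bound[OF assms] by blast
  have "integrable lborel (\<lambda>x. complex_of_real (norm x ^ k * norm (\<phi> x)))"
  proof (rule integrable_of_weighted_bound)
    fix x :: 'a
    have "(1 + norm x) ^ (2 * DIM('a)) * norm (complex_of_real (norm x ^ k * norm (\<phi> x)))
       \<le> (1 + norm x) ^ (2 * DIM('a)) * ((1 + norm x) ^ k * norm (\<phi> x))"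
      unfolding norm_of_real by (intro mult_left_mono) (auto simp: abs_mult intro!: mult_right_mono power_mono)
    also have "\<dots> \<le> B" using B[of x] by (simp add: power_add mult_ac)
    finally show "(1 + norm x) ^ (2 * DIM('a)) * norm (complex_of_real (norm x ^ k * norm (\<phi> x))) \<le> B" .
  qed measurable
  then show ?thesis by (simp only: complex_of_real_integrable_eq)
qed

text \<open>A real \<open>SUP\<close> bounds its members only if they are bounded above. This holds
  because there are finitely many lists of basis vectors of length at most \<open>N\<close>; the
  empty list yields the function itself.\<close>

lemma schwartz_seminorm_upper:
  fixes \<phi> :: "'a::euclidean_space \<Rightarrow> complex"
  assumes "schwartz \<phi>"
  shows "(1 + norm x) ^ N * norm (\<phi> x) \<le> schwartz_seminorm N \<phi>"
proof -
  let ?f = "\<lambda>(bs, x::'a). (1 + norm x) ^ N * norm (iter_deriv bs \<phi> x)"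
  let ?L = "{bs \<in> lists (Basis :: 'a set). length bs \<le> N}"
  have "finite ?L" using finite_lists_length_le[of "Basis :: 'a set" N] by (simp add: lists_eq_set conj_commute Collect_conj_eq[symmetric])
  moreover have "bdd_above (?f ` ({bs} \<times> UNIV))" if bs: "bs \<in> ?L" for bs
  proof -
    obtain B where "\<forall>x. (1 + norm x) ^ N * norm (iter_deriv bs \<phi> x) \<le> B"
      using assms bs unfolding schwartz_def by blast
    then show ?thesis by (intro bdd_aboveI[of _ B]) auto
  qed
  moreover have "?f ` (?L \<times> UNIV) = (\<Union>bs\<in>?L. ?f ` ({bs} \<times> UNIV))" by auto
  ultimately have "bdd_above (?f ` (?L \<times> UNIV))" by (simp add: bdd_above_UN)
  then have "?f ([], x) \<le> (SUP p\<in>?L \<times> UNIV. ?f p)" by (rule cSUP_upper[rotated]) auto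
  then show ?thesis unfolding schwartz_seminorm_def by simp
qed

lemma schwartz_seminorm_nonneg: "schwartz \<phi> \<Longrightarrow> 0 \<le> schwartz_seminorm N \<phi>"
  by (rule order_trans[OF _ schwartz_seminorm_upper[of _ 0]]) auto

section \<open>Fourier transform and inversion on Schwartz functions\<close>

lemma norm_cis_minus_1_le: "norm (cis \<theta> - 1) \<le> \<bar>\<theta>\<bar>"
  using iexp_approx1[of \<theta> 0] by (simp add: cis_conv_exp)

lemma norm_cis_approx2: "norm (cis \<theta> - 1 - \<i> * of_real \<theta>) \<le> \<theta>\<^sup>2"
proof -
  have "norm (cis \<theta> - 1 - \<i> * of_real \<theta>) * 2 \<le> \<theta>\<^sup>2"
    using iexp_approx1[of \<theta> 1] by (simp add: cis_conv_exp power2_eq_square diff_diff_eq)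
  then show ?thesis using norm_ge_zero[of "cis \<theta> - 1 - \<i> * of_real \<theta>"] by linarith
qed

lemma has_derivative_quadratic:
  assumes L: "bounded_linear L" and bd: "\<And>h. norm (f (x + h) - f x - L h) \<le> C * (norm h)\<^sup>2"
  shows "(f has_derivative L) (at x)"
  unfolding has_derivative_at
proof (intro conjI L)
  show "(\<lambda>h. norm (f (x + h) - f x - L h) / norm h) \<midarrow>0\<rightarrow> 0"
  proof (rule Lim_null_comparison)
    show "\<forall>\<^sub>F h in at 0. norm (norm (f (x + h) - f x - L h) / norm h) \<le> C * norm h"
      using bd by (intro always_eventually allI)
        (auto simp: divide_le_eq power2_eq_square mult.assoc)
    show "((\<lambda>h. C * norm h) \<longlongrightarrow> 0) (at (0::'a))"
      by (intro tendsto_mult_right_zero tendsto_norm_zero tendsto_ident_at)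
  qed
qed

text \<open>Differentiation under the integral sign: the second-order remainder of the phase is at
  most \<open>(w \<bullet> A x)\<^sup>2\<close>, so the second moment of \<open>h\<close> controls
  the error quadratically. The map \<open>A\<close> serves two purposes: \<open>A x = - x\<close>
  gives the derivative of the Fourier transform, \<open>A \<xi> = norm \<xi>\<close> the time
  derivative of a wave.\<close>

lemma has_derivative_phase_integral:
  fixes A :: "'a::euclidean_space \<Rightarrow> 'v::euclidean_space" and h :: "'a \<Rightarrow> complex"
  assumes [measurable]: "A \<in> borel_measurable borel"
    and h: "integrable lborel h" "integrable lborel (\<lambda>x. norm (A x) * norm (h x))"
      "integrable lborel (\<lambda>x. (norm (A x))\<^sup>2 * norm (h x))"
  shows "((\<lambda>v. LINT x|lborel. cis (v \<bullet> A x) * h x) has_derivative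
     (\<lambda>w. LINT x|lborel. cis (v \<bullet> A x) * (\<i> * of_real (w \<bullet> A x) * h x))) (at v)"
proof (rule has_derivative_quadratic)
  have [measurable]: "h \<in> borel_measurable borel" using h by simp
  have i1: "integrable lborel (\<lambda>x. cis (v \<bullet> A x) * (\<i> * of_real (w \<bullet> A x) * h x))" for w v
    by (rule Bochner_Integration.integrable_bound[OF integrable_mult_right[OF h(2), of "norm w"]])
       (auto simp: norm_mult mult.assoc[symmetric] intro!: mult_right_mono Cauchy_Schwarz_ineq2)
  have i0: "integrable lborel (\<lambda>x. cis (v \<bullet> A x) * h x)" for v
    by (rule Bochner_Integration.integrable_bound[OF h(1)]) (auto simp: norm_mult)
  show "bounded_linear (\<lambda>w. LINT x|lborel. cis (v \<bullet> A x) * (\<i> * of_real (w \<bullet> A x) * h x))"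
  proof (rule bounded_linear_intro)
    fix w w' :: 'v and r :: real
    show "(LINT x|lborel. cis (v \<bullet> A x) * (\<i> * of_real ((w + w') \<bullet> A x) * h x)) =
       (LINT x|lborel. cis (v \<bullet> A x) * (\<i> * of_real (w \<bullet> A x) * h x)) + (LINT x|lborel. cis (v \<bullet> A x) * (\<i> * of_real (w' \<bullet> A x) * h x))"
      by (subst Bochner_Integration.integral_add[symmetric, OF i1 i1]) (simp add: inner_add_left algebra_simps)
    show "(LINT x|lborel. cis (v \<bullet> A x) * (\<i> * of_real ((r *\<^sub>R w) \<bullet> A x) * h x)) =
       r *\<^sub>R (LINT x|lborel. cis (v \<bullet> A x) * (\<i> * of_real (w \<bullet> A x) * h x))"
      by (subst integral_scaleR_right[symmetric]) (simp add: scaleR_conv_of_real mult_ac)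
    have "norm (LINT x|lborel. cis (v \<bullet> A x) * (\<i> * of_real (w \<bullet> A x) * h x)) \<le> (LINT x|lborel. norm w * (norm (A x) * norm (h x)))"
      by (rule Bochner_Integration.integral_norm_bound_integral[OF i1])
         (use integrable_mult_right[OF h(2), of "norm w"] in \<open>auto simp: norm_mult mult.assoc[symmetric] intro!: mult_right_mono Cauchy_Schwarz_ineq2\<close>)
    then show "norm (LINT x|lborel. cis (v \<bullet> A x) * (\<i> * of_real (w \<bullet> A x) * h x)) \<le> norm w * (LINT x|lborel. norm (A x) * norm (h x))"
      by simp
  qed
  fix w :: 'v
  have "(LINT x|lborel. cis ((v + w) \<bullet> A x) * h x) - (LINT x|lborel. cis (v \<bullet> A x) * h x)
      - (LINT x|lborel. cis (v \<bullet> A x) * (\<i> * of_real (w \<bullet> A x) * h x))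
     = (LINT x|lborel. cis (v \<bullet> A x) * (cis (w \<bullet> A x) - 1 - \<i> * of_real (w \<bullet> A x)) * h x)"
    by (subst Bochner_Integration.integral_diff[symmetric, OF i0 i0],
        subst Bochner_Integration.integral_diff[symmetric, OF Bochner_Integration.integrable_diff[OF i0 i0] i1])
       (simp add: inner_add_left cis_mult[symmetric] algebra_simps)
  also have "norm \<dots> \<le> (LINT x|lborel. (norm w)\<^sup>2 * ((norm (A x))\<^sup>2 * norm (h x)))"
  proof -
    have *: "norm (cis (v \<bullet> A x) * (cis (w \<bullet> A x) - 1 - \<i> * of_real (w \<bullet> A x)) * h x) \<le> (norm w)\<^sup>2 * ((norm (A x))\<^sup>2 * norm (h x))" for x
    proof -
      have "norm (cis (w \<bullet> A x) - 1 - \<i> * of_real (w \<bullet> A x)) \<le> \<bar>w \<bullet> A x\<bar>\<^sup>2" using norm_cis_approx2 by simp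
      also have "\<dots> \<le> (norm w * norm (A x))\<^sup>2" by (intro power_mono Cauchy_Schwarz_ineq2) auto
      finally show ?thesis by (simp add: norm_mult mult.assoc[symmetric] power_mult_distrib mult_right_mono)
    qed
    show ?thesis
    proof (rule Bochner_Integration.integral_norm_bound_integral)
      show i: "integrable lborel (\<lambda>x. (norm w)\<^sup>2 * ((norm (A x))\<^sup>2 * norm (h x)))" using h(3) by simp
      show "integrable lborel (\<lambda>x. cis (v \<bullet> A x) * (cis (w \<bullet> A x) - 1 - \<i> * of_real (w \<bullet> A x)) * h x)"
        by (rule Bochner_Integration.integrable_bound[OF i]) (use * in \<open>auto intro: order_trans[OF _ abs_ge_self]\<close>)
    qed (rule *)
  qed
  also have "\<dots> = (LINT x|lborel. (norm (A x))\<^sup>2 * norm (h x)) * (norm w)\<^sup>2" by simp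
  finally show "norm ((LINT x|lborel. cis ((v + w) \<bullet> A x) * h x) - (LINT x|lborel. cis (v \<bullet> A x) * h x)
      - (LINT x|lborel. cis (v \<bullet> A x) * (\<i> * of_real (w \<bullet> A x) * h x))) \<le> (LINT x|lborel. (norm (A x))\<^sup>2 * norm (h x)) * (norm w)\<^sup>2" .
qed

lemma fourier_cis: "fourier \<phi> \<xi> = (LINT x|lborel. cis (\<xi> \<bullet> (- x)) * \<phi> x)"
  by (simp add: fourier_def cis_conv_exp inner_commute)

lemma inv_fourier_cis: "inv_fourier \<phi> x = (LINT \<xi>|lborel. cis (x \<bullet> \<xi>) * \<phi> \<xi>) / of_real ((2 * pi) ^ DIM('a))" for x :: "'a::euclidean_space"
  by (simp add: inv_fourier_def cis_conv_exp)

lemma inv_fourier_eq_fourier: "inv_fourier \<phi> x = fourier \<phi> (- x) / of_real ((2 * pi) ^ DIM('a))" for x :: "'a::euclidean_space"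
  by (simp add: inv_fourier_cis fourier_cis)

lemma inv_fourier_reflect: "inv_fourier (\<lambda>\<xi>. \<phi> (- \<xi>)) (- x) = inv_fourier \<phi> x" if "\<phi> \<in> borel_measurable borel" for x :: "'a::euclidean_space"
  using integral_lborel_affine[of "\<lambda>\<xi>. cis (x \<bullet> \<xi>) * \<phi> \<xi>" "-1" 0] that by (simp add: inv_fourier_cis)

lemma fourier_has_derivative:
  assumes "schwartz \<phi>"
  shows "(fourier \<phi> has_derivative (\<lambda>w. LINT x|lborel. cis (\<xi> \<bullet> (- x)) * (\<i> * of_real (w \<bullet> (- x)) * \<phi> x))) (at \<xi>)"
  unfolding fourier_cis[abs_def]
  by (rule has_derivative_phase_integral)
     (use schwartz_integrable_weighted[OF assms, of 1] schwartz_integrable_weighted[OF assms, of 2]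
       schwartz_integrable[OF assms] in auto)

text \<open>Instead of integrating by parts, one transforms the difference quotient along
  \<open>b\<close>. Translation invariance turns it into multiplication by
  \<open>(cis (t * (b \<bullet> \<xi>)) - 1) / t\<close>, and dominated convergence gives the limit
  on the other side.\<close>

lemma fourier_pderiv_dir:
  fixes \<phi> :: "'a::euclidean_space \<Rightarrow> complex"
  assumes \<phi>: "schwartz \<phi>" and b: "b \<in> Basis"
  shows "fourier (pderiv_dir b \<phi>) \<xi> = \<i> * of_real (b \<bullet> \<xi>) * fourier \<phi> \<xi>"
proof -
  have [measurable]: "\<phi> \<in> borel_measurable borel" "pderiv_dir b \<phi> \<in> borel_measurable borel"
    using \<phi> schwartz_pderiv_dir[OF \<phi> b] by measurable
  define t where "t n = 1 / real (Suc n)" for n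
  have t: "t n > 0" "t n \<le> 1" for n by (auto simp: t_def)
  have t0: "t \<longlonglongrightarrow> 0" unfolding t_def by (rule LIMSEQ_inverse_real_of_nat[unfolded inverse_eq_divide])
  obtain B where B: "\<And>x. (1 + norm x) ^ (2 * DIM('a)) * norm (pderiv_dir b \<phi> x) \<le> B"
    using schwartz_bound[OF schwartz_pderiv_dir[OF \<phi> b]] by blast
  \<comment> \<open>Majorant of all difference quotients: a shift by at most 1 changes
    \<open>1 + norm x\<close> by a factor of at most 2, hence the power of 2.\<close>
  define W where "W x = B * 2 ^ (2 * DIM('a)) * (1 / (1 + norm x) ^ (2 * DIM('a)))" for x :: 'a
  have deriv_le: "norm (pderiv_dir b \<phi> (x + s *\<^sub>R b)) \<le> W x" if "0 \<le> s" "s \<le> 1" for x s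
  proof -
    have "norm x \<le> norm (x + s *\<^sub>R b) + norm (s *\<^sub>R b)" using norm_triangle_ineq4[of "x + s *\<^sub>R b" "s *\<^sub>R b"] by simp
    also have "\<dots> \<le> norm (x + s *\<^sub>R b) + 1" using that b by simp
    finally have "1 + norm x \<le> 1 + (norm (x + s *\<^sub>R b) + 1)" by (rule add_left_mono)
    also have "\<dots> \<le> 2 * (1 + norm (x + s *\<^sub>R b))" by simp
    finally have "1 + norm x \<le> 2 * (1 + norm (x + s *\<^sub>R b))" .
    then have "(1 + norm x) ^ (2 * DIM('a)) \<le> 2 ^ (2 * DIM('a)) * (1 + norm (x + s *\<^sub>R b)) ^ (2 * DIM('a))"
      unfolding power_mult_distrib[symmetric] by (intro power_mono) auto
    then have "(1 + norm x) ^ (2 * DIM('a)) * norm (pderiv_dir b \<phi> (x + s *\<^sub>R b)) \<le>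
       2 ^ (2 * DIM('a)) * ((1 + norm (x + s *\<^sub>R b)) ^ (2 * DIM('a)) * norm (pderiv_dir b \<phi> (x + s *\<^sub>R b)))"
      unfolding mult.assoc[symmetric] by (rule mult_right_mono) simp
    also have "\<dots> \<le> 2 ^ (2 * DIM('a)) * B" by (intro mult_left_mono B) auto
    finally have le: "(1 + norm x) ^ (2 * DIM('a)) * norm (pderiv_dir b \<phi> (x + s *\<^sub>R b)) \<le> 2 ^ (2 * DIM('a)) * B" .
    have p: "(1 + norm x) ^ (2 * DIM('a)) > 0" by (intro zero_less_power add_pos_nonneg) auto
    show ?thesis
      unfolding W_def times_divide_eq_right mult_1_right pos_le_divide_eq[OF p] using le by (simp only: mult.commute)
  qed
  define q where "q n x = (\<phi> (x + t n *\<^sub>R b) - \<phi> x) / of_real (t n)" for n x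
  have g: "((\<lambda>s. \<phi> (x + s *\<^sub>R b)) has_vector_derivative pderiv_dir b \<phi> (x + s *\<^sub>R b)) (at s)" for x s
  proof -
    have "((\<lambda>s. \<phi> (x + s *\<^sub>R b)) has_derivative (\<lambda>r. frechet_derivative \<phi> (at (x + s *\<^sub>R b)) (r *\<^sub>R b))) (at s)"
      by (rule has_derivative_compose[of "\<lambda>s. x + s *\<^sub>R b" _ _ _ \<phi>, OF _ schwartz_has_derivative[OF \<phi>]]) (auto intro!: derivative_eq_intros)
    then show ?thesis
      unfolding has_vector_derivative_def
      by (simp add: linear_cmul[OF has_derivative_linear[OF schwartz_has_derivative[OF \<phi>]]])
  qed
  have q_le: "norm (q n x) \<le> W x" for n x
  proof -
    have "norm (\<phi> (x + t n *\<^sub>R b) - \<phi> (x + 0 *\<^sub>R b)) \<le> W x * norm (t n - 0)"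
    proof (rule differentiable_bound[of "{0..1}" _ "\<lambda>s r. r *\<^sub>R pderiv_dir b \<phi> (x + s *\<^sub>R b)"])
      fix s :: real assume s: "s \<in> {0..1}"
      show "((\<lambda>s. \<phi> (x + s *\<^sub>R b)) has_derivative (\<lambda>r. r *\<^sub>R pderiv_dir b \<phi> (x + s *\<^sub>R b))) (at s within {0..1})"
        using g[of x s] unfolding has_vector_derivative_def by (rule has_derivative_at_withinI)
      show "onorm (\<lambda>r. r *\<^sub>R pderiv_dir b \<phi> (x + s *\<^sub>R b)) \<le> W x"
        by (rule onorm_le) (use deriv_le[of s x] s in \<open>auto simp: mult.commute[of "W x"] intro!: mult_left_mono\<close>)
    qed (use t[of n] in auto)
    then show ?thesis using t[of n] by (simp add: q_def norm_divide divide_le_eq)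
  qed
  have q_lim: "(\<lambda>n. q n x) \<longlonglongrightarrow> pderiv_dir b \<phi> x" for x
  proof -
    have "(\<lambda>h. norm (\<phi> (x + (0 + h) *\<^sub>R b) - \<phi> (x + 0 *\<^sub>R b) - h *\<^sub>R pderiv_dir b \<phi> (x + 0 *\<^sub>R b)) / norm h) \<midarrow>0\<rightarrow> 0"
      using g[of x 0] unfolding has_vector_derivative_def has_derivative_at by blast
    then have "(\<lambda>n. norm (\<phi> (x + (0 + t n) *\<^sub>R b) - \<phi> (x + 0 *\<^sub>R b) - t n *\<^sub>R pderiv_dir b \<phi> (x + 0 *\<^sub>R b)) / norm (t n)) \<longlonglongrightarrow> 0"
      by (rule filterlim_compose) (use t t0 in \<open>auto simp: filterlim_at less_imp_neq[symmetric]\<close>)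
    moreover have "norm (\<phi> (x + (0 + t n) *\<^sub>R b) - \<phi> (x + 0 *\<^sub>R b) - t n *\<^sub>R pderiv_dir b \<phi> (x + 0 *\<^sub>R b)) / norm (t n)
       = norm (q n x - pderiv_dir b \<phi> x)" for n
    proof -
      have "q n x - pderiv_dir b \<phi> x = (\<phi> (x + t n *\<^sub>R b) - \<phi> x - of_real (t n) * pderiv_dir b \<phi> x) / of_real (t n)"
        using t(1)[of n] by (simp add: q_def field_simps)
      then show ?thesis using t(1)[of n] by (simp only: norm_divide norm_of_real) (simp add: scaleR_conv_of_real)
    qed
    ultimately have "(\<lambda>n. norm (q n x - pderiv_dir b \<phi> x)) \<longlonglongrightarrow> 0" by simp
    then show ?thesis using tendsto_norm_zero_iff LIM_zero_iff by blast
  qed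
  have lim1: "(\<lambda>n. LINT x|lborel. cis (\<xi> \<bullet> (- x)) * q n x) \<longlonglongrightarrow> fourier (pderiv_dir b \<phi>) \<xi>"
    unfolding fourier_cis
  proof (rule integral_dominated_convergence[where w=W])
    show "integrable lborel W" unfolding W_def by (intro integrable_mult_right integrable_inverse_weight)
    show "(\<lambda>x. cis (\<xi> \<bullet> - x) * q n x) \<in> borel_measurable lborel" for n unfolding q_def by measurable
  qed (use q_le q_lim in \<open>auto simp: norm_mult intro!: tendsto_intros\<close>)
  have "(LINT x|lborel. cis (\<xi> \<bullet> (- x)) * q n x) = (cis (t n * (b \<bullet> \<xi>)) - 1) / of_real (t n) * fourier \<phi> \<xi>" for n
  proof -
    have i: "integrable lborel (\<lambda>x. cis (\<xi> \<bullet> (- x)) * \<phi> x)"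
      by (rule Bochner_Integration.integrable_bound[OF schwartz_integrable[OF \<phi>]]) (auto simp: norm_mult)
    have c: "cis (\<xi> \<bullet> (- x)) * \<phi> (x + t n *\<^sub>R b) = cis (t n * (b \<bullet> \<xi>)) * (cis (\<xi> \<bullet> (- (t n *\<^sub>R b + 1 *\<^sub>R x))) * \<phi> (t n *\<^sub>R b + 1 *\<^sub>R x))" for x
      by (simp add: mult.assoc[symmetric] cis_mult inner_diff_right inner_add_right inner_commute add.commute)
    have i': "integrable lborel (\<lambda>x. cis (\<xi> \<bullet> (- x)) * \<phi> (x + t n *\<^sub>R b))"
      unfolding c by (intro integrable_mult_right integrable_lborel_affine[OF i]) auto
    have "(LINT x|lborel. cis (\<xi> \<bullet> (- x)) * \<phi> (x + t n *\<^sub>R b)) = cis (t n * (b \<bullet> \<xi>)) * fourier \<phi> \<xi>"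
      unfolding c fourier_cis
      by (subst (2) integral_lborel_affine[where c=1 and t="t n *\<^sub>R b"]) auto
    moreover have "(LINT x|lborel. cis (\<xi> \<bullet> (- x)) * q n x) =
       ((LINT x|lborel. cis (\<xi> \<bullet> (- x)) * \<phi> (x + t n *\<^sub>R b)) - (LINT x|lborel. cis (\<xi> \<bullet> (- x)) * \<phi> x)) / of_real (t n)"
    proof -
      have "(LINT x|lborel. cis (\<xi> \<bullet> (- x)) * q n x) =
        (LINT x|lborel. (cis (\<xi> \<bullet> (- x)) * \<phi> (x + t n *\<^sub>R b) - cis (\<xi> \<bullet> (- x)) * \<phi> x) / of_real (t n))"
        by (simp add: q_def right_diff_distrib)
      also have "\<dots> = (LINT x|lborel. cis (\<xi> \<bullet> (- x)) * \<phi> (x + t n *\<^sub>R b) - cis (\<xi> \<bullet> (- x)) * \<phi> x) / of_real (t n)"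
        by (rule integral_divide_zero)
      finally show ?thesis unfolding Bochner_Integration.integral_diff[OF i' i] .
    qed
    ultimately show ?thesis by (simp add: fourier_cis algebra_simps diff_divide_distrib)
  qed
  moreover have "(\<lambda>n. (cis (t n * (b \<bullet> \<xi>)) - 1) / of_real (t n) * fourier \<phi> \<xi>) \<longlonglongrightarrow> \<i> * of_real (b \<bullet> \<xi>) * fourier \<phi> \<xi>"
  proof (rule tendsto_mult_right)
    have "((\<lambda>z. exp (z * (\<i> * of_real (b \<bullet> \<xi>)))) has_field_derivative \<i> * of_real (b \<bullet> \<xi>)) (at 0)"
      by (auto intro!: derivative_eq_intros)
    then have "((\<lambda>z. (exp (z * (\<i> * of_real (b \<bullet> \<xi>))) - 1) / z) \<longlongrightarrow> \<i> * of_real (b \<bullet> \<xi>)) (at 0)"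
      by (simp add: has_field_derivative_iff)
    then have "(\<lambda>n. (exp (of_real (t n) * (\<i> * of_real (b \<bullet> \<xi>))) - 1) / of_real (t n)) \<longlonglongrightarrow> \<i> * of_real (b \<bullet> \<xi>)"
    proof (rule filterlim_compose)
      have "(\<lambda>n. complex_of_real (t n)) \<longlonglongrightarrow> 0" using tendsto_of_real[OF t0, where 'a=complex] by simp
      moreover have "t n \<noteq> 0" for n using t(1)[of n] by simp
      ultimately show "filterlim (\<lambda>n. complex_of_real (t n)) (at 0) sequentially" by (simp add: filterlim_at)
    qed
    then show "(\<lambda>n. (cis (t n * (b \<bullet> \<xi>)) - 1) / of_real (t n)) \<longlonglongrightarrow> \<i> * of_real (b \<bullet> \<xi>)"
      by (simp add: cis_conv_exp mult_ac)
  qed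
  ultimately show ?thesis using lim1 LIMSEQ_unique by fastforce
qed

lemma norm_fourier_le: "integrable lborel \<phi> \<Longrightarrow> norm (fourier \<phi> \<xi>) \<le> (LINT x|lborel. norm (\<phi> x))"
  unfolding fourier_cis by (rule norm_fourier_integral_le)

text \<open>Induction on \<open>N\<close>: \<open>1 + norm \<xi>\<close> is at most 1 plus the sum
  of the moduli of the coordinates, and each coordinate is absorbed by passing to a partial
  derivative of \<phi>.\<close>

lemma fourier_decay:
  fixes \<phi> :: "'a::euclidean_space \<Rightarrow> complex"
  assumes "schwartz \<phi>"
  shows "\<exists>B. \<forall>\<xi>. (1 + norm \<xi>) ^ N * norm (fourier \<phi> \<xi>) \<le> B"
  using assms
proof (induction N arbitrary: \<phi>)
  case 0 then show ?case using norm_fourier_le[OF schwartz_integrable] by auto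
next
  case (Suc N)
  obtain B where B: "\<And>\<xi>. (1 + norm \<xi>) ^ N * norm (fourier \<phi> \<xi>) \<le> B" using Suc by blast
  have "\<forall>b\<in>Basis. \<exists>B. \<forall>\<xi>. (1 + norm \<xi>) ^ N * norm (fourier (pderiv_dir b \<phi>) \<xi>) \<le> B"
    using Suc.IH schwartz_pderiv_dir[OF Suc.prems] by blast
  then obtain C where C: "\<And>b \<xi>. b \<in> Basis \<Longrightarrow> (1 + norm \<xi>) ^ N * norm (fourier (pderiv_dir b \<phi>) \<xi>) \<le> C b" by metis
  have "(1 + norm \<xi>) ^ Suc N * norm (fourier \<phi> \<xi>) \<le> B + (\<Sum>b\<in>Basis. C b)" for \<xi>
  proof -
    have "(1 + norm \<xi>) ^ Suc N * norm (fourier \<phi> \<xi>) \<le> (1 + (\<Sum>b\<in>Basis. \<bar>\<xi> \<bullet> b\<bar>)) * ((1 + norm \<xi>) ^ N * norm (fourier \<phi> \<xi>))"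
      using norm_le_l1[of \<xi>] by (simp add: mult.assoc mult_right_mono)
    also have "\<dots> = (1 + norm \<xi>) ^ N * norm (fourier \<phi> \<xi>) + (\<Sum>b\<in>Basis. (1 + norm \<xi>) ^ N * norm (fourier (pderiv_dir b \<phi>) \<xi>))"
    proof -
      have "\<bar>\<xi> \<bullet> b\<bar> * ((1 + norm \<xi>) ^ N * norm (fourier \<phi> \<xi>)) = (1 + norm \<xi>) ^ N * norm (fourier (pderiv_dir b \<phi>) \<xi>)"
        if "b \<in> Basis" for b
        by (simp add: fourier_pderiv_dir[OF Suc.prems that] norm_mult inner_commute)
      then show ?thesis unfolding distrib_right sum_distrib_right by (simp only: mult_1 cong: sum.cong)
    qed
    also have "\<dots> \<le> B + (\<Sum>b\<in>Basis. C b)" by (intro add_mono B sum_mono C)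
    finally show ?thesis .
  qed
  then show ?case by blast
qed

text \<open>The transforms of Schwartz functions are closed under partial derivatives, since such a
  derivative multiplies the original function by a linear factor.\<close>

lemma schwartz_fourier:
  assumes "schwartz \<phi>" shows "schwartz (fourier \<phi>)"
proof (rule schwartz_coinduct[where S="{fourier \<phi> |\<phi>. schwartz \<phi>}"], goal_cases)
  case (2 f x) then show ?case using fourier_has_derivative by (auto intro: differentiableI)
next
  case (4 f b)
  then obtain \<phi> where *: "f = fourier \<phi>" "schwartz \<phi>" by auto
  have eq: "pderiv_dir b f = fourier (\<lambda>x. - \<i> * (of_real (x \<bullet> b) * \<phi> x))"
    unfolding *(1) by (subst pderiv_dir_eqI[OF fourier_has_derivative[OF *(2)]])
      (auto simp: fourier_cis inner_commute mult_ac)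
  show ?case unfolding eq by (rule CollectI, rule exI, rule conjI[OF refl]) (intro schwartz_cmult schwartz_coord *)
qed (use assms fourier_decay in auto)

lemma schwartz_inv_fourier:
  fixes \<phi> :: "'a::euclidean_space \<Rightarrow> complex"
  assumes "schwartz \<phi>" shows "schwartz (inv_fourier \<phi>)"
proof -
  have "inv_fourier \<phi> = (\<lambda>x. (1 / of_real ((2 * pi) ^ DIM('a))) * fourier \<phi> (- x))"
    by (auto simp: inv_fourier_eq_fourier)
  then show ?thesis using schwartz_cmult[OF schwartz_reflect[OF schwartz_fourier[OF assms]]] by (simp only:)
qed

text \<open>Damp the inverse integral by a Gaussian of parameter \<open>e i\<close>. Fubini turns it
  into an average of \<phi> at scale \<open>e i\<close> around \<open>x\<close>, while the damped
  integrals tend to the undamped one. The factor \<open>sqrt (2 * pi)\<close> per dimension enters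
  twice, from the transform of the Gaussian and from its integral.\<close>

lemma inv_fourier_fourier:
  fixes \<phi> :: "'a::euclidean_space \<Rightarrow> complex"
  assumes \<phi>: "schwartz \<phi>"
  shows "inv_fourier (fourier \<phi>) x = \<phi> x"
proof -
  have [measurable]: "\<phi> \<in> borel_measurable borel" "fourier \<phi> \<in> borel_measurable borel"
    using \<phi> schwartz_fourier[OF \<phi>] by measurable
  define e where "e i = 1 / real (Suc i)" for i
  have e: "e i > 0" for i by (simp add: e_def)
  have gi: "integrable lborel (\<lambda>\<xi>::'a. complex_of_real (gaussian (e i) \<xi>))" for i
    using integrable_gaussian[OF e] by (simp only: complex_of_real_integrable_eq)
  have gi': "integrable lborel (\<lambda>\<xi>::'a. complex_of_real (gaussian (e i) \<xi>) * cis (x \<bullet> \<xi>))" for i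
    by (rule Bochner_Integration.integrable_bound[OF gi[of i]]) (auto simp: norm_mult)
  have eq: "(LINT \<xi>|lborel. cis (x \<bullet> \<xi>) * fourier \<phi> \<xi> * of_real (gaussian (e i) \<xi>)) =
     of_real (sqrt (2 * pi) ^ DIM('a)) * (LINT z|lborel. \<phi> (x + e i *\<^sub>R z) * of_real (gaussian 1 z))" for i
  proof -
    have "(LINT \<xi>|lborel. cis (x \<bullet> \<xi>) * fourier \<phi> \<xi> * of_real (gaussian (e i) \<xi>)) =
      (LINT \<xi>|lborel. of_real (gaussian (e i) \<xi>) * cis (x \<bullet> \<xi>) * (LINT y|lborel. cis (\<xi> \<bullet> (- y)) * \<phi> y))"
      by (simp add: fourier_cis mult_ac)
    also have "\<dots> = (LINT y|lborel. \<phi> y * (LINT \<xi>|lborel. cis (\<xi> \<bullet> (- y)) * (of_real (gaussian (e i) \<xi>) * cis (x \<bullet> \<xi>))))"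
      by (rule bounded_kernel_Fubini[OF gi' schwartz_integrable[OF \<phi>]]) simp_all
    also have "(\<lambda>y. LINT \<xi>|lborel. cis (\<xi> \<bullet> (- y)) * (of_real (gaussian (e i) \<xi>) * cis (x \<bullet> \<xi>)))
      = (\<lambda>y. LINT \<xi>|lborel. cis (\<xi> \<bullet> (x - y)) * of_real (gaussian (e i) \<xi>))"
    proof (intro ext Bochner_Integration.integral_cong refl)
      fix y \<xi>
      have "cis (\<xi> \<bullet> (x - y)) = cis (\<xi> \<bullet> (- y)) * cis (x \<bullet> \<xi>)"
        by (simp add: cis_mult inner_diff_right inner_commute)
      then show "cis (\<xi> \<bullet> (- y)) * (of_real (gaussian (e i) \<xi>) * cis (x \<bullet> \<xi>)) = cis (\<xi> \<bullet> (x - y)) * of_real (gaussian (e i) \<xi>)"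
        by simp
    qed
    also have "\<dots> = (\<lambda>y. of_real ((sqrt (2 * pi) / e i) ^ DIM('a) * gaussian (1 / e i) (x - y)))"
      by (intro ext has_bochner_integral_integral_eq has_bochner_integral_cis_gaussian e)
    also have "(LINT y|lborel. \<phi> y * of_real ((sqrt (2 * pi) / e i) ^ DIM('a) * gaussian (1 / e i) (x - y))) =
       of_real (sqrt (2 * pi) ^ DIM('a)) * (LINT z|lborel. \<phi> (x + e i *\<^sub>R z) * of_real (gaussian 1 z))"
    proof -
      have g: "e i ^ DIM('a) * ((sqrt (2 * pi) / e i) ^ DIM('a) * gaussian (1 / e i) (x - (x + e i *\<^sub>R z))) = sqrt (2 * pi) ^ DIM('a) * gaussian 1 z" for z :: 'a
        using e[of i] by (simp add: gaussian_def power_divide)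
      have "(LINT y|lborel. \<phi> y * of_real ((sqrt (2 * pi) / e i) ^ DIM('a) * gaussian (1 / e i) (x - y))) =
        of_real (e i ^ DIM('a)) * (LINT z|lborel. \<phi> (x + e i *\<^sub>R z) * of_real ((sqrt (2 * pi) / e i) ^ DIM('a) * gaussian (1 / e i) (x - (x + e i *\<^sub>R z))))"
        using e[of i] by (subst integral_lborel_affine[where c="e i" and t=x]) (auto simp: scaleR_conv_of_real)
      also have "\<dots> = (LINT z|lborel. \<phi> (x + e i *\<^sub>R z) * of_real (sqrt (2 * pi) ^ DIM('a) * gaussian 1 z))"
        unfolding g[symmetric] by (subst integral_mult_right_zero[symmetric]) (simp add: mult_ac)
      finally show ?thesis by (simp add: mult_ac flip: integral_mult_right_zero)
    qed
    finally show ?thesis .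
  qed
  obtain B where B: "\<And>x. norm (\<phi> x) \<le> B" using schwartz_bound[OF \<phi>, of 0] by auto
  have c: "continuous_on UNIV \<phi>"
    by (simp add: differentiable_imp_continuous_on differentiable_on_def differentiable_at_withinI schwartz_differentiable[OF \<phi>])
  have "(\<lambda>i. LINT \<xi>|lborel. cis (x \<bullet> \<xi>) * fourier \<phi> \<xi> * of_real (gaussian (e i) \<xi>)) \<longlonglongrightarrow>
     of_real (sqrt (2 * pi) ^ DIM('a)) * (\<phi> x * of_real (sqrt (2 * pi) ^ DIM('a)))"
    unfolding eq unfolding e_def by (intro tendsto_mult_left gaussian_approx_identity[OF c B])
  moreover have "(\<lambda>i. LINT \<xi>|lborel. cis (x \<bullet> \<xi>) * fourier \<phi> \<xi> * of_real (gaussian (e i) \<xi>)) \<longlonglongrightarrow>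
     (LINT \<xi>|lborel. cis (x \<bullet> \<xi>) * fourier \<phi> \<xi> * of_real 1)"
  proof (rule integral_dominated_convergence[where w="\<lambda>\<xi>. norm (fourier \<phi> \<xi>)"])
    show "AE \<xi> in lborel. (\<lambda>i. cis (x \<bullet> \<xi>) * fourier \<phi> \<xi> * of_real (gaussian (e i) \<xi>)) \<longlonglongrightarrow> cis (x \<bullet> \<xi>) * fourier \<phi> \<xi> * of_real 1"
      unfolding e_def by (intro AE_I2 tendsto_intros gaussian_tendsto)
  qed (use schwartz_integrable[OF schwartz_fourier[OF \<phi>]] in \<open>auto simp: norm_mult mult_left_le gaussian_le_1\<close>)
  ultimately have "(LINT \<xi>|lborel. cis (x \<bullet> \<xi>) * fourier \<phi> \<xi>) = of_real (sqrt (2 * pi) ^ DIM('a)) * (\<phi> x * of_real (sqrt (2 * pi) ^ DIM('a)))"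
    using LIMSEQ_unique by fastforce
  also have "\<dots> = of_real ((sqrt (2 * pi) * sqrt (2 * pi)) ^ DIM('a)) * \<phi> x"
    unfolding power_mult_distrib by (simp add: mult_ac)
  finally show ?thesis by (simp add: inv_fourier_cis)
qed

text \<open>The two transforms differ by a reflection and a constant, so inversion in this order
  follows from the other one.\<close>

lemma fourier_inv_fourier:
  fixes \<phi> :: "'a::euclidean_space \<Rightarrow> complex"
  assumes \<phi>: "schwartz \<phi>"
  shows "fourier (inv_fourier \<phi>) \<xi> = \<phi> \<xi>"
proof -
  have [measurable]: "fourier \<phi> \<in> borel_measurable borel"
    using schwartz_fourier[OF \<phi>] by measurable
  have "fourier (inv_fourier \<phi>) \<xi> = of_real ((2 * pi) ^ DIM('a)) * inv_fourier (inv_fourier \<phi>) (- \<xi>)"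
    by (simp add: inv_fourier_eq_fourier[of "inv_fourier \<phi>"])
  also have "inv_fourier (inv_fourier \<phi>) (- \<xi>) = inv_fourier (\<lambda>x. fourier \<phi> (- x)) (- \<xi>) / of_real ((2 * pi) ^ DIM('a))"
    by (simp add: inv_fourier_eq_fourier[where \<phi>=\<phi>, abs_def] inv_fourier_cis flip: integral_divide_zero)
  also have "inv_fourier (\<lambda>x. fourier \<phi> (- x)) (- \<xi>) = \<phi> \<xi>"
    using inv_fourier_reflect[of "fourier \<phi>" \<xi>] inv_fourier_fourier[OF \<phi>] by simp
  finally show ?thesis by simp
qed


section \<open>Square integrable data\<close>

text \<open>Kept as the square of the norm and extended real, so that estimates can be added and
  integrated before finiteness is known.\<close>

definition l2sq :: "('a::euclidean_space \<Rightarrow> complex) \<Rightarrow> ennreal" where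
  "l2sq f = (\<integral>\<^sup>+x. ennreal ((norm (f x))\<^sup>2) \<partial>lborel)"

lemma l2sq_cong_norm: "(\<And>x. norm (f x) = norm (g x)) \<Longrightarrow> l2sq f = l2sq g"
  unfolding l2sq_def by simp

text \<open>A weighted mean inequality in the role of Cauchy-Schwarz. Taking for \<open>a\<close> a
  bound of the norm of \<open>f\<close> makes the right side linear in that bound, so that summable
  norms give summable integrals.\<close>

lemma nn_integral_mult_le_l2sq:
  assumes [measurable]: "f \<in> borel_measurable borel" "g \<in> borel_measurable borel" and a: "a > 0"
  shows "(\<integral>\<^sup>+x. ennreal (norm (f x * g x)) \<partial>lborel) \<le> ennreal (1 / a) * l2sq f + ennreal a * l2sq g"
proof -
  have "norm (f x * g x) \<le> 1 / a * (norm (f x))\<^sup>2 + a * (norm (g x))\<^sup>2" for x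
  proof -
    have "0 \<le> (norm (f x) - a * norm (g x))\<^sup>2 / a + norm (f x) * norm (g x)" using a by simp
    also have "\<dots> = 1 / a * (norm (f x))\<^sup>2 + a * (norm (g x))\<^sup>2 - norm (f x) * norm (g x)"
      using a by (simp add: power2_eq_square field_simps)
    finally show ?thesis by (simp add: norm_mult)
  qed
  then have "(\<integral>\<^sup>+x. ennreal (norm (f x * g x)) \<partial>lborel) \<le>
    (\<integral>\<^sup>+x. ennreal (1 / a) * ennreal ((norm (f x))\<^sup>2) + ennreal a * ennreal ((norm (g x))\<^sup>2) \<partial>lborel)"
    using a by (intro nn_integral_mono) (simp add: ennreal_mult[symmetric] ennreal_plus[symmetric] del: ennreal_plus)
  also have "\<dots> = ennreal (1 / a) * l2sq f + ennreal a * l2sq g"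
    unfolding l2sq_def by (simp add: nn_integral_add nn_integral_cmult)
  finally show ?thesis .
qed

lemma integrable_mult_l2:
  assumes [measurable]: "f \<in> borel_measurable borel" "g \<in> borel_measurable borel"
    and "l2sq f < \<infinity>" "l2sq g < \<infinity>"
  shows "integrable lborel (\<lambda>x. f x * g x)"
proof (rule integrableI_bounded)
  show "(\<integral>\<^sup>+x. ennreal (norm (f x * g x)) \<partial>lborel) < \<infinity>"
    using nn_integral_mult_le_l2sq[OF assms(1,2), of 1] assms(3,4)
    by (simp add: order_le_less_trans ennreal_add_eq_top less_top)
qed simp

text \<open>The seminorm of order \<open>DIM('a)\<close>, once squared, provides just the
  \<open>2 * DIM('a)\<close> powers of decay that are integrable. The explicit dependence on the
  seminorm is what temperedness of L^2 data requires.\<close>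

lemma l2sq_schwartz:
  fixes \<phi> :: "'a::euclidean_space \<Rightarrow> complex"
  assumes \<phi>: "schwartz \<phi>"
  shows "l2sq \<phi> \<le> ennreal ((schwartz_seminorm DIM('a) \<phi>)\<^sup>2 * (LINT x::'a|lborel. 1 / (1 + norm x) ^ (2 * DIM('a))))"
proof -
  have "(norm (\<phi> x))\<^sup>2 \<le> (schwartz_seminorm DIM('a) \<phi>)\<^sup>2 * (1 / (1 + norm x) ^ (2 * DIM('a)))" for x
  proof -
    have p: "(1 + norm x) ^ (2 * DIM('a)) > 0" by (intro zero_less_power add_pos_nonneg) auto
    have "((1 + norm x) ^ DIM('a) * norm (\<phi> x))\<^sup>2 \<le> (schwartz_seminorm DIM('a) \<phi>)\<^sup>2"
      using schwartz_seminorm_upper[OF \<phi>] by (intro power_mono) auto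
    then have "(1 + norm x) ^ (2 * DIM('a)) * (norm (\<phi> x))\<^sup>2 \<le> (schwartz_seminorm DIM('a) \<phi>)\<^sup>2"
      by (simp add: power_mult_distrib power_mult[symmetric] mult.commute)
    then show ?thesis unfolding times_divide_eq_right mult_1_right pos_le_divide_eq[OF p] by (simp only: mult.commute)
  qed
  then have "l2sq \<phi> \<le> (\<integral>\<^sup>+x. ennreal ((schwartz_seminorm DIM('a) \<phi>)\<^sup>2 * (1 / (1 + norm (x::'a)) ^ (2 * DIM('a)))) \<partial>lborel)"
    unfolding l2sq_def by (intro nn_integral_mono ennreal_leI)
  also have "\<dots> = ennreal (LINT x::'a|lborel. (schwartz_seminorm DIM('a) \<phi>)\<^sup>2 * (1 / (1 + norm x) ^ (2 * DIM('a))))"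
    by (rule nn_integral_eq_integral[OF integrable_mult_right[OF integrable_inverse_weight]]) auto
  finally show ?thesis unfolding integral_mult_right_zero .
qed

lemma l2sq_schwartz_finite: "schwartz \<phi> \<Longrightarrow> l2sq \<phi> < \<infinity>"
  using l2sq_schwartz by (rule order_le_less_trans) auto

text \<open>Bessel's constant \<open>(2 * pi) ^ DIM('a)\<close> is outweighed by the squared
  normalisation of \<open>inv_fourier\<close>; the resulting factor is rounded up to 1.\<close>

lemma l2sq_inv_fourier_le:
  fixes h :: "'a::euclidean_space \<Rightarrow> complex"
  assumes h: "integrable lborel h"
  shows "l2sq (inv_fourier h) \<le> l2sq h"
proof -
  have [measurable]: "h \<in> borel_measurable borel" using h by simp
  let ?c = "(2 * pi) ^ DIM('a)"
  have c: "?c \<ge> 1" using pi_gt3 by (intro one_le_power) simp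
  have "l2sq (inv_fourier h) = (\<integral>\<^sup>+x. ennreal (1 / ?c\<^sup>2) * ennreal ((norm (LINT \<xi>|lborel. cis (x \<bullet> \<xi>) * h \<xi>))\<^sup>2) \<partial>lborel)"
    unfolding l2sq_def inv_fourier_cis
    by (intro nn_integral_cong) (simp add: norm_divide power_divide norm_mult norm_power ennreal_mult[symmetric])
  also have "\<dots> = ennreal (1 / ?c\<^sup>2) * (\<integral>\<^sup>+x. ennreal ((norm (LINT \<xi>|lborel. cis (x \<bullet> \<xi>) * h \<xi>))\<^sup>2) \<partial>lborel)"
    by (rule nn_integral_cmult) measurable
  also have "\<dots> \<le> ennreal (1 / ?c\<^sup>2) * (ennreal ?c * l2sq h)"
    unfolding l2sq_def by (intro mult_left_mono bessel h) simp
  also have "\<dots> = ennreal (1 / ?c) * l2sq h"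
    by (simp add: mult.assoc[symmetric] ennreal_mult[symmetric] power2_eq_square mult.commute[of "pi ^ _"])
  also have "\<dots> \<le> 1 * l2sq h"
    using c by (intro mult_right_mono) (auto simp: ennreal_le_1)
  finally show ?thesis by simp
qed

lemma measurable_inv_fourier [measurable (raw)]:
  assumes [measurable]: "h \<in> borel_measurable (borel :: 'a::euclidean_space measure)"
  shows "inv_fourier h \<in> borel_measurable borel"
proof -
  have "(\<lambda>x. (LINT \<xi>|lborel. cis (x \<bullet> \<xi>) * h \<xi>) / of_real ((2 * pi) ^ DIM('a))) \<in> borel_measurable borel"
    by measurable
  then show ?thesis unfolding inv_fourier_cis[abs_def] .
qed

section \<open>Series with summable L^2 norms\<close>

context
  fixes \<Psi> :: "nat \<Rightarrow> 'a::euclidean_space \<Rightarrow> complex" and a :: "nat \<Rightarrow> real"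
  assumes m [measurable]: "\<And>k. \<Psi> k \<in> borel_measurable borel"
    and a: "\<And>k. a k > 0" "summable a"
    and l2: "\<And>k. l2sq (\<Psi> k) \<le> ennreal ((a k)\<^sup>2)"
begin

lemma nn_integral_mult_l2_series:
  assumes [measurable]: "g \<in> borel_measurable borel" and g: "l2sq g < \<infinity>"
  shows "(\<Sum>k. \<integral>\<^sup>+x. ennreal (norm (\<Psi> k x * g x)) \<partial>lborel) < \<infinity>"
proof -
  obtain G where G: "l2sq g = ennreal G" "G \<ge> 0" using g by (cases "l2sq g") auto
  have "(\<integral>\<^sup>+x. ennreal (norm (\<Psi> k x * g x)) \<partial>lborel) \<le> ennreal ((1 + G) * a k)" for k
  proof -
    have "(\<integral>\<^sup>+x. ennreal (norm (\<Psi> k x * g x)) \<partial>lborel) \<le> ennreal (1 / a k) * l2sq (\<Psi> k) + ennreal (a k) * l2sq g"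
      by (rule nn_integral_mult_le_l2sq) (use a in auto)
    also have "\<dots> \<le> ennreal (1 / a k) * ennreal ((a k)\<^sup>2) + ennreal (a k) * ennreal G"
      unfolding G by (intro add_mono mult_left_mono l2) auto
    also have "\<dots> = ennreal ((1 + G) * a k)"
      using a(1)[of k] G(2)
      by (simp add: ennreal_mult[symmetric] ennreal_plus[symmetric] power2_eq_square algebra_simps del: ennreal_plus)
    finally show ?thesis .
  qed
  then have "(\<Sum>k. \<integral>\<^sup>+x. ennreal (norm (\<Psi> k x * g x)) \<partial>lborel) \<le> (\<Sum>k. ennreal ((1 + G) * a k))"
    by (intro suminf_le) auto
  also have "\<dots> < \<infinity>"
    using a G by (subst suminf_ennreal2) (auto intro: summable_mult simp: less_imp_le)
  finally show ?thesis .
qed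

lemma AE_summable_mult_l2_series:
  assumes [measurable]: "g \<in> borel_measurable borel" and g: "l2sq g < \<infinity>"
  shows "AE x in lborel. summable (\<lambda>k. norm (\<Psi> k x * g x))"
proof -
  have "(\<integral>\<^sup>+x. (\<Sum>k. ennreal (norm (\<Psi> k x * g x))) \<partial>lborel) \<noteq> \<infinity>"
    using nn_integral_mult_l2_series[OF assms] by (subst nn_integral_suminf) auto
  then have "AE x in lborel. (\<Sum>k. ennreal (norm (\<Psi> k x * g x))) \<noteq> \<infinity>"
    by (intro nn_integral_PInf_AE) auto
  then show ?thesis by eventually_elim (auto intro!: summable_suminf_not_top)
qed

text \<open>Pairing with a strictly positive square integrable function, here a Gaussian, turns
  convergence of integrals into convergence at almost every point.\<close>

lemma AE_summable_l2_series: "AE x in lborel. summable (\<lambda>k. norm (\<Psi> k x))"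
proof -
  have "AE x in lborel. summable (\<lambda>k. norm (\<Psi> k x * of_real (gaussian 1 x)))"
    using l2sq_schwartz_finite[OF schwartz_gaussian[of 1 "0 :: 'a"]]
    by (intro AE_summable_mult_l2_series) auto
  then show ?thesis
    by eventually_elim (simp add: norm_mult mult.commute[of "norm _"])
qed

lemma
  assumes [measurable]: "g \<in> borel_measurable borel" and g: "l2sq g < \<infinity>"
  shows integrable_mult_l2_series: "integrable lborel (\<lambda>x. (\<Sum>k. \<Psi> k x) * g x)"
    and sums_integral_mult_l2_series: "(\<lambda>k. LINT x|lborel. \<Psi> k x * g x) sums (LINT x|lborel. (\<Sum>k. \<Psi> k x) * g x)"
proof -
  have i: "integrable lborel (\<lambda>x. \<Psi> k x * g x)" for k
    by (rule integrable_mult_l2) (use g l2[of k] in \<open>auto intro: order_le_less_trans\<close>)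
  note s = AE_summable_mult_l2_series[OF assms]
  have "(\<Sum>k. ennreal (LINT x|lborel. norm (\<Psi> k x * g x))) < \<infinity>"
    using nn_integral_mult_l2_series[OF assms] i by (subst (asm) nn_integral_eq_integral) auto
  then have t: "summable (\<lambda>k. LINT x|lborel. norm (\<Psi> k x * g x))"
    by (intro summable_suminf_not_top) auto
  have eq: "AE x in lborel. (\<Sum>k. \<Psi> k x * g x) = (\<Sum>k. \<Psi> k x) * g x"
    using AE_summable_l2_series by eventually_elim (simp add: suminf_mult2 summable_norm_cancel)
  have "integrable lborel (\<lambda>x. \<Sum>k. \<Psi> k x * g x)" by (rule integrable_suminf[OF i s t])
  then show "integrable lborel (\<lambda>x. (\<Sum>k. \<Psi> k x) * g x)"
    by (rule integrable_cong_AE_imp) (use eq in \<open>auto simp: eq_commute\<close>)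
  have "(LINT x|lborel. (\<Sum>k. \<Psi> k x) * g x) = (LINT x|lborel. (\<Sum>k. \<Psi> k x * g x))"
    by (rule integral_cong_AE) (use eq in \<open>auto simp: eq_commute\<close>)
  then show "(\<lambda>k. LINT x|lborel. \<Psi> k x * g x) sums (LINT x|lborel. (\<Sum>k. \<Psi> k x) * g x)"
    using sums_integral[OF i s t] by simp
qed

end

lemma inv_fourier_duality:
  fixes h \<phi> :: "'a::euclidean_space \<Rightarrow> complex"
  assumes "integrable lborel h" "integrable lborel \<phi>"
  shows "(LINT x|lborel. inv_fourier h x * \<phi> x) = (LINT \<xi>|lborel. h \<xi> * inv_fourier \<phi> \<xi>)"
proof -
  have "(LINT x|lborel. \<phi> x * (LINT \<xi>|lborel. cis (x \<bullet> \<xi>) * h \<xi>)) = (LINT \<xi>|lborel. h \<xi> * (LINT x|lborel. cis (x \<bullet> \<xi>) * \<phi> x))"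
    by (rule bounded_kernel_Fubini) (use assms in simp_all)
  then show ?thesis
    by (simp add: inv_fourier_cis inner_commute mult.commute[of "\<phi> _"])
qed

text \<open>This takes the role of the inverse Fourier transform of L^2: duality holds for every
  integrable piece, and both sides are summed by means of the summable norms.\<close>

lemma represents_inv_fourier_series:
  fixes h :: "nat \<Rightarrow> 'a::euclidean_space \<Rightarrow> complex"
  assumes h: "\<And>k. integrable lborel (h k)"
    and a: "\<And>k. a k > 0" "summable a"
    and l2: "\<And>k. l2sq (h k) \<le> ennreal ((a k)\<^sup>2)"
  shows "represents (\<lambda>x. \<Sum>k. inv_fourier (h k) x) (inv_fourier_distr (distr_of_fun (\<lambda>\<xi>. \<Sum>k. h k \<xi>)))"
proof -
  have [measurable]: "h k \<in> borel_measurable borel" for k using h[of k] by simp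
  have l2': "l2sq (inv_fourier (h k)) \<le> ennreal ((a k)\<^sup>2)" for k
    using l2sq_inv_fourier_le[OF h] l2 by (rule order_trans)
  have m: "inv_fourier (h k) \<in> borel_measurable borel" for k by measurable
  show ?thesis
    unfolding represents_def inv_fourier_distr_def distr_of_fun_def
  proof (intro conjI allI impI)
    fix \<phi> :: "'a \<Rightarrow> complex" assume \<phi>: "schwartz \<phi>"
    note \<psi> = schwartz_inv_fourier[OF \<phi>]
    show "integrable lborel (\<lambda>x. (\<Sum>k. inv_fourier (h k) x) * \<phi> x)"
      by (rule integrable_mult_l2_series[OF m a l2' schwartz_measurable[OF \<phi>] l2sq_schwartz_finite[OF \<phi>]])
    have "(\<lambda>k. LINT x|lborel. inv_fourier (h k) x * \<phi> x) sums (LINT x|lborel. (\<Sum>k. inv_fourier (h k) x) * \<phi> x)"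
      by (rule sums_integral_mult_l2_series[OF m a l2' schwartz_measurable[OF \<phi>] l2sq_schwartz_finite[OF \<phi>]])
    moreover have "(\<lambda>k. LINT \<xi>|lborel. h k \<xi> * inv_fourier \<phi> \<xi>) sums (LINT \<xi>|lborel. (\<Sum>k. h k \<xi>) * inv_fourier \<phi> \<xi>)"
      by (rule sums_integral_mult_l2_series[OF _ a l2 schwartz_measurable[OF \<psi>] l2sq_schwartz_finite[OF \<psi>]]) measurable
    ultimately show "(LINT \<xi>|lborel. (\<Sum>k. h k \<xi>) * inv_fourier \<phi> \<xi>) = (LINT x|lborel. (\<Sum>k. inv_fourier (h k) x) * \<phi> x)"
      unfolding inv_fourier_duality[OF h schwartz_integrable[OF \<phi>]] by (rule sums_unique2[symmetric])
  qed measurable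
qed

text \<open>Only values on Schwartz functions are compared, a distribution being arbitrary
  elsewhere. Translated Gaussians are Schwartz functions, and they already determine the
  representing function.\<close>

lemma represents_unique:
  assumes f: "represents f u" and g: "represents g v" and uv: "\<And>\<phi>. schwartz \<phi> \<Longrightarrow> u \<phi> = v \<phi>"
  shows "AE x in lborel. f x = g x"
proof -
  have "AE x in lborel. f x - g x = 0"
  proof (rule AE_zero_if_gaussian_tests_zero)
    fix \<epsilon> :: real and c assume \<epsilon>: "\<epsilon> > 0"
    note s = schwartz_gaussian[OF \<epsilon>, of c]
    have fi: "integrable lborel (\<lambda>x. f x * of_real (gaussian \<epsilon> (x - c)))"
      and gi: "integrable lborel (\<lambda>x. g x * of_real (gaussian \<epsilon> (x - c)))"
      using f g s unfolding represents_def by blast+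
    then show "integrable lborel (\<lambda>x. (f x - g x) * of_real (gaussian \<epsilon> (x - c)))"
      unfolding left_diff_distrib by (rule Bochner_Integration.integrable_diff)
    have "(LINT x|lborel. f x * of_real (gaussian \<epsilon> (x - c))) = (LINT x|lborel. g x * of_real (gaussian \<epsilon> (x - c)))"
    proof -
      have "u (\<lambda>x. of_real (gaussian \<epsilon> (x - c))) = (LINT x|lborel. f x * of_real (gaussian \<epsilon> (x - c)))"
        using f s unfolding represents_def by blast
      moreover have "v (\<lambda>x. of_real (gaussian \<epsilon> (x - c))) = (LINT x|lborel. g x * of_real (gaussian \<epsilon> (x - c)))"
        using g s unfolding represents_def by blast
      ultimately show ?thesis using uv[OF s] by (simp only:)
    qed
    then show "(LINT x|lborel. (f x - g x) * of_real (gaussian \<epsilon> (x - c))) = 0"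
      unfolding left_diff_distrib using fi gi by (subst Bochner_Integration.integral_diff) auto
  qed
  then show ?thesis by eventually_elim simp
qed

text \<open>The choice in \<open>fourier_fun\<close> is meaningful as soon as one representing
  function exists, and by uniqueness it is that function almost everywhere.\<close>

lemma fourier_fun_represents:
  assumes "represents g (fourier_distr u)"
  shows "represents (fourier_fun u) (fourier_distr u)" "AE \<xi> in lborel. fourier_fun u \<xi> = g \<xi>"
proof -
  show r: "represents (fourier_fun u) (fourier_distr u)"
    unfolding fourier_fun_def using assms by (rule someI[of "\<lambda>g. represents g (fourier_distr u)"])
  show "AE \<xi> in lborel. fourier_fun u \<xi> = g \<xi>" by (rule represents_unique[OF r assms refl])
qed

section \<open>Waves as series of absolutely convergent Fourier integrals\<close>

definition wave :: "('a::euclidean_space \<Rightarrow> complex) \<Rightarrow> 'a \<Rightarrow> real \<Rightarrow> complex" where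
  "wave h x t = inv_fourier (\<lambda>\<xi>. cis (t * norm \<xi>) * h \<xi>) x"

lemma wave_0: "wave h x 0 = inv_fourier h x"
  by (simp add: wave_def)

lemma measurable_wave [measurable]:
  assumes [measurable]: "h \<in> borel_measurable borel"
  shows "(\<lambda>(x::'a::euclidean_space, t). wave h x t) \<in> borel_measurable (borel \<Otimes>\<^sub>M borel)"
  unfolding wave_def inv_fourier_cis by measurable

lemma represents_cong_schwartz:
  "represents f u \<Longrightarrow> (\<And>\<phi>. schwartz \<phi> \<Longrightarrow> u \<phi> = v \<phi>) \<Longrightarrow> represents f v"
  unfolding represents_def by auto

lemma integrable_cis_mult:
  fixes h :: "'a::euclidean_space \<Rightarrow> complex"
  assumes "integrable lborel h" and [measurable]: "f \<in> borel_measurable borel"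
  shows "integrable lborel (\<lambda>x. cis (f x) * h x)"
  by (rule Bochner_Integration.integrable_bound[OF assms(1)]) (use assms in \<open>auto simp: norm_mult\<close>)

context
  fixes u :: "'a::euclidean_space distr" and g :: "'a \<Rightarrow> complex" and h :: "nat \<Rightarrow> 'a \<Rightarrow> complex" and a :: "nat \<Rightarrow> real"
  assumes g: "represents g (fourier_distr u)" and gh: "AE \<xi> in lborel. g \<xi> = (\<Sum>k. h k \<xi>)"
    and h: "\<And>k. integrable lborel (h k)"
    and a: "\<And>k. a k > 0" "summable a"
    and l2: "\<And>k. l2sq (h k) \<le> ennreal ((a k)\<^sup>2)"
begin

text \<open>The phase of the wave operator has modulus 1, so the pieces keep their L^2 norms.
  \<open>S1\<close> is built from the chosen \<open>fourier_fun u\<close>, which agrees with the sum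
  of the pieces almost everywhere and hence under all integrals.\<close>

lemma S1_represents_series: "represents (\<lambda>x. \<Sum>k. wave (h k) x t) (S1 u t)"
proof -
  have [measurable]: "h k \<in> borel_measurable borel" for k using h[of k] by simp
  have [measurable]: "fourier_fun u \<in> borel_measurable borel"
    using fourier_fun_represents(1)[OF g] by (simp add: represents_def)
  have "represents (\<lambda>x. \<Sum>k. inv_fourier (\<lambda>\<xi>. cis (t * norm \<xi>) * h k \<xi>) x)
     (inv_fourier_distr (distr_of_fun (\<lambda>\<xi>. \<Sum>k. cis (t * norm \<xi>) * h k \<xi>)))"
  proof (rule represents_inv_fourier_series[OF _ a])
    fix k
    show "integrable lborel (\<lambda>\<xi>. cis (t * norm \<xi>) * h k \<xi>)" by (rule integrable_cis_mult[OF h]) measurable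
    show "l2sq (\<lambda>\<xi>. cis (t * norm \<xi>) * h k \<xi>) \<le> ennreal ((a k)\<^sup>2)"
      using l2[of k] by (subst l2sq_cong_norm[of _ "h k"]) (auto simp: norm_mult)
  qed
  then show ?thesis
    unfolding wave_def
  proof (rule represents_cong_schwartz)
    fix \<phi> :: "'a \<Rightarrow> complex" assume "schwartz \<phi>"
    then have [measurable]: "inv_fourier \<phi> \<in> borel_measurable borel" by (intro schwartz_measurable schwartz_inv_fourier)
    have "AE \<xi> in lborel. summable (\<lambda>k. norm (h k \<xi>))" by (rule AE_summable_l2_series[OF _ a l2]) measurable
    then have "AE \<xi> in lborel. (\<Sum>k. cis (t * norm \<xi>) * h k \<xi>) * inv_fourier \<phi> \<xi> = exp (\<i> * of_real (t * norm \<xi>)) * fourier_fun u \<xi> * inv_fourier \<phi> \<xi>"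
      using gh fourier_fun_represents(2)[OF g]
      by eventually_elim (simp add: cis_conv_exp suminf_mult summable_norm_cancel)
    then show "inv_fourier_distr (distr_of_fun (\<lambda>\<xi>. \<Sum>k. cis (t * norm \<xi>) * h k \<xi>)) \<phi> = S1 u t \<phi>"
      unfolding S1_def inv_fourier_distr_def distr_of_fun_def by (intro integral_cong_AE) measurable
  qed
qed

text \<open>At time 0 the multiplier is 1, and inversion on test functions identifies
  \<open>S1 u 0\<close> with \<open>u\<close>. So the value of the series at time 0 can serve as the
  function in \<open>S1_converges\<close>.\<close>

lemma represents_series: "represents (\<lambda>x. \<Sum>k. wave (h k) x 0) u"
proof (rule represents_cong_schwartz[OF S1_represents_series])
  fix \<phi> :: "'a \<Rightarrow> complex" assume \<phi>: "schwartz \<phi>"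
  then have "u \<phi> = fourier_distr u (inv_fourier \<phi>)"
  proof -
    have "fourier (inv_fourier \<phi>) = \<phi>" by (rule ext) (rule fourier_inv_fourier[OF \<phi>])
    then show ?thesis by (simp add: fourier_distr_def)
  qed
  also have "\<dots> = (LINT \<xi>|lborel. fourier_fun u \<xi> * inv_fourier \<phi> \<xi>)"
    using fourier_fun_represents(1)[OF g] schwartz_inv_fourier[OF \<phi>] by (simp add: represents_def)
  finally show "S1 u 0 \<phi> = u \<phi>" by (simp add: S1_def inv_fourier_distr_def distr_of_fun_def)
qed

text \<open>A single series for all times is jointly measurable, which is what a version demands
  beyond correct time slices.\<close>

lemma S1_version_series: "S1_version u (\<lambda>x t. \<Sum>k. wave (h k) x t)"
proof -
  have [measurable]: "h k \<in> borel_measurable borel" for k using h[of k] by simp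
  show ?thesis unfolding S1_version_def
    by (intro conjI allI S1_represents_series) (simp add: borel_prod[symmetric])
qed

end

text \<open>Every square integrable function is thereby the transform of a tempered distribution;
  the counterexamples are obtained in this way.\<close>

lemma
  fixes h :: "'a::euclidean_space \<Rightarrow> complex"
  assumes [measurable]: "h \<in> borel_measurable borel" and l2: "l2sq h < \<infinity>"
  shows tempered_inv_fourier_distr: "tempered (inv_fourier_distr (distr_of_fun h))"
    and represents_fourier_inv_fourier: "represents h (fourier_distr (inv_fourier_distr (distr_of_fun h)))"
proof -
  let ?u = "inv_fourier_distr (distr_of_fun h)"
  have i: "integrable lborel (\<lambda>x. h x * \<phi> x)" if "schwartz \<phi>" for \<phi>
    by (rule integrable_mult_l2[OF assms(1) schwartz_measurable[OF that] assms(2) l2sq_schwartz_finite[OF that]])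
  have u: "?u \<phi> = (LINT \<xi>|lborel. h \<xi> * inv_fourier \<phi> \<xi>)" for \<phi>
    by (simp add: inv_fourier_distr_def distr_of_fun_def)
  have "inv_fourier (fourier \<phi>) = \<phi>" if "schwartz \<phi>" for \<phi> :: "'a \<Rightarrow> complex"
    using inv_fourier_fourier[OF that] by (rule ext)
  then show "represents h (fourier_distr ?u)"
    unfolding represents_def fourier_distr_def using i by (simp add: u)
  show "tempered ?u"
    unfolding tempered_def
  proof (intro conjI allI impI)
    fix \<phi> \<psi> :: "'a \<Rightarrow> complex" assume s: "schwartz \<phi>" "schwartz \<psi>"
    have "inv_fourier (\<lambda>x. \<phi> x + \<psi> x) = (\<lambda>x. inv_fourier \<phi> x + inv_fourier \<psi> x)"
      unfolding inv_fourier_cis[abs_def] using s[THEN schwartz_integrable]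
      by (auto simp: distrib_left add_divide_distrib integrable_cis_mult)
    then show "?u (\<lambda>x. \<phi> x + \<psi> x) = ?u \<phi> + ?u \<psi>"
      using s[THEN schwartz_inv_fourier, THEN i] by (simp add: u distrib_left)
  next
    fix c and \<phi> :: "'a \<Rightarrow> complex" assume s: "schwartz \<phi>"
    have "inv_fourier (\<lambda>x. c * \<phi> x) = (\<lambda>x. c * inv_fourier \<phi> x)"
      unfolding inv_fourier_cis[abs_def] by (simp add: mult.left_commute[of _ c])
    then show "?u (\<lambda>x. c * \<phi> x) = c * ?u \<phi>"
      by (simp add: u mult.left_commute[of _ c])
  next
    obtain H where H: "l2sq h = ennreal H" "H \<ge> 0" using l2 by (cases "l2sq h") auto
    define C where "C = (LINT x::'a|lborel. 1 / (1 + norm x) ^ (2 * DIM('a)))"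
    have C: "C \<ge> 0" unfolding C_def by (intro integral_nonneg_AE) auto
    \<comment> \<open>The seminorm itself serves as the weight in the mean inequality, which must be
      positive; if it vanishes, so does \<phi>.\<close>
    have "norm (?u \<phi>) \<le> (C + H) * schwartz_seminorm DIM('a) \<phi>" if \<phi>: "schwartz \<phi>" for \<phi> :: "'a \<Rightarrow> complex"
    proof (cases "schwartz_seminorm DIM('a) \<phi> = 0")
      case True
      have "\<phi> x = 0" for x
      proof -
        have "(1 + norm x) ^ DIM('a) * norm (\<phi> x) \<le> 0" using schwartz_seminorm_upper[OF \<phi>, of x "DIM('a)"] True by simp
        moreover have "(1 + norm x) ^ DIM('a) > 0" by (intro zero_less_power add_pos_nonneg) auto
        ultimately show ?thesis by (simp add: mult_le_0_iff)
      qed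
      then show ?thesis using True by (simp add: u inv_fourier_cis)
    next
      case False
      define s where "s = schwartz_seminorm DIM('a) \<phi>"
      have s: "s > 0" using False schwartz_seminorm_nonneg[OF \<phi>, of "DIM('a)"] by (simp add: s_def)
      have [measurable]: "inv_fourier \<phi> \<in> borel_measurable borel" using \<phi> by (intro schwartz_measurable schwartz_inv_fourier)
      have "ennreal (norm (?u \<phi>)) \<le> (\<integral>\<^sup>+\<xi>. ennreal (norm (inv_fourier \<phi> \<xi> * h \<xi>)) \<partial>lborel)"
        unfolding u by (subst mult.commute) (rule norm_integral_le_nn_integral)
      also have "\<dots> \<le> ennreal (1 / s) * l2sq (inv_fourier \<phi>) + ennreal s * l2sq h"
        by (rule nn_integral_mult_le_l2sq) (use s in auto)
      also have "\<dots> \<le> ennreal (1 / s) * ennreal (s\<^sup>2 * C) + ennreal s * ennreal H"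
        unfolding H using order_trans[OF l2sq_inv_fourier_le[OF schwartz_integrable[OF \<phi>]] l2sq_schwartz[OF \<phi>]]
        by (intro add_mono mult_left_mono) (auto simp: s_def C_def)
      also have "\<dots> = ennreal ((C + H) * s)"
        using s C H(2) by (simp add: ennreal_mult[symmetric] ennreal_plus[symmetric] power2_eq_square algebra_simps del: ennreal_plus)
      finally show ?thesis using s C H(2) by (simp add: s_def ennreal_le_iff)
    qed
    then show "\<exists>N C. \<forall>\<phi>. schwartz \<phi> \<longrightarrow> norm (?u \<phi>) \<le> C * schwartz_seminorm N \<phi>" by blast
  qed
qed


section \<open>The maximal estimate\<close>

lemma measurable_wave_compose [measurable (raw)]:
  assumes "h \<in> borel_measurable (borel :: 'a::euclidean_space measure)"
    and f: "f \<in> borel_measurable M" and g: "g \<in> borel_measurable M"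
  shows "(\<lambda>z. wave h (f z :: 'a) (g z)) \<in> borel_measurable M"
  using measurable_compose[OF measurable_Pair[OF f g] measurable_wave[OF assms(1)]] by simp

lemma wave_has_vector_derivative:
  fixes h :: "'a::euclidean_space \<Rightarrow> complex"
  assumes h: "integrable lborel h" "integrable lborel (\<lambda>\<xi>. norm \<xi> * norm (h \<xi>))"
    "integrable lborel (\<lambda>\<xi>. (norm \<xi>)\<^sup>2 * norm (h \<xi>))"
  shows "((\<lambda>t. wave h x t) has_vector_derivative wave (\<lambda>\<xi>. \<i> * of_real (norm \<xi>) * h \<xi>) x t) (at t)"
proof -
  have [measurable]: "h \<in> borel_measurable borel" using h by simp
  have "((\<lambda>t. LINT \<xi>|lborel. cis (t \<bullet> norm \<xi>) * (cis (x \<bullet> \<xi>) * h \<xi>)) has_derivative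
    (\<lambda>w. LINT \<xi>|lborel. cis (t \<bullet> norm \<xi>) * (\<i> * of_real (w \<bullet> norm \<xi>) * (cis (x \<bullet> \<xi>) * h \<xi>)))) (at t)"
    by (rule has_derivative_phase_integral) (use h in \<open>auto simp: norm_mult integrable_cis_mult\<close>)
  also have "(\<lambda>w. LINT \<xi>|lborel. cis (t \<bullet> norm \<xi>) * (\<i> * of_real (w \<bullet> norm \<xi>) * (cis (x \<bullet> \<xi>) * h \<xi>)))
    = (\<lambda>w. w *\<^sub>R (LINT \<xi>|lborel. cis (x \<bullet> \<xi>) * (cis (t * norm \<xi>) * (\<i> * of_real (norm \<xi>) * h \<xi>))))"
    by (simp add: scaleR_conv_of_real mult_ac flip: integral_mult_right_zero)
  finally have "((\<lambda>t. LINT \<xi>|lborel. cis (x \<bullet> \<xi>) * (cis (t * norm \<xi>) * h \<xi>)) has_vector_derivative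
    (LINT \<xi>|lborel. cis (x \<bullet> \<xi>) * (cis (t * norm \<xi>) * (\<i> * of_real (norm \<xi>) * h \<xi>)))) (at t)"
    by (simp add: has_vector_derivative_def mult.left_commute[of "cis (_ * _)"])
  then show ?thesis
    unfolding wave_def inv_fourier_cis
    by (rule has_vector_derivative_divide)
qed

text \<open>The derivative of the squared norm is \<open>2 * (D \<tau> \<bullet> D' \<tau>)\<close>
  with the real inner product of complex numbers, and the product of norms is split with weight
  \<open>w\<close>. This exchanges a supremum over times for a time integral of squares, to which
  Bessel's inequality applies.\<close>

lemma norm_sq_diff_le_nn_integral:
  fixes D D' :: "real \<Rightarrow> complex"
  assumes d: "\<And>\<tau>. (D has_vector_derivative D' \<tau>) (at \<tau>)" and c: "continuous_on UNIV D'"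
    and w: "w > 0" and ab: "a \<le> b"
  shows "ennreal \<bar>(norm (D b))\<^sup>2 - (norm (D a))\<^sup>2\<bar> \<le>
    (\<integral>\<^sup>+\<tau>. indicator {a..b} \<tau> * ennreal (w * (norm (D \<tau>))\<^sup>2 + 1 / w * (norm (D' \<tau>))\<^sup>2) \<partial>lborel)"
proof -
  define q where "q \<tau> = w * (norm (D \<tau>))\<^sup>2 + 1 / w * (norm (D' \<tau>))\<^sup>2" for \<tau>
  have cD: "continuous_on UNIV D"
    using d by (intro continuous_at_imp_continuous_on ballI has_vector_derivative_continuous)
  have cq: "continuous_on UNIV q"
    unfolding q_def by (intro continuous_intros cD c)
  then have [measurable]: "q \<in> borel_measurable borel" by (rule borel_measurable_continuous_onI)
  have q_nonneg: "q \<tau> \<ge> 0" for \<tau> using w by (simp add: q_def)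
  have "((\<lambda>\<tau>. D \<tau> \<bullet> D \<tau>) has_vector_derivative 2 * (D \<tau> \<bullet> D' \<tau>)) (at \<tau>)" for \<tau>
  proof -
    have "((\<lambda>\<tau>. D \<tau> \<bullet> D \<tau>) has_vector_derivative (D \<tau> \<bullet> D' \<tau> + D' \<tau> \<bullet> D \<tau>)) (at \<tau>)"
      by (rule bounded_bilinear.has_vector_derivative[OF bounded_bilinear_inner d d])
    then show ?thesis by (simp add: inner_commute)
  qed
  then have ftc: "((\<lambda>\<tau>. 2 * (D \<tau> \<bullet> D' \<tau>)) has_integral (D b \<bullet> D b - D a \<bullet> D a)) {a..b}"
    using ab by (intro fundamental_theorem_of_calculus) (auto intro: has_vector_derivative_at_within)
  have bd: "norm (2 * (D \<tau> \<bullet> D' \<tau>)) \<le> q \<tau>" for \<tau>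
  proof -
    have "0 \<le> (w * norm (D \<tau>) - norm (D' \<tau>))\<^sup>2 / w" using w by simp
    also have "\<dots> = q \<tau> - 2 * (norm (D \<tau>) * norm (D' \<tau>))"
      using w by (simp add: q_def power2_eq_square field_simps)
    finally show ?thesis using Cauchy_Schwarz_ineq2[of "D \<tau>" "D' \<tau>"] by (simp add: abs_mult)
  qed
  have qi: "q integrable_on {a..b}"
    by (intro integrable_continuous_interval continuous_on_subset[OF cq]) auto
  have "norm (integral {a..b} (\<lambda>\<tau>. 2 * (D \<tau> \<bullet> D' \<tau>))) \<le> integral {a..b} q"
    by (rule Henstock_Kurzweil_Integration.integral_norm_bound_integral[OF _ qi bd]) (use ftc in auto)
  also have "integral {a..b} (\<lambda>\<tau>. 2 * (D \<tau> \<bullet> D' \<tau>)) = (norm (D b))\<^sup>2 - (norm (D a))\<^sup>2"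
    using integral_unique[OF ftc] by (simp add: power2_norm_eq_inner)
  finally have "\<bar>(norm (D b))\<^sup>2 - (norm (D a))\<^sup>2\<bar> \<le> integral {a..b} q" by simp
  moreover have "(\<integral>\<^sup>+\<tau>. indicator {a..b} \<tau> * ennreal (q \<tau>) \<partial>lborel) = ennreal (integral {a..b} q)"
    using nn_integral_has_integral_lebesgue'[of "{a..b}" q "integral {a..b} q"] qi q_nonneg
    by (simp add: mult.commute integrable_integral)
  ultimately show ?thesis unfolding q_def[symmetric] by (simp add: ennreal_leI)
qed

lemma norm_sq_le_nn_integral:
  fixes D D' :: "real \<Rightarrow> complex"
  assumes d: "\<And>\<tau>. (D has_vector_derivative D' \<tau>) (at \<tau>)" and c: "continuous_on UNIV D'"
    and w: "w > 0" and D0: "D 0 = 0" and t: "\<bar>t\<bar> \<le> T"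
  shows "ennreal ((norm (D t))\<^sup>2) \<le>
    (\<integral>\<^sup>+\<tau>. indicator {-T..T} \<tau> * ennreal (w * (norm (D \<tau>))\<^sup>2 + 1 / w * (norm (D' \<tau>))\<^sup>2) \<partial>lborel)"
proof -
  have "ennreal ((norm (D t))\<^sup>2) \<le>
    (\<integral>\<^sup>+\<tau>. indicator {min 0 t..max 0 t} \<tau> * ennreal (w * (norm (D \<tau>))\<^sup>2 + 1 / w * (norm (D' \<tau>))\<^sup>2) \<partial>lborel)"
    using norm_sq_diff_le_nn_integral[OF d c w, of "min 0 t" "max 0 t"] D0
    by (cases "0 \<le> t") (auto simp: min_def max_def)
  also have "\<dots> \<le> (\<integral>\<^sup>+\<tau>. indicator {-T..T} \<tau> * ennreal (w * (norm (D \<tau>))\<^sup>2 + 1 / w * (norm (D' \<tau>))\<^sup>2) \<partial>lborel)"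
    using t by (intro nn_integral_mono mult_right_mono) (auto simp: indicator_def)
  finally show ?thesis .
qed

text \<open>Subtraction of natural numbers is truncated, so \<open>(j - k) + (k - j)\<close> is the
  distance of \<open>j\<close> and \<open>k\<close>. Each side of \<open>k\<close> contributes at
  most one geometric series.\<close>

lemma
  fixes p :: real
  assumes p: "0 \<le> p" "p < 1"
  shows summable_power_dist: "summable (\<lambda>j. p ^ ((j - k) + (k - j)))"
    and suminf_power_dist_le: "(\<Sum>j. p ^ ((j - k) + (k - j))) \<le> 2 / (1 - p)"
proof -
  let ?f = "\<lambda>j. p ^ ((j - k) + (k - j))"
  have shift: "(\<lambda>j. ?f (j + k)) = (\<lambda>j. p ^ j)" by auto
  show s: "summable ?f"
    by (rule summable_offset[of _ k]) (use p in \<open>simp add: shift summable_geometric\<close>)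
  have "(\<Sum>j<k. ?f j) \<le> (\<Sum>j<k. p ^ (k - Suc j))"
    using p by (intro sum_mono) (auto intro!: power_decreasing)
  also have "\<dots> = (\<Sum>j<k. p ^ j)" by (rule sum.nat_diff_reindex)
  also have "\<dots> \<le> (\<Sum>j. p ^ j)" using p by (intro sum_le_suminf summable_geometric) auto
  finally have "(\<Sum>j<k. ?f j) \<le> 1 / (1 - p)" using p by (simp add: suminf_geometric)
  moreover have "(\<Sum>j. ?f j) = (\<Sum>j. ?f (j + k)) + (\<Sum>j<k. ?f j)" by (rule suminf_split_initial_segment[OF s])
  ultimately show "(\<Sum>j. ?f j) \<le> 2 / (1 - p)"
    unfolding shift using p by (simp add: suminf_geometric add_divide_distrib[symmetric])
qed

lemma suminf_ennreal_swap: "(\<Sum>j. \<Sum>k. f j k) = (\<Sum>k. \<Sum>j. f j k :: ennreal)"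
proof -
  have "(\<Sum>j. \<Sum>k. f j k) = (\<integral>\<^sup>+j. (\<Sum>k. f j k) \<partial>count_space UNIV)" by (simp add: nn_integral_count_space_nat)
  also have "\<dots> = (\<Sum>k. \<integral>\<^sup>+j. f j k \<partial>count_space UNIV)" by (rule nn_integral_suminf) simp
  finally show ?thesis by (simp add: nn_integral_count_space_nat)
qed

lemma dyadic_scale_exists:
  fixes t :: real assumes "t > 0" "t \<le> 1"
  obtains j :: nat where "2 powr (- real (Suc j)) < t" "t \<le> 2 powr (- real j)"
proof -
  define i where "i = (LEAST i. 2 powr (- real i) < t)"
  have ex: "\<exists>i. 2 powr (- real i) < t"
  proof -
    obtain n where "(1/2) ^ n < t" using real_arch_pow_inv[of t "1/2"] assms by auto
    moreover have "2 powr (- real n) = (1/2) ^ n"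
      by (simp add: powr_minus_divide powr_realpow power_one_over)
    ultimately have "2 powr (- real n) < t" by (simp only:)
    then show ?thesis ..
  qed
  have i: "2 powr (- real i) < t" unfolding i_def using ex by (rule LeastI_ex)
  then obtain j where j: "i = Suc j" using assms(2) by (cases i) auto
  have "\<not> 2 powr (- real j) < t" using not_less_Least[of j "\<lambda>i. 2 powr (- real i) < t"] j i_def by auto
  then show ?thesis using that[of j] i j by auto
qed

text \<open>Finiteness with the weight \<open>r ^ (2 * ((j - k) + (k - j)))\<close> in the
  denominator bounds \<open>norm (D k t)\<close> by \<open>2 powr (- s * j) * sqrt (V j)\<close>
  times \<open>r\<close> to the distance of \<open>j\<close> and \<open>k\<close>, which can be
  summed over \<open>k\<close>. As \<open>V\<close> is summable it tends to 0, and this is what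
  gives o instead of O.\<close>

lemma dyadic_maximal_conclusion:
  fixes D :: "nat \<Rightarrow> real \<Rightarrow> complex" and B :: "nat \<Rightarrow> nat \<Rightarrow> ennreal" and r s :: real
  assumes s: "s > 0" and r: "0 < r" "r < 1"
    and B: "\<And>j k t. \<bar>t\<bar> \<le> 2 powr (- real j) \<Longrightarrow> ennreal ((norm (D k t))\<^sup>2) \<le> B j k"
    and fin: "(\<Sum>j. \<Sum>k. ennreal (4 powr (s * j) / r ^ (2 * ((j - k) + (k - j)))) * B j k) < \<infinity>"
  shows "\<bar>t\<bar> \<le> 1 \<Longrightarrow> summable (\<lambda>k. norm (D k t))"
    and "((\<lambda>t. \<bar>t\<bar> powr (- s) *\<^sub>R (\<Sum>k. D k t)) \<longlongrightarrow> 0) (at 0)"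
proof -
  define v where "v j = (\<Sum>k. ennreal (4 powr (s * j) / r ^ (2 * ((j - k) + (k - j)))) * B j k)" for j :: nat
  have vfin: "v j < \<infinity>" for j
  proof -
    have "v j \<le> (\<Sum>j. v j)" using sum_le_suminf[of v "{j}"] by simp
    then show ?thesis using fin unfolding v_def[symmetric] by (rule order_le_less_trans)
  qed
  define V where "V j = enn2real (v j)" for j
  have V: "v j = ennreal (V j)" "V j \<ge> 0" for j using vfin[of j] by (auto simp: V_def)
  have "summable V"
    using fin unfolding v_def[symmetric] V(1) by (intro summable_suminf_not_top V) auto
  then have V0: "V \<longlonglongrightarrow> 0" by (rule summable_LIMSEQ_zero)
  have trm: "norm (D k t) \<le> 2 powr (- s * j) * sqrt (V j) * r ^ ((j - k) + (k - j))" if t: "\<bar>t\<bar> \<le> 2 powr (- real j)" for j k t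
  proof -
    define d where "d = (j - k) + (k - j)"
    have "ennreal (4 powr (s * j) / r ^ (2 * d)) * ennreal ((norm (D k t))\<^sup>2) \<le> ennreal (4 powr (s * j) / r ^ (2 * d)) * B j k"
      by (intro mult_left_mono B t) simp
    also have "\<dots> \<le> v j"
      unfolding v_def d_def using sum_le_suminf[of "\<lambda>k. ennreal (4 powr (s * j) / r ^ (2 * ((j - k) + (k - j)))) * B j k" "{k}"] by simp
    finally have "4 powr (s * j) / r ^ (2 * d) * (norm (D k t))\<^sup>2 \<le> V j"
      using r V by (simp add: ennreal_mult[symmetric])
    then have "(norm (D k t))\<^sup>2 \<le> V j * r ^ (2 * d) / 4 powr (s * j)"
      using r by (simp add: field_simps)
    also have "\<dots> = (2 powr (- s * j) * sqrt (V j) * r ^ d)\<^sup>2"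
    proof -
      have "(2 powr (- s * j))\<^sup>2 = 2 powr (- s * j * 2)" 
        by (simp only: power2_eq_square powr_add[symmetric]) (simp add: mult_2_right)
      also have "\<dots> = 1 / 4 powr (s * j)" using powr_powr[of 2 2 "s * j"] by (simp add: powr_minus_divide mult_ac)
      finally show ?thesis using V(2)[of j] by (simp add: power_mult_distrib power_mult[symmetric] mult.commute)
    qed
    finally show ?thesis unfolding d_def by (rule power2_le_imp_le) (use r V in auto)
  qed
  have sr: "summable (\<lambda>k. r ^ ((j - k) + (k - j)))" "(\<Sum>k. r ^ ((j - k) + (k - j))) \<le> 2 / (1 - r)" for j
    using summable_power_dist[of r j] suminf_power_dist_le[of r j] r by (auto simp: add.commute)
  have summ: "summable (\<lambda>k. norm (D k t))" if t: "\<bar>t\<bar> \<le> 2 powr (- real j)" for j t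
    by (rule summable_comparison_test'[of "\<lambda>k. 2 powr (- s * j) * sqrt (V j) * r ^ ((j - k) + (k - j))"])
       (use trm[OF t] sr(1) in \<open>auto intro!: summable_mult\<close>)
  show "summable (\<lambda>k. norm (D k t))" if "\<bar>t\<bar> \<le> 1" using summ[of t 0] that by simp
  have sum_le: "norm (\<Sum>k. D k t) \<le> 2 powr (- s * j) * sqrt (V j) * (2 / (1 - r))" if t: "\<bar>t\<bar> \<le> 2 powr (- real j)" for j t
  proof -
    have "norm (\<Sum>k. D k t) \<le> (\<Sum>k. norm (D k t))" by (rule summable_norm[OF summ[OF t]])
    also have "\<dots> \<le> (\<Sum>k. 2 powr (- s * j) * sqrt (V j) * r ^ ((j - k) + (k - j)))"
      by (intro suminf_le trm[OF t] summ[OF t] summable_mult sr)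
    also have "\<dots> = 2 powr (- s * j) * sqrt (V j) * (\<Sum>k. r ^ ((j - k) + (k - j)))" by (rule suminf_mult[OF sr(1)])
    also have "\<dots> \<le> 2 powr (- s * j) * sqrt (V j) * (2 / (1 - r))" by (intro mult_left_mono sr) (use V in auto)
    finally show ?thesis .
  qed
  show "((\<lambda>t. \<bar>t\<bar> powr (- s) *\<^sub>R (\<Sum>k. D k t)) \<longlongrightarrow> 0) (at 0)"
  proof (rule tendstoI)
    fix e :: real assume e: "e > 0"
    have "(\<lambda>j. 2 powr s * sqrt (V j) * (2 / (1 - r))) \<longlonglongrightarrow> 2 powr s * sqrt 0 * (2 / (1 - r))"
      by (intro tendsto_intros V0)
    then have "\<forall>\<^sub>F j in sequentially. 2 powr s * sqrt (V j) * (2 / (1 - r)) < e" using e by (intro order_tendstoD(2)) auto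
    then obtain J where J: "\<And>j. j \<ge> J \<Longrightarrow> 2 powr s * sqrt (V j) * (2 / (1 - r)) < e"
      by (auto simp: eventually_sequentially)
    show "\<forall>\<^sub>F t in at 0. dist (\<bar>t\<bar> powr (- s) *\<^sub>R (\<Sum>k. D k t)) 0 < e"
      unfolding eventually_at
    proof (intro exI[of _ "2 powr (- real J)"] conjI ballI impI)
      fix t :: real assume t: "t \<noteq> 0 \<and> dist t 0 < 2 powr (- real J)"
      then have t0: "\<bar>t\<bar> > 0" and tJ: "\<bar>t\<bar> < 2 powr (- real J)" by auto
      have "2 powr (- real J) \<le> 2 powr 0" by (intro powr_mono) auto
      then have "\<bar>t\<bar> \<le> 1" using tJ by simp
      from dyadic_scale_exists[OF t0 this] obtain j where j: "2 powr (- real (Suc j)) < \<bar>t\<bar>" "\<bar>t\<bar> \<le> 2 powr (- real j)" .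
      from j(1) tJ have "2 powr (- real (Suc j)) < 2 powr (- real J)" by (rule less_trans)
      then have "- real (Suc j) < - real J" by (subst (asm) powr_less_cancel_iff) auto
      then have "J \<le> j" by simp
      \<comment> \<open>Passing from |t| to its dyadic scale costs at most the factor
        \<open>2 powr s\<close>.\<close>
      have "\<bar>t\<bar> powr (- s) \<le> (2 powr (- real (Suc j))) powr (- s)"
        using j(1) s by (intro powr_mono2') auto
      also have "\<dots> = 2 powr (s * j) * 2 powr s" by (simp add: powr_powr powr_add[symmetric] algebra_simps)
      finally have tp: "\<bar>t\<bar> powr (- s) \<le> 2 powr (s * j) * 2 powr s" .
      have "norm (\<bar>t\<bar> powr (- s) *\<^sub>R (\<Sum>k. D k t)) \<le> (2 powr (s * j) * 2 powr s) * (2 powr (- s * j) * sqrt (V j) * (2 / (1 - r)))"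
        unfolding norm_scaleR using tp sum_le[OF j(2)] by (intro mult_mono) auto
      also have "\<dots> = (2 powr (s * j) * 2 powr (- s * j)) * (2 powr s * sqrt (V j) * (2 / (1 - r)))" by (simp only: mult_ac)
      also have "2 powr (s * j) * 2 powr (- s * j) = (1::real)" by (simp add: powr_add[symmetric])
      finally show "dist (\<bar>t\<bar> powr (- s) *\<^sub>R (\<Sum>k. D k t)) 0 < e" using J[OF \<open>J \<le> j\<close>] by simp
    qed simp
  qed
qed


section \<open>Dyadic shells and convergence at order s\<close>

lemma l2sq_le_mult:
  assumes [measurable]: "h \<in> borel_measurable borel" and c: "c \<ge> 0" and le: "\<And>x. norm (f x) \<le> c * norm (h x)"
  shows "l2sq f \<le> ennreal (c\<^sup>2) * l2sq h"
proof -
  have "ennreal ((norm (f x))\<^sup>2) \<le> ennreal (c\<^sup>2) * ennreal ((norm (h x))\<^sup>2)" for x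
    using power_mono[OF le[of x], of 2] by (simp add: ennreal_mult[symmetric] power_mult_distrib ennreal_leI)
  then have "l2sq f \<le> (\<integral>\<^sup>+x. ennreal (c\<^sup>2) * ennreal ((norm (h x))\<^sup>2) \<partial>lborel)"
    unfolding l2sq_def by (intro nn_integral_mono)
  then show ?thesis unfolding l2sq_def by (simp add: nn_integral_cmult)
qed

lemma inv_fourier_diff:
  assumes "integrable lborel f" "integrable lborel g"
  shows "inv_fourier f x - inv_fourier g x = inv_fourier (\<lambda>\<xi>. f \<xi> - g \<xi>) x"
  unfolding inv_fourier_cis using assms
  by (simp add: right_diff_distrib diff_divide_distrib integrable_cis_mult)

text \<open>Shell 0 is the whole open unit ball, the others are annuli, half open so that the shells
  partition the space.\<close>

definition dyadic_shell :: "nat \<Rightarrow> 'a::euclidean_space set" where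
  "dyadic_shell k = {\<xi>. norm \<xi> < 2 ^ k \<and> (k = 0 \<or> 2 ^ (k - 1) \<le> norm \<xi>)}"

lemma measurable_dyadic_shell [measurable]: "dyadic_shell k \<in> sets borel"
proof -
  have "Measurable.pred borel (\<lambda>\<xi>::'a. norm \<xi> < 2 ^ k \<and> (k = 0 \<or> 2 ^ (k - 1) \<le> norm \<xi>))" by measurable
  then show ?thesis by (simp add: dyadic_shell_def pred_def)
qed

lemma dyadic_shell_unique: "\<xi> \<in> dyadic_shell k \<Longrightarrow> \<xi> \<in> dyadic_shell l \<Longrightarrow> k = l"
proof (induction k l rule: linorder_wlog)
  case (le k l)
  show ?case
  proof (rule ccontr)
    assume "k \<noteq> l"
    with le have "k \<le> l - 1" "l \<noteq> 0" by auto
    then have "(2::real) ^ k \<le> 2 ^ (l - 1)" by (intro power_increasing) auto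
    moreover from le have "norm \<xi> < 2 ^ k" by (simp add: dyadic_shell_def)
    moreover from le \<open>l \<noteq> 0\<close> have "2 ^ (l - 1) \<le> norm \<xi>" by (simp add: dyadic_shell_def)
    ultimately show False by linarith
  qed
qed auto

lemma dyadic_shell_exists: "\<exists>k. \<xi> \<in> dyadic_shell k"
proof -
  define k where "k = (LEAST k. norm \<xi> < 2 ^ k)"
  obtain n where "norm \<xi> < 2 ^ n" using real_arch_pow[of 2 "norm \<xi>"] by auto
  then have "norm \<xi> < 2 ^ k" unfolding k_def by (rule LeastI)
  moreover have "2 ^ (k - 1) \<le> norm \<xi>" if "k \<noteq> 0"
    using not_less_Least[of "k - 1" "\<lambda>k. norm \<xi> < 2 ^ k"] that unfolding k_def[symmetric] by (auto simp: not_less)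
  ultimately show ?thesis by (auto simp: dyadic_shell_def)
qed

lemma dyadic_shell_sums: "(\<lambda>k. indicator (dyadic_shell k) \<xi> * c) sums (c :: 'a::real_normed_field)"
proof -
  obtain k where k: "\<xi> \<in> dyadic_shell k" using dyadic_shell_exists by blast
  have "(\<lambda>l. indicator (dyadic_shell l) \<xi> * c) = (\<lambda>l. if l = k then c else 0)"
    using k dyadic_shell_unique by (fastforce simp: indicator_def)
  then show ?thesis using sums_single[of k "\<lambda>_. c"] by simp
qed

lemma dyadic_shell_suminf_ennreal: "(\<Sum>k. indicator (dyadic_shell k) \<xi> * c) = (c :: ennreal)"
proof -
  obtain k where k: "\<xi> \<in> dyadic_shell k" using dyadic_shell_exists by blast
  have "(\<lambda>l. indicator (dyadic_shell l) \<xi> * c) = (\<lambda>l. if l = k then c else 0)"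
    using k dyadic_shell_unique by (fastforce simp: indicator_def)
  then show ?thesis using sums_single[of k "\<lambda>_. c"] by (simp add: sums_iff)
qed

text \<open>\<open>real k - 1\<close> is a real subtraction: in shell 0 the left side is at most 1,
  so the unit ball fits the same formula.\<close>

lemma dyadic_shell_weight:
  assumes "\<xi> \<in> dyadic_shell k" "s \<ge> 0"
  shows "4 powr (s * (real k - 1)) \<le> (1 + (norm \<xi>)\<^sup>2) powr s"
proof -
  have "4 powr (real k - 1) \<le> 1 + (norm \<xi>)\<^sup>2"
  proof (cases k)
    case (Suc m)
    then have "(2 ^ m)\<^sup>2 \<le> (norm \<xi>)\<^sup>2" using assms by (intro power_mono) (auto simp: dyadic_shell_def)
    moreover have "(2 ^ m)\<^sup>2 = (4::real) ^ m" by (simp add: power_mult[symmetric] mult.commute[of m]) (simp add: power_mult)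
    ultimately show ?thesis using Suc by (simp add: powr_realpow)
  qed (auto simp: powr_minus_divide add_increasing2)
  then have "(4 powr (real k - 1)) powr s \<le> (1 + (norm \<xi>)\<^sup>2) powr s" using assms by (intro powr_mono2) auto
  then show ?thesis by (simp add: powr_powr mult.commute)
qed

text \<open>The two hypotheses on s meet here. For \<open>k \<le> j\<close> a wave hardly moves up
  to time \<open>T\<close>: its increment is at most \<open>T * 2 ^ k\<close> times its size, and
  the gain per step of distance is \<open>2 * (1 - s)\<close> in the exponent. For
  \<open>k > j\<close> the increment is only bounded by 2, and the gain is \<open>2 * s - 1\<close>.
  The constant 10 is \<open>2 * (2\<^sup>2 + 1)\<close>, from the second case.\<close>

lemma dyadic_exponent_bound:
  fixes s c :: real and j k :: nat
  defines "d \<equiv> (j - k) + (k - j)" and "T \<equiv> 2 powr (- real j)" and "w \<equiv> 2 powr (real (max j k))"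
  assumes c: "c \<le> 2 * (1 - s)" "c \<le> 2 * s - 1"
  shows "4 powr (s * j) * (2 * T * (w * (min 2 (T * 2 ^ k))\<^sup>2 + 1 / w * (2 ^ k)\<^sup>2) * 4 powr (- (s * k))) \<le> 10 * 2 powr (- (c * d))"
proof -
  have T: "T > 0" by (simp add: T_def)
  have k2: "2 ^ k = 2 powr real k" by (simp add: powr_realpow)
  have sq: "(2 powr x)\<^sup>2 = 2 powr (2 * x)" for x :: real by (simp add: power2_eq_square powr_add[symmetric])
  have four: "4 powr x = 2 powr (2 * x)" for x :: real using powr_powr[of 2 2 x] by simp
  show ?thesis
  proof (cases "k \<le> j")
    case True
    have w: "w = 2 powr real j" using True by (simp add: w_def max_def)
    have "(min 2 (T * 2 ^ k))\<^sup>2 \<le> (T * 2 ^ k)\<^sup>2" using T by (intro power_mono) auto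
    then have "2 * T * (w * (min 2 (T * 2 ^ k))\<^sup>2 + 1 / w * (2 ^ k)\<^sup>2) \<le> 2 * T * (w * (T * 2 ^ k)\<^sup>2 + 1 / w * (2 ^ k)\<^sup>2)"
      using T by (intro mult_left_mono add_right_mono) (auto simp: w_def)
    also have "\<dots> = 4 * 2 powr (2 * (real k - real j))"
    proof -
      have w1: "w = 1 / T" by (simp add: T_def w powr_minus_divide)
      then have eq: "2 * T * (w * (T * 2 ^ k)\<^sup>2 + 1 / w * (2 ^ k)\<^sup>2) = 4 * (T * 2 ^ k)\<^sup>2"
        unfolding w1 using T by (simp add: field_simps power2_eq_square)
      have "T * 2 ^ k = 2 powr (real k - real j)" by (simp add: T_def k2 powr_add[symmetric])
      then show ?thesis unfolding eq by (simp only: sq)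
    qed
    finally have "4 powr (s * j) * (2 * T * (w * (min 2 (T * 2 ^ k))\<^sup>2 + 1 / w * (2 ^ k)\<^sup>2) * 4 powr (- (s * k)))
       \<le> 4 powr (s * j) * (4 * 2 powr (2 * (real k - real j)) * 4 powr (- (s * k)))"
      by (intro mult_left_mono mult_right_mono) auto
    also have "\<dots> = 4 * 2 powr (- (2 * (1 - s)) * d)"
      using True by (simp add: four d_def of_nat_diff powr_add[symmetric] algebra_simps)
    also have "\<dots> \<le> 4 * 2 powr (- (c * d))"
      using mult_right_mono[OF c(1), of "real d"] by (intro mult_left_mono powr_mono) (auto simp: algebra_simps)
    also have "\<dots> \<le> 10 * 2 powr (- (c * d))" by simp
    finally show ?thesis .
  next
    case False
    have w: "w = 2 powr real k" using False by (simp add: w_def max_def)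
    have "(min 2 (T * 2 ^ k))\<^sup>2 \<le> 2\<^sup>2" using T by (intro power_mono) auto
    then have "2 * T * (w * (min 2 (T * 2 ^ k))\<^sup>2 + 1 / w * (2 ^ k)\<^sup>2) \<le> 2 * T * (w * 2\<^sup>2 + 1 / w * (2 ^ k)\<^sup>2)"
      using T by (intro mult_left_mono add_right_mono) (auto simp: w_def)
    also have "\<dots> = 10 * (T * w)" unfolding k2 w[symmetric] using w by (simp add: power2_eq_square)
    also have "\<dots> = 10 * 2 powr (real k - real j)" by (simp add: T_def w powr_add[symmetric])
    finally have "4 powr (s * j) * (2 * T * (w * (min 2 (T * 2 ^ k))\<^sup>2 + 1 / w * (2 ^ k)\<^sup>2) * 4 powr (- (s * k)))
       \<le> 4 powr (s * j) * (10 * 2 powr (real k - real j) * 4 powr (- (s * k)))"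
      by (intro mult_left_mono mult_right_mono) auto
    also have "\<dots> = 10 * 2 powr (- (2 * s - 1) * d)"
      using False by (simp add: four d_def of_nat_diff powr_add[symmetric] algebra_simps)
    also have "\<dots> \<le> 10 * 2 powr (- (c * d))"
      using mult_right_mono[OF c(2), of "real d"] by (intro mult_left_mono powr_mono) (auto simp: algebra_simps)
    finally show ?thesis .
  qed
qed

proposition S1_converges_at_order:
  fixes u :: "'a::euclidean_space distr"
  assumes s: "1 / 2 < s" "s < 1" and u: "u \<in> sobolev s"
  shows "S1_converges s u"
proof -
  obtain g where g: "represents g (fourier_distr u)"
    and gi: "integrable lborel (\<lambda>\<xi>. (1 + (norm \<xi>)\<^sup>2) powr s * (norm (g \<xi>))\<^sup>2)"
    using u by (auto simp: sobolev_def)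
  have [measurable]: "g \<in> borel_measurable borel" using g by (simp add: represents_def)
  define h where "h k \<xi> = indicator (dyadic_shell k) \<xi> * g \<xi>" for k \<xi>
  have [measurable]: "h k \<in> borel_measurable borel" for k unfolding h_def by measurable
  have gh: "AE \<xi> in lborel. g \<xi> = (\<Sum>k. h k \<xi>)"
    unfolding h_def by (intro AE_I2 sums_unique dyadic_shell_sums)
  have h_supp: "norm \<xi> ^ m * norm (h k \<xi>) \<le> (2 ^ k) ^ m * norm (h k \<xi>)" for m k \<xi>
    by (cases "\<xi> \<in> dyadic_shell k")
       (auto simp: h_def dyadic_shell_def intro!: mult_right_mono power_mono)

  define w where "w k = (\<integral>\<^sup>+\<xi>. indicator (dyadic_shell k) \<xi> * ennreal ((1 + (norm \<xi>)\<^sup>2) powr s * (norm (g \<xi>))\<^sup>2) \<partial>lborel)" for k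
  have "(\<Sum>k. w k) = (\<integral>\<^sup>+\<xi>. ennreal ((1 + (norm \<xi>)\<^sup>2) powr s * (norm (g \<xi>))\<^sup>2) \<partial>lborel)"
    unfolding w_def by (subst nn_integral_suminf[symmetric]) (auto simp: dyadic_shell_suminf_ennreal[where c=1, simplified])
  also have "\<dots> < \<infinity>" using gi by (simp add: integrable_iff_bounded abs_mult)
  finally have wfin: "(\<Sum>k. w k) < \<infinity>" .
  have w_lt: "w k < \<infinity>" for k
    using sum_le_suminf[of w "{k}"] wfin by (auto intro: order_le_less_trans)
  define v where "v k = enn2real (w k)" for k
  have v: "w k = ennreal (v k)" "v k \<ge> 0" for k using w_lt[of k] by (auto simp: v_def)
  have "summable v" using wfin unfolding v(1) by (intro summable_suminf_not_top v) auto
  \<comment> \<open>\<open>4 powr s\<close> pays for the shift from \<open>k - 1\<close> to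
    \<open>k\<close> in the weight of a shell; the geometric term makes \<open>\<beta> k\<close>
    strictly positive, as the series lemmas require of \<open>a k\<close>.\<close>
  define \<beta> where "\<beta> k = 4 powr s * v k + (1 / 2) ^ k" for k
  have \<beta>: "\<beta> k > 0" "summable \<beta>" for k
    unfolding \<beta>_def using v(2)[of k] by (auto intro!: add_nonneg_pos summable_add summable_mult \<open>summable v\<close> summable_geometric)
  have l2: "l2sq (h k) \<le> ennreal (\<beta> k * 4 powr (- (s * k)))" for k
  proof -
    have "(norm (h k \<xi>))\<^sup>2 \<le> 4 powr s * 4 powr (- (s * k)) * (indicator (dyadic_shell k) \<xi> * ((1 + (norm \<xi>)\<^sup>2) powr s * (norm (g \<xi>))\<^sup>2))" for \<xi>
    proof (cases "\<xi> \<in> dyadic_shell k")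
      case True
      have "1 = 4 powr s * 4 powr (- (s * k)) * 4 powr (s * (real k - 1))"
        by (simp add: powr_add[symmetric] algebra_simps)
      also have "\<dots> \<le> 4 powr s * 4 powr (- (s * k)) * (1 + (norm \<xi>)\<^sup>2) powr s"
        using s by (intro mult_left_mono dyadic_shell_weight True) auto
      finally have "1 * (norm (g \<xi>))\<^sup>2 \<le> 4 powr s * 4 powr (- (s * k)) * (1 + (norm \<xi>)\<^sup>2) powr s * (norm (g \<xi>))\<^sup>2"
        by (intro mult_right_mono) auto
      then show ?thesis using True by (simp add: h_def mult.assoc)
    qed (simp add: h_def)
    then have "ennreal ((norm (h k \<xi>))\<^sup>2) \<le> ennreal (4 powr s * 4 powr (- (s * k)))
        * (indicator (dyadic_shell k) \<xi> * ennreal ((1 + (norm \<xi>)\<^sup>2) powr s * (norm (g \<xi>))\<^sup>2))" for \<xi>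
      by (subst ennreal_indicator[symmetric]) (simp only: ennreal_mult[symmetric] ennreal_leI
        mult_nonneg_nonneg powr_ge_zero indicator_pos_le zero_le_power2)
    then have "l2sq (h k) \<le> (\<integral>\<^sup>+\<xi>. ennreal (4 powr s * 4 powr (- (s * k))) * (indicator (dyadic_shell k) \<xi> * ennreal ((1 + (norm \<xi>)\<^sup>2) powr s * (norm (g \<xi>))\<^sup>2)) \<partial>lborel)"
      unfolding l2sq_def
      by (intro nn_integral_mono)
    also have "\<dots> = ennreal (4 powr s * 4 powr (- (s * k))) * w k"
      unfolding w_def by (rule nn_integral_cmult) measurable
    also have "\<dots> = ennreal (4 powr s * v k * 4 powr (- (s * k)))"
      unfolding v by (simp add: ennreal_mult[symmetric] v mult_ac)
    also have "\<dots> \<le> ennreal (\<beta> k * 4 powr (- (s * k)))"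
      by (intro ennreal_leI mult_right_mono) (auto simp: \<beta>_def)
    finally show ?thesis .
  qed

  \<comment> \<open>Square roots of \<open>\<beta> k\<close> alone might not be summable; the decay
    \<open>4 powr (- (s * k))\<close>, with s positive, makes \<open>a\<close> summable through the
    mean inequality.\<close>
  define a where "a k = sqrt (\<beta> k * 4 powr (- (s * k)))" for k :: nat
  have a_sq: "(a k)\<^sup>2 = \<beta> k * 4 powr (- (s * k))" for k using \<beta>(1)[of k] by (simp add: a_def)
  have a: "a k > 0" "summable a" for k
  proof -
    show "a k > 0" using \<beta> by (simp add: a_def)
    have "summable (\<lambda>k. (4 powr (- s)) ^ k)"
      using s by (intro summable_geometric) (auto simp: powr_less_one)
    then have "summable (\<lambda>k. 4 powr (- (s * real k)))"
      by (simp add: powr_realpow[symmetric] powr_powr)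
    with \<beta>(2) have "summable (\<lambda>k. (\<beta> k + 4 powr (- (s * real k))) / 2)" by (intro summable_divide summable_add)
    then show "summable a"
    proof (rule summable_comparison_test'[where N=0])
      fix k :: nat
      have "a k \<le> (\<beta> k + 4 powr (- (s * real k))) / 2"
        unfolding a_def by (rule arith_geo_mean_sqrt) (use \<beta>(1)[of k] in auto)
      moreover have "a k \<ge> 0" using \<beta>(1)[of k] by (simp add: a_def)
      ultimately show "norm (a k) \<le> (\<beta> k + 4 powr (- (s * real k))) / 2" by simp
    qed
  qed
  have l2a: "l2sq (h k) \<le> ennreal ((a k)\<^sup>2)" for k unfolding a_sq by (rule l2)
  \<comment> \<open>On a bounded shell, square integrability implies integrability.\<close>
  have hint: "integrable lborel (h k)" for k
  proof -
    have "integrable lborel (\<lambda>\<xi>. indicator (dyadic_shell k) \<xi> * h k \<xi>)"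
    proof (rule integrable_mult_l2)
      have "dyadic_shell k \<subseteq> ball (0::'a) (2 ^ k)" by (auto simp: dyadic_shell_def)
      then have "emeasure lborel (dyadic_shell k :: 'a set) < \<infinity>"
        by (intro emeasure_bounded_finite bounded_subset[OF bounded_ball])
      moreover have "l2sq (indicator (dyadic_shell k :: 'a set)) = emeasure lborel (dyadic_shell k :: 'a set)"
      proof -
        have *: "ennreal ((norm (indicator S x :: complex))\<^sup>2) = indicator S x" for S :: "'a set" and x
          by (simp split: split_indicator)
        show ?thesis unfolding l2sq_def * by simp
      qed
      ultimately show "l2sq (indicator (dyadic_shell k :: 'a set)) < \<infinity>" by simp
      show "l2sq (h k) < \<infinity>" using l2 by (rule order_le_less_trans) simp
    qed measurable
    moreover have "(\<lambda>\<xi>. indicator (dyadic_shell k) \<xi> * h k \<xi>) = h k" by (auto simp: h_def indicator_def)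
    ultimately show ?thesis by simp
  qed
  have hint_m: "integrable lborel (\<lambda>\<xi>. norm \<xi> ^ m * norm (h k \<xi>))" for m k
    by (rule Bochner_Integration.integrable_bound[OF integrable_mult_right[OF integrable_norm[OF hint[of k]], of "(2 ^ k) ^ m"]])
       (use h_supp in \<open>auto\<close>)

  define W where "W k x t = wave (h k) x t" for k x t
  define W' where "W' k x t = wave (\<lambda>\<xi>. \<i> * of_real (norm \<xi>) * h k \<xi>) x t" for k x t
  have dW: "((\<lambda>t. W k x t) has_vector_derivative W' k x t) (at t)" for k x t
    unfolding W_def W'_def
    by (rule wave_has_vector_derivative) (use hint hint_m[of 1] hint_m[of 2] in auto)
  have cW': "continuous_on UNIV (W' k x)" for k x
  proof -
    have "((\<lambda>t. W' k x t) has_vector_derivative wave (\<lambda>\<xi>. \<i> * of_real (norm \<xi>) * (\<i> * of_real (norm \<xi>) * h k \<xi>)) x t) (at t)" for t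
      unfolding W'_def
    proof (rule wave_has_vector_derivative)
      show "integrable lborel (\<lambda>\<xi>. \<i> * of_real (norm \<xi>) * h k \<xi>)"
        by (rule Bochner_Integration.integrable_bound[OF hint_m[of 1 k]]) (auto simp: norm_mult)
    qed (use hint_m[of 2 k] hint_m[of 3 k] in \<open>simp_all add: norm_mult power2_eq_square power3_eq_cube mult_ac\<close>)
    then show ?thesis
      by (intro continuous_at_imp_continuous_on ballI has_vector_derivative_continuous)
  qed
  define D where "D k x t = W k x t - W k x 0" for k x t
  have dD: "((\<lambda>t. D k x t) has_vector_derivative W' k x t) (at t)" for k x t
    unfolding D_def using has_vector_derivative_diff[OF dW has_vector_derivative_const] by simp
  have [measurable]: "(\<lambda>z. D k (f z) (e z)) \<in> borel_measurable M" "(\<lambda>z. W' k (f z) (e z)) \<in> borel_measurable M"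
    if [measurable]: "f \<in> borel_measurable M" "e \<in> borel_measurable M" for k and M :: "'z measure" and f e
    unfolding D_def W_def W'_def by measurable

  define T where "T j = 2 powr (- real j)" for j :: nat
  define l where "l j k = 2 powr (real (max j k))" for j k :: nat
  have Tl: "T j > 0" "l j k > 0" for j k by (auto simp: T_def l_def)
  define B where "B j k x = (\<integral>\<^sup>+\<tau>. indicator {- T j..T j} \<tau> * ennreal (l j k * (norm (D k x \<tau>))\<^sup>2 + 1 / l j k * (norm (W' k x \<tau>))\<^sup>2) \<partial>lborel)" for j k x
  have [measurable]: "B j k \<in> borel_measurable borel" for j k
    unfolding B_def by measurable
  have B_bound: "ennreal ((norm (D k x t))\<^sup>2) \<le> B j k x" if "\<bar>t\<bar> \<le> T j" for j k x t
    unfolding B_def by (rule norm_sq_le_nn_integral[OF dD cW' Tl(2) _ that]) (simp add: D_def)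
  \<comment> \<open>\<open>norm (cis \<theta> - 1)\<close> is at most
    \<open>\<bar>\<theta>\<bar>\<close> and at most 2; the first bound is effective for frequencies
    below \<open>1 / T j\<close>, the second above.\<close>
  have l2D: "l2sq (\<lambda>x. D k x \<tau>) \<le> ennreal ((min 2 (T j * 2 ^ k))\<^sup>2) * l2sq (h k)" if \<tau>: "\<bar>\<tau>\<bar> \<le> T j" for j k \<tau>
  proof -
    have i: "integrable lborel (\<lambda>\<xi>. cis (\<tau> * norm \<xi>) * h k \<xi>)" by (rule integrable_cis_mult[OF hint]) measurable
    have D_eq: "(\<lambda>x. D k x \<tau>) = inv_fourier (\<lambda>\<xi>. cis (\<tau> * norm \<xi>) * h k \<xi> - h k \<xi>)"
      unfolding D_def W_def wave_0 unfolding wave_def by (intro ext inv_fourier_diff i hint)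
    have "l2sq (inv_fourier (\<lambda>\<xi>. cis (\<tau> * norm \<xi>) * h k \<xi> - h k \<xi>)) \<le> l2sq (\<lambda>\<xi>. cis (\<tau> * norm \<xi>) * h k \<xi> - h k \<xi>)"
      by (intro l2sq_inv_fourier_le Bochner_Integration.integrable_diff i hint)
    also have "\<dots> \<le> ennreal ((min 2 (T j * 2 ^ k))\<^sup>2) * l2sq (h k)"
    proof (rule l2sq_le_mult)
      fix \<xi>
      have "norm (cis (\<tau> * norm \<xi>) - 1) * norm (h k \<xi>) \<le> min 2 (T j * 2 ^ k) * norm (h k \<xi>)"
      proof (cases "\<xi> \<in> dyadic_shell k")
        case True
        have "norm (cis (\<tau> * norm \<xi>) - 1) \<le> \<bar>\<tau> * norm \<xi>\<bar>" by (rule norm_cis_minus_1_le)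
        also have "\<dots> \<le> T j * 2 ^ k"
          unfolding abs_mult using \<tau> True by (intro mult_mono) (auto simp: dyadic_shell_def)
        moreover have "norm (cis (\<tau> * norm \<xi>) - 1) \<le> 2"
          using norm_triangle_ineq4[of "cis (\<tau> * norm \<xi>)" 1] by simp
        ultimately show ?thesis by (intro mult_right_mono) auto
      qed (simp add: h_def)
      then show "norm (cis (\<tau> * norm \<xi>) * h k \<xi> - h k \<xi>) \<le> min 2 (T j * 2 ^ k) * norm (h k \<xi>)"
        by (simp add: norm_mult[symmetric] left_diff_distrib)
    qed (use Tl[of j] in auto)
    finally show ?thesis unfolding D_eq .
  qed
  have l2W': "l2sq (\<lambda>x. W' k x \<tau>) \<le> ennreal ((2 ^ k)\<^sup>2) * l2sq (h k)" for k \<tau>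
  proof -
    have "l2sq (\<lambda>x. W' k x \<tau>) \<le> l2sq (\<lambda>\<xi>. cis (\<tau> * norm \<xi>) * (\<i> * of_real (norm \<xi>) * h k \<xi>))"
      unfolding W'_def wave_def
    proof (intro l2sq_inv_fourier_le integrable_cis_mult)
      show "integrable lborel (\<lambda>\<xi>. \<i> * of_real (norm \<xi>) * h k \<xi>)"
        by (rule Bochner_Integration.integrable_bound[OF hint_m[of 1 k]]) (auto simp: norm_mult)
    qed measurable
    also have "\<dots> \<le> ennreal ((2 ^ k)\<^sup>2) * l2sq (h k)"
      by (rule l2sq_le_mult) (use h_supp[of _ 1 k] in \<open>auto simp: norm_mult\<close>)
    finally show ?thesis .
  qed
  have B_int: "(\<integral>\<^sup>+x. B j k x \<partial>lborel) \<le>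
      ennreal (2 * T j * (l j k * (min 2 (T j * 2 ^ k))\<^sup>2 + 1 / l j k * (2 ^ k)\<^sup>2) * 4 powr (- (s * k)) * \<beta> k)" for j k
  proof -
    define L where "L = \<beta> k * 4 powr (- (s * k))"
    have L: "L \<ge> 0" "l2sq (h k) \<le> ennreal L" unfolding L_def using \<beta>(1)[of k] l2 by auto
    define m where "m = l j k * (min 2 (T j * 2 ^ k))\<^sup>2 + 1 / l j k * (2 ^ k)\<^sup>2"
    have m: "m \<ge> 0" unfolding m_def using Tl(2)[of j k] by simp
    have "(\<integral>\<^sup>+x. B j k x \<partial>lborel) = (\<integral>\<^sup>+\<tau>. \<integral>\<^sup>+x. indicator {- T j..T j} \<tau> * ennreal (l j k * (norm (D k x \<tau>))\<^sup>2 + 1 / l j k * (norm (W' k x \<tau>))\<^sup>2) \<partial>lborel \<partial>lborel)"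
      unfolding B_def by (rule lborel_pair.Fubini'[symmetric]) measurable
    also have "\<dots> \<le> (\<integral>\<^sup>+\<tau>. indicator {- T j..T j} \<tau> * ennreal (m * L) \<partial>lborel)"
    proof (rule nn_integral_mono)
      fix \<tau>
      show "(\<integral>\<^sup>+x. indicator {- T j..T j} \<tau> * ennreal (l j k * (norm (D k x \<tau>))\<^sup>2 + 1 / l j k * (norm (W' k x \<tau>))\<^sup>2) \<partial>lborel)
        \<le> indicator {- T j..T j} \<tau> * ennreal (m * L)"
      proof (cases "\<bar>\<tau>\<bar> \<le> T j")
        case True
        have "(\<integral>\<^sup>+x. ennreal (l j k * (norm (D k x \<tau>))\<^sup>2 + 1 / l j k * (norm (W' k x \<tau>))\<^sup>2) \<partial>lborel)
          = (\<integral>\<^sup>+x. ennreal (l j k) * ennreal ((norm (D k x \<tau>))\<^sup>2) + ennreal (1 / l j k) * ennreal ((norm (W' k x \<tau>))\<^sup>2) \<partial>lborel)"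
          using Tl(2)[of j k] by (intro nn_integral_cong) (simp add: ennreal_mult[symmetric])
        also have "\<dots> = ennreal (l j k) * l2sq (\<lambda>x. D k x \<tau>) + ennreal (1 / l j k) * l2sq (\<lambda>x. W' k x \<tau>)"
          unfolding l2sq_def by (simp add: nn_integral_add nn_integral_cmult)
        also have "\<dots> \<le> ennreal (l j k) * (ennreal ((min 2 (T j * 2 ^ k))\<^sup>2) * ennreal L) + ennreal (1 / l j k) * (ennreal ((2 ^ k)\<^sup>2) * ennreal L)"
          by (intro add_mono mult_left_mono order_trans[OF l2D[OF True]] order_trans[OF l2W'] L) auto
        also have "\<dots> = ennreal (m * L)"
          using L(1) Tl(2)[of j k] by (simp add: m_def ennreal_mult[symmetric] ennreal_plus[symmetric] algebra_simps del: ennreal_plus)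
        finally show ?thesis using True by (simp add: indicator_def abs_le_iff)
      qed (auto simp: indicator_def)
    qed
    also have "\<dots> = ennreal (m * L) * ennreal (2 * T j)"
      using Tl(1)[of j] by (subst nn_integral_multc) (auto simp: mult.commute)
    also have "\<dots> = ennreal (2 * T j * m * 4 powr (- (s * k)) * \<beta> k)"
      using m L(1) Tl(1)[of j] by (simp add: ennreal_mult[symmetric] L_def mult_ac)
    finally show ?thesis unfolding m_def .
  qed

  define c where "c = min (2 * (1 - s)) (2 * s - 1)"
  have c: "c > 0" "c \<le> 2 * (1 - s)" "c \<le> 2 * s - 1" using s by (auto simp: c_def)
  \<comment> \<open>Chosen such that the gain at distance d is \<open>r ^ (4 * d)\<close>: one half
    is spent on the weight needed for summing over \<open>k\<close> pointwise, the other half makes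
    the integrals summable over \<open>j\<close>.\<close>
  define r where "r = 2 powr (- (c / 4))"
  have r: "0 < r" "r < 1" using c by (auto simp: r_def powr_less_one)
  let ?d = "\<lambda>j k :: nat. (j - k) + (k - j)"
  have r4: "2 powr (- (c * real n)) = r ^ (4 * n)" for n
    using r by (simp add: r_def powr_realpow[symmetric] powr_powr)
  have weighted: "(\<integral>\<^sup>+x. ennreal (4 powr (s * j) / r ^ (2 * ?d j k)) * B j k x \<partial>lborel) \<le> ennreal (10 * \<beta> k * (r\<^sup>2) ^ ?d j k)" for j k
  proof -
    define d where "d = ?d j k"
    define m where "m = 2 * T j * (l j k * (min 2 (T j * 2 ^ k))\<^sup>2 + 1 / l j k * (2 ^ k)\<^sup>2) * 4 powr (- (s * k))"
    have m: "4 powr (s * j) * m \<le> 10 * r ^ (4 * d)"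
      using dyadic_exponent_bound[OF c(2,3), of j k] by (simp only: m_def T_def l_def d_def r4)
    have "(\<integral>\<^sup>+x. ennreal (4 powr (s * j) / r ^ (2 * d)) * B j k x \<partial>lborel) \<le> ennreal (4 powr (s * j) / r ^ (2 * d)) * ennreal (m * \<beta> k)"
      using B_int[of j k] unfolding m_def by (subst nn_integral_cmult) (auto intro!: mult_left_mono)
    also have "\<dots> = ennreal (4 powr (s * j) * m * \<beta> k / r ^ (2 * d))"
      using r by (subst ennreal_mult'[symmetric]) (auto simp: mult_ac)
    also have "\<dots> \<le> ennreal (10 * r ^ (4 * d) * \<beta> k / r ^ (2 * d))"
      using m \<beta>(1)[of k] r by (intro ennreal_leI divide_right_mono mult_right_mono) auto
    also have "10 * r ^ (4 * d) * \<beta> k / r ^ (2 * d) = 10 * \<beta> k * (r\<^sup>2) ^ d"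
    proof -
      have "r ^ (4 * d) = r ^ (2 * d) * r ^ (2 * d)" by (simp add: power_add[symmetric])
      then show ?thesis using r by (simp add: power_mult)
    qed
    finally show ?thesis unfolding d_def .
  qed
  have r2: "0 \<le> r\<^sup>2" "r\<^sup>2 < 1" using r by (auto simp: power_less_one_iff abs_square_less_1)
  have "(\<integral>\<^sup>+x. (\<Sum>j. \<Sum>k. ennreal (4 powr (s * j) / r ^ (2 * ?d j k)) * B j k x) \<partial>lborel)
     = (\<Sum>j. \<Sum>k. \<integral>\<^sup>+x. ennreal (4 powr (s * j) / r ^ (2 * ?d j k)) * B j k x \<partial>lborel)"
    by (simp add: nn_integral_suminf)
  also have "\<dots> \<le> (\<Sum>j. \<Sum>k. ennreal (10 * \<beta> k * (r\<^sup>2) ^ ?d j k))"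
    by (intro suminf_le weighted) auto
  \<comment> \<open>Summing over \<open>j\<close> first leaves a constant multiple of
    \<open>\<beta> k\<close>, which is summable by the Sobolev hypothesis.\<close>
  also have "\<dots> = (\<Sum>k. \<Sum>j. ennreal (10 * \<beta> k * (r\<^sup>2) ^ ?d j k))"
    by (rule suminf_ennreal_swap)
  also have "\<dots> \<le> (\<Sum>k. ennreal (10 * \<beta> k * (2 / (1 - r\<^sup>2))))"
  proof (rule suminf_le)
    fix k
    have "(\<Sum>j. ennreal (10 * \<beta> k * (r\<^sup>2) ^ ?d j k)) = ennreal (\<Sum>j. 10 * \<beta> k * (r\<^sup>2) ^ ?d j k)"
      using \<beta>(1)[of k] by (intro suminf_ennreal2 summable_mult summable_power_dist r2) auto
    also have "\<dots> \<le> ennreal (10 * \<beta> k * (2 / (1 - r\<^sup>2)))"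
      using \<beta>(1)[of k] by (subst suminf_mult[OF summable_power_dist[OF r2]])
        (intro ennreal_leI mult_left_mono suminf_power_dist_le r2, simp)
    finally show "(\<Sum>j. ennreal (10 * \<beta> k * (r\<^sup>2) ^ ?d j k)) \<le> ennreal (10 * \<beta> k * (2 / (1 - r\<^sup>2)))" .
  qed auto
  also have "\<dots> < \<infinity>"
    using \<beta> r2 by (subst suminf_ennreal2) (auto intro!: summable_mult summable_mult2 summable_divide mult_nonneg_nonneg simp: less_imp_le)
  finally have "AE x in lborel. (\<Sum>j. \<Sum>k. ennreal (4 powr (s * j) / r ^ (2 * ?d j k)) * B j k x) \<noteq> \<infinity>"
    by (intro nn_integral_PInf_AE) auto
  moreover have "AE x in lborel. summable (\<lambda>k. norm (W k x 0))"
  proof -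
    have "l2sq (\<lambda>x. W k x 0) \<le> ennreal ((a k)\<^sup>2)" for k
      unfolding W_def wave_0 using order_trans[OF l2sq_inv_fourier_le[OF hint] l2a] by simp
    then show ?thesis by (intro AE_summable_l2_series[OF _ a]) (auto simp: W_def)
  qed
  ultimately have "AE x in lborel. ((\<lambda>t. \<bar>t\<bar> powr (- s) *\<^sub>R ((\<Sum>k. W k x t) - (\<Sum>k. W k x 0))) \<longlongrightarrow> 0) (at 0)"
  proof eventually_elim
    case (elim x)
    have fin: "(\<Sum>j. \<Sum>k. ennreal (4 powr (s * j) / r ^ (2 * ?d j k)) * B j k x) < \<infinity>"
      using elim(1) by (simp add: less_top)
    have s0: "s > 0" using s by simp
    note concl = dyadic_maximal_conclusion[OF s0 r B_bound[unfolded T_def, of _ _ _ x] fin]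
    \<comment> \<open>The maximal estimate covers times of modulus at most 1; there the series of
      \<open>W\<close> converges because those of \<open>D\<close> and of the values at time 0
      do.\<close>
    have eq: "(\<Sum>k. W k x t) - (\<Sum>k. W k x 0) = (\<Sum>k. D k x t)" if "\<bar>t\<bar> \<le> 1" for t
    proof -
      have 0: "summable (\<lambda>k. W k x 0)" using elim(2) by (rule summable_norm_cancel)
      moreover have "summable (\<lambda>k. D k x t)" using concl(1)[OF _ that] by (rule summable_norm_cancel)
      from summable_add[OF this 0] have "summable (\<lambda>k. W k x t)" by (simp add: D_def)
      ultimately show ?thesis unfolding D_def by (intro suminf_diff)
    qed
    have "\<forall>\<^sub>F t in at 0. \<bar>t\<bar> powr (- s) *\<^sub>R (\<Sum>k. D k x t) = \<bar>t\<bar> powr (- s) *\<^sub>R ((\<Sum>k. W k x t) - (\<Sum>k. W k x 0))"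
      unfolding eventually_at by (intro exI[of _ 1]) (auto simp: eq)
    with concl(2) show ?case by (rule Lim_transform_eventually)
  qed
  moreover have "represents (\<lambda>x. \<Sum>k. W k x 0) u"
    unfolding W_def by (rule represents_series[OF g gh hint a l2a])
  moreover have "S1_version u (\<lambda>x t. \<Sum>k. W k x t)"
    unfolding W_def by (rule S1_version_series[OF g gh hint a l2a])
  ultimately show ?thesis unfolding S1_converges_def by blast
qed

text \<open>For times of modulus at most 1 the larger exponent gives the larger weight.\<close>

lemma S1_converges_mono:
  assumes "S1_converges \<delta> u" "\<gamma> \<le> \<delta>"
  shows "S1_converges \<gamma> u"
proof -
  obtain f F where fF: "represents f u" "S1_version u F"
    "AE x in lborel. ((\<lambda>t. \<bar>t\<bar> powr (- \<delta>) *\<^sub>R (F x t - f x)) \<longlongrightarrow> 0) (at 0)"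
    using assms(1) by (auto simp: S1_converges_def)
  from fF(3) have "AE x in lborel. ((\<lambda>t. \<bar>t\<bar> powr (- \<gamma>) *\<^sub>R (F x t - f x)) \<longlongrightarrow> 0) (at 0)"
  proof eventually_elim
    case (elim x)
    show ?case
    proof (rule Lim_null_comparison[OF _ tendsto_norm_zero[OF elim]])
      show "\<forall>\<^sub>F t in at 0. norm (\<bar>t\<bar> powr (- \<gamma>) *\<^sub>R (F x t - f x)) \<le> norm (\<bar>t\<bar> powr (- \<delta>) *\<^sub>R (F x t - f x))"
        unfolding eventually_at
        by (intro exI[of _ 1]) (auto intro!: mult_right_mono powr_mono' simp: assms(2))
    qed
  qed
  with fF show ?thesis by (auto simp: S1_converges_def)
qed

lemma sobolev_mono:
  fixes u :: "'a::euclidean_space distr"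
  assumes "u \<in> sobolev s" "r \<le> s" shows "u \<in> sobolev r"
proof -
  obtain g where t: "tempered u" and g: "represents g (fourier_distr u)"
    and gi: "integrable lborel (\<lambda>\<xi>. (1 + (norm \<xi>)\<^sup>2) powr s * (norm (g \<xi>))\<^sup>2)"
    using assms(1) by (auto simp: sobolev_def)
  have [measurable]: "g \<in> borel_measurable borel" using g by (simp add: represents_def)
  have "integrable lborel (\<lambda>\<xi>. (1 + (norm \<xi>)\<^sup>2) powr r * (norm (g \<xi>))\<^sup>2)"
    by (rule Bochner_Integration.integrable_bound[OF gi]) (auto intro!: mult_right_mono powr_mono assms(2))
  with t g show ?thesis by (auto simp: sobolev_def)
qed

theorem S1_converges_if:
  fixes u :: "'a::euclidean_space distr"
  assumes "\<delta> < 1" "1 / 2 < s" "\<delta> \<le> s" and u: "u \<in> sobolev s"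
  shows "S1_converges \<delta> u"
proof -
  \<comment> \<open>Any \<open>r\<close> strictly between 1/2 and 1 with
    \<open>\<delta> \<le> r \<le> s\<close> would do; 3/4 only serves to cap \<open>s\<close> below
    1.\<close>
  define r where "r = max \<delta> (min s (3 / 4))"
  have r: "1 / 2 < r" "r < 1" "r \<le> s" "\<delta> \<le> r" using assms(1-3) by (auto simp: r_def)
  from S1_converges_mono[OF S1_converges_at_order[OF r(1,2) sobolev_mono[OF u r(3)]] r(4)] show ?thesis .
qed


section \<open>Wave packets\<close>

lemma norm_unit_box_le: "\<eta> \<in> box 0 (One :: 'a::euclidean_space) \<Longrightarrow> norm \<eta> \<le> DIM('a)"
  using norm_le_l1[of \<eta>] sum_bounded_above[of Basis "\<lambda>b. \<bar>\<eta> \<bullet> b\<bar>" 1]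
  by (force simp: mem_box)

lemma emeasure_translated_unit_box: "emeasure lborel (box a (a + One) :: 'a::euclidean_space set) = 1"
proof -
  have "emeasure lborel (box a (a + One)) = (\<Prod>b\<in>(Basis::'a set). ((a + One) - a) \<bullet> b)"
    by (rule emeasure_lborel_box) (auto simp: inner_add_left)
  also have "\<dots> = 1" by simp
  finally show ?thesis .
qed

lemma of_real_indicator_complex: "complex_of_real (indicator A x) = indicator A x"
  by (simp split: split_indicator)

lemma integrable_indicator_unit_box: "integrable lborel (indicator (box a (a + One)) :: 'a::euclidean_space \<Rightarrow> complex)"
proof -
  have "integrable lborel (\<lambda>x. complex_of_real (indicator (box a (a + One)) x))"
    unfolding complex_of_real_integrable_eq
    by (rule integrable_real_indicator) (auto simp: emeasure_translated_unit_box)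
  then show ?thesis by (simp add: of_real_indicator_complex)
qed

text \<open>Its transform lives on a unit cube, so multiplication by a plane wave moves the
  frequencies to a translated cube. In space, what matters is that it is Lipschitz and stays away
  from 0 near the origin.\<close>

definition unit_bump :: "'a::euclidean_space \<Rightarrow> complex" where
  "unit_bump = inv_fourier (indicator (box 0 One))"

lemma two_pi_power_ge_1: "(2 * pi) ^ n \<ge> 1"
  using pi_gt3 by (intro one_le_power) simp

text \<open>The cube has volume 1, so a pointwise bound of the phase difference passes to the
  integrals unchanged.\<close>

lemma norm_phase_difference_le:
  fixes f g :: "'a::euclidean_space \<Rightarrow> real"
  assumes [measurable]: "f \<in> borel_measurable borel" "g \<in> borel_measurable borel"
    and le: "\<And>\<eta>. \<eta> \<in> box 0 One \<Longrightarrow> \<bar>f \<eta> - g \<eta>\<bar> \<le> C"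
  shows "norm ((LINT \<eta>|lborel. cis (f \<eta>) * indicator (box 0 One) \<eta>) - (LINT \<eta>|lborel. cis (g \<eta>) * indicator (box 0 One) \<eta>)) \<le> C"
proof -
  have i: "integrable lborel (indicator (box 0 One) :: 'a \<Rightarrow> complex)"
    using integrable_indicator_unit_box[of "0 :: 'a"] by simp
  have m: "measure lborel (box 0 One :: 'a set) = 1"
    using emeasure_translated_unit_box[of "0::'a"] by (simp add: measure_def)
  have "(LINT \<eta>|lborel. cis (f \<eta>) * indicator (box 0 One) \<eta>) - (LINT \<eta>|lborel. cis (g \<eta>) * indicator (box 0 One) \<eta>)
     = (LINT \<eta>|lborel. cis (f \<eta>) * indicator (box 0 One) \<eta> - cis (g \<eta>) * indicator (box 0 One) \<eta>)"
    by (intro Bochner_Integration.integral_diff[symmetric] integrable_cis_mult i) auto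
  also have "norm \<dots> \<le> (LINT \<eta>|lborel. C * indicator (box 0 One) (\<eta>::'a))"
  proof (rule Bochner_Integration.integral_norm_bound_integral)
    show "integrable lborel (\<lambda>\<eta>. cis (f \<eta>) * indicator (box 0 One) \<eta> - cis (g \<eta>) * indicator (box 0 One) \<eta>)"
      by (intro Bochner_Integration.integrable_diff integrable_cis_mult i) auto
    show "integrable lborel (\<lambda>\<eta>::'a. C * indicator (box 0 One) \<eta>)"
      using emeasure_translated_unit_box[of "0::'a"] by (intro integrable_mult_right integrable_real_indicator) auto
    fix \<eta> :: 'a
    show "norm (cis (f \<eta>) * indicator (box 0 One) \<eta> - cis (g \<eta>) * indicator (box 0 One) \<eta>) \<le> C * indicator (box 0 One) \<eta>"
    proof (cases "\<eta> \<in> box 0 One")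
      case True
      have "cis (f \<eta>) - cis (g \<eta>) = cis (g \<eta>) * (cis (f \<eta> - g \<eta>) - 1)"
        by (simp add: right_diff_distrib cis_mult)
      then have "norm (cis (f \<eta>) - cis (g \<eta>)) \<le> \<bar>f \<eta> - g \<eta>\<bar>"
        by (simp only: norm_mult norm_cis mult_1 norm_cis_minus_1_le)
      with le[OF True] show ?thesis using True by simp
    qed simp
  qed
  also have "\<dots> = C" by (simp add: m)
  finally show ?thesis .
qed

lemma unit_bump_cis: "unit_bump x = (LINT \<eta>|lborel. cis (x \<bullet> \<eta>) * indicator (box 0 One) \<eta>) / of_real ((2 * pi) ^ DIM('a))" for x :: "'a::euclidean_space"
  by (simp add: unit_bump_def inv_fourier_cis)

lemma unit_bump_lipschitz: "norm (unit_bump x - unit_bump y) \<le> DIM('a) * norm (x - y) / (2 * pi) ^ DIM('a)" for x y :: "'a::euclidean_space"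
proof -
  have "norm ((LINT \<eta>|lborel. cis (x \<bullet> \<eta>) * indicator (box 0 One) \<eta>) - (LINT \<eta>|lborel. cis (y \<bullet> \<eta>) * indicator (box 0 One) \<eta>)) \<le> DIM('a) * norm (x - y)"
  proof (rule norm_phase_difference_le)
    fix \<eta> :: 'a assume "\<eta> \<in> box 0 One"
    have "\<bar>x \<bullet> \<eta> - y \<bullet> \<eta>\<bar> \<le> norm (x - y) * norm \<eta>"
      using Cauchy_Schwarz_ineq2[of "x - y" \<eta>] by (simp add: inner_diff_left)
    also have "\<dots> \<le> norm (x - y) * DIM('a)" by (intro mult_left_mono norm_unit_box_le \<open>\<eta> \<in> box 0 One\<close>) simp
    finally show "\<bar>x \<bullet> \<eta> - y \<bullet> \<eta>\<bar> \<le> DIM('a) * norm (x - y)" by (simp add: mult.commute)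
  qed auto
  then show ?thesis
    unfolding unit_bump_cis diff_divide_distrib[symmetric] norm_divide norm_of_real
    by (subst abs_of_nonneg) (auto intro: divide_right_mono)
qed

lemma unit_bump_0: "unit_bump (0::'a::euclidean_space) = 1 / of_real ((2 * pi) ^ DIM('a))"
proof -
  have m: "measure lborel (box 0 One :: 'a set) = 1"
    using emeasure_translated_unit_box[of "0::'a"] by (simp add: measure_def)
  have "(LINT \<eta>|lborel. indicator (box 0 One) (\<eta>::'a) :: complex) = 1"
    using m unfolding of_real_indicator_complex[symmetric] integral_complex_of_real by simp
  then show ?thesis by (simp add: unit_bump_cis)
qed

text \<open>Within this radius the Lipschitz bound loses at most half of the value at 0.\<close>

lemma unit_bump_ge:
  fixes x :: "'a::euclidean_space"
  assumes "norm x \<le> 1 / (2 * DIM('a))"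
  shows "norm (unit_bump x) \<ge> 1 / (2 * (2 * pi) ^ DIM('a))"
proof -
  have "DIM('a) * norm (x - 0) \<le> 1 / 2" using assms DIM_positive[where 'a='a] by (simp add: field_simps)
  then have "DIM('a) * norm (x - 0) / (2 * pi) ^ DIM('a) \<le> (1 / 2) / (2 * pi) ^ DIM('a)"
    by (rule divide_right_mono) simp
  with unit_bump_lipschitz[of x 0] have "norm (unit_bump x - unit_bump (0::'a)) \<le> (1 / 2) / (2 * pi) ^ DIM('a)"
    by (rule order_trans)
  moreover have "norm (unit_bump (0::'a)) = 1 / (2 * pi) ^ DIM('a)" by (simp add: unit_bump_0 norm_divide norm_power norm_mult)
  moreover have "norm (unit_bump (0::'a)) \<le> norm (unit_bump x) + norm (unit_bump x - unit_bump (0::'a))"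
    using norm_triangle_sub[of "unit_bump (0::'a)" "unit_bump x"] by (simp add: norm_minus_commute)
  moreover have "1 / (2 * P) = 1 / P / 2" "1 / 2 / P = 1 / P / 2" for P :: real by simp_all
  ultimately show ?thesis by linarith
qed

text \<open>For a basis vector \<open>e\<close>, these open unit cubes are disjoint for distinct
  \<open>N\<close>, being separated in the coordinate \<open>e\<close>.\<close>

definition frequency_cell :: "'a::euclidean_space \<Rightarrow> nat \<Rightarrow> 'a set" where
  "frequency_cell e N = box (real N *\<^sub>R e) (real N *\<^sub>R e + One)"

lemma measurable_frequency_cell [measurable]: "frequency_cell e N \<in> sets borel"
  by (simp add: frequency_cell_def)

lemma emeasure_frequency_cell: "emeasure lborel (frequency_cell e N) = 1"
  unfolding frequency_cell_def by (rule emeasure_translated_unit_box)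

lemma integrable_frequency_cell: "integrable lborel (indicator (frequency_cell e N) :: 'a::euclidean_space \<Rightarrow> complex)"
  unfolding frequency_cell_def by (rule integrable_indicator_unit_box)

lemma frequency_cell_iff: "real N *\<^sub>R e + \<eta> \<in> frequency_cell e N \<longleftrightarrow> \<eta> \<in> box 0 One"
  by (auto simp: frequency_cell_def mem_box inner_add_left)

lemma frequency_cell_unique:
  assumes "e \<in> Basis" "\<xi> \<in> frequency_cell e N" "\<xi> \<in> frequency_cell e M"
  shows "N = M"
proof -
  have "real N < \<xi> \<bullet> e" "\<xi> \<bullet> e < real N + 1" "real M < \<xi> \<bullet> e" "\<xi> \<bullet> e < real M + 1"
    using assms by (auto simp: frequency_cell_def mem_box inner_add_left)
  then have "real N < real M + 1" "real M < real N + 1" by linarith+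
  then show ?thesis by simp
qed

lemma norm_frequency_cell_le:
  fixes e :: "'a::euclidean_space"
  assumes "e \<in> Basis" "\<xi> \<in> frequency_cell e N"
  shows "norm \<xi> \<le> N + DIM('a)"
proof -
  have "\<xi> - real N *\<^sub>R e \<in> box 0 One" using assms(2) frequency_cell_iff[of N e "\<xi> - real N *\<^sub>R e"] by simp
  then have "norm (\<xi> - real N *\<^sub>R e) \<le> DIM('a)" by (rule norm_unit_box_le)
  moreover have "norm \<xi> \<le> norm (real N *\<^sub>R e) + norm (\<xi> - real N *\<^sub>R e)" by (metis norm_triangle_sub)
  ultimately show ?thesis using assms(1) by simp
qed

text \<open>For \<xi> the shifted frequency, \<open>norm \<xi> - \<xi> \<bullet> e\<close> is
  \<open>(norm \<xi>)\<^sup>2 - (\<xi> \<bullet> e)\<^sup>2\<close> divided by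
  \<open>norm \<xi> + \<xi> \<bullet> e\<close>. The numerator is the sum of the squares of the
  transverse coordinates, each at most 1, and the denominator is at least \<open>N\<close>.\<close>

lemma norm_minus_inner_le:
  fixes e \<eta> :: "'a::euclidean_space"
  assumes e: "e \<in> Basis" and N: "N \<ge> 1" and \<eta>: "\<eta> \<in> box 0 One"
  shows "0 \<le> norm (real N *\<^sub>R e + \<eta>) - (N + \<eta> \<bullet> e)" "norm (real N *\<^sub>R e + \<eta>) - (N + \<eta> \<bullet> e) \<le> DIM('a) / N"
proof -
  define \<xi> where "\<xi> = real N *\<^sub>R e + \<eta>"
  have \<eta>e: "0 < \<eta> \<bullet> e" using \<eta> e by (auto simp: mem_box)
  have \<xi>e: "\<xi> \<bullet> e = N + \<eta> \<bullet> e" using e by (simp add: \<xi>_def inner_add_left)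
  have 1: "\<xi> \<bullet> e \<le> norm \<xi>" using Basis_le_norm[OF e, of \<xi>] by simp
  then show "0 \<le> norm (real N *\<^sub>R e + \<eta>) - (N + \<eta> \<bullet> e)" by (simp add: \<xi>_def[symmetric] \<xi>e)
  have "(norm \<xi>)\<^sup>2 - (\<xi> \<bullet> e)\<^sup>2 = (\<Sum>b\<in>Basis - {e}. (\<xi> \<bullet> b)\<^sup>2)"
    unfolding norm_sq_Basis using e by (subst sum.remove[of Basis e]) auto
  also have "\<dots> \<le> (\<Sum>b\<in>Basis - {e}. 1)"
  proof (rule sum_mono)
    fix b assume b: "b \<in> Basis - {e}"
    then have "\<xi> \<bullet> b = \<eta> \<bullet> b" using e by (simp add: \<xi>_def inner_add_left inner_Basis eq_commute[of e b])
    then show "(\<xi> \<bullet> b)\<^sup>2 \<le> 1" using \<eta> b by (auto simp: mem_box power_le_one less_imp_le)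
  qed
  also have "\<dots> \<le> DIM('a)" by (simp add: card_Diff1_le)
  finally have "(norm \<xi> - \<xi> \<bullet> e) * (norm \<xi> + \<xi> \<bullet> e) \<le> DIM('a)"
    by (simp add: power2_eq_square algebra_simps)
  moreover have "(norm \<xi> - \<xi> \<bullet> e) * N \<le> (norm \<xi> - \<xi> \<bullet> e) * (norm \<xi> + \<xi> \<bullet> e)"
    using 1 \<eta>e \<xi>e by (intro mult_left_mono) auto
  ultimately have "(norm \<xi> - \<xi> \<bullet> e) * N \<le> DIM('a)" by linarith
  then show "norm (real N *\<^sub>R e + \<eta>) - (N + \<eta> \<bullet> e) \<le> DIM('a) / N"
    unfolding \<xi>_def[symmetric] \<xi>e[symmetric] using N by (simp add: pos_le_divide_eq)
qed

text \<open>Replacing the norm of the frequency by its linear part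
  \<open>N + \<eta> \<bullet> e\<close> makes the evolution an exact translation along
  \<open>e\<close>. The phase error is t times the difference of the two, which is at most
  \<open>DIM('a) / N\<close>.\<close>

lemma wave_frequency_cell:
  fixes e x :: "'a::euclidean_space"
  assumes e: "e \<in> Basis" and N: "N \<ge> 1"
  shows "norm (wave (indicator (frequency_cell e N)) x t - cis (real N * (x \<bullet> e + t)) * unit_bump (x + t *\<^sub>R e)) \<le> \<bar>t\<bar> * DIM('a) / N"
proof -
  let ?I = "indicator (box 0 One) :: 'a \<Rightarrow> complex" and ?c = "(2 * pi) ^ DIM('a)"
  have ind: "indicator (frequency_cell e N) (real N *\<^sub>R e + 1 *\<^sub>R \<eta>) = ?I \<eta>" for \<eta>
    using frequency_cell_iff[of N e \<eta>] by (simp add: indicator_def)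
  have 1: "wave (indicator (frequency_cell e N)) x t =
     (LINT \<eta>|lborel. cis (x \<bullet> (real N *\<^sub>R e + \<eta>) + t * norm (real N *\<^sub>R e + \<eta>)) * ?I \<eta>) / of_real ?c"
    unfolding wave_def inv_fourier_cis
    by (subst integral_lborel_affine[where c=1 and t="real N *\<^sub>R e"])
       (auto simp: ind[simplified] cis_mult[symmetric] mult.assoc)
  have 2: "cis (real N * (x \<bullet> e + t)) * unit_bump (x + t *\<^sub>R e) =
     (LINT \<eta>|lborel. cis (real N * (x \<bullet> e + t) + (x + t *\<^sub>R e) \<bullet> \<eta>) * ?I \<eta>) / of_real ?c"
    unfolding unit_bump_cis by (simp add: cis_mult[symmetric] mult.assoc)
  have "norm ((LINT \<eta>|lborel. cis (x \<bullet> (real N *\<^sub>R e + \<eta>) + t * norm (real N *\<^sub>R e + \<eta>)) * ?I \<eta>)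
      - (LINT \<eta>|lborel. cis (real N * (x \<bullet> e + t) + (x + t *\<^sub>R e) \<bullet> \<eta>) * ?I \<eta>)) \<le> \<bar>t\<bar> * DIM('a) / N"
  proof (rule norm_phase_difference_le)
    fix \<eta> :: 'a assume \<eta>: "\<eta> \<in> box 0 One"
    have "x \<bullet> (real N *\<^sub>R e + \<eta>) + t * norm (real N *\<^sub>R e + \<eta>) - (N * (x \<bullet> e + t) + (x + t *\<^sub>R e) \<bullet> \<eta>)
      = t * (norm (real N *\<^sub>R e + \<eta>) - (N + \<eta> \<bullet> e))"
      by (simp add: inner_add_left inner_add_right inner_commute algebra_simps)
    also have "\<bar>\<dots>\<bar> \<le> \<bar>t\<bar> * (DIM('a) / N)"
      unfolding abs_mult using norm_minus_inner_le[OF e N \<eta>] by (intro mult_left_mono) auto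
    finally show "\<bar>x \<bullet> (real N *\<^sub>R e + \<eta>) + t * norm (real N *\<^sub>R e + \<eta>) - (N * (x \<bullet> e + t) + (x + t *\<^sub>R e) \<bullet> \<eta>)\<bar> \<le> \<bar>t\<bar> * DIM('a) / N"
      by simp
  qed auto
  from divide_right_mono[OF this, of ?c]
  have "norm (wave (indicator (frequency_cell e N)) x t - cis (real N * (x \<bullet> e + t)) * unit_bump (x + t *\<^sub>R e)) \<le> (\<bar>t\<bar> * DIM('a) / N) / ?c"
    unfolding 1 2 diff_divide_distrib[symmetric] norm_divide norm_of_real by (subst abs_of_nonneg) auto
  also have "\<dots> \<le> \<bar>t\<bar> * DIM('a) / N"
    using divide_left_mono[OF two_pi_power_ge_1[of "DIM('a)"], of "\<bar>t\<bar> * DIM('a) / N"] by simp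
  finally show ?thesis .
qed

section \<open>Superposition of wave packets\<close>

lemma
  fixes f :: "nat \<Rightarrow> 'a::euclidean_space \<Rightarrow> complex"
  assumes f: "\<And>m. integrable lborel (f m)" and s: "\<And>\<xi>. summable (\<lambda>m. norm (f m \<xi>))"
    and n: "summable (\<lambda>m. LINT \<xi>|lborel. norm (f m \<xi>))"
  shows integrable_series: "integrable lborel (\<lambda>\<xi>. \<Sum>m. f m \<xi>)"
    and wave_series: "(\<lambda>m. wave (f m) x t) sums wave (\<lambda>\<xi>. \<Sum>m. f m \<xi>) x t"
proof -
  show "integrable lborel (\<lambda>\<xi>. \<Sum>m. f m \<xi>)"
    by (rule integrable_suminf[OF f _ n]) (use s in auto)
  have [measurable]: "f m \<in> borel_measurable borel" for m using f[of m] by simp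
  have "(\<lambda>m. LINT \<xi>|lborel. cis (x \<bullet> \<xi>) * (cis (t * norm \<xi>) * f m \<xi>)) sums
    (LINT \<xi>|lborel. (\<Sum>m. cis (x \<bullet> \<xi>) * (cis (t * norm \<xi>) * f m \<xi>)))"
  proof (rule sums_integral)
    show "integrable lborel (\<lambda>\<xi>. cis (x \<bullet> \<xi>) * (cis (t * norm \<xi>) * f m \<xi>))" for m
      by (intro integrable_cis_mult f) measurable
  qed (use s n in \<open>auto simp: norm_mult\<close>)
  moreover have "(\<Sum>m. cis (x \<bullet> \<xi>) * (cis (t * norm \<xi>) * f m \<xi>)) = cis (x \<bullet> \<xi>) * (cis (t * norm \<xi>) * (\<Sum>m. f m \<xi>))" for \<xi>
    using summable_norm_cancel[OF s[of \<xi>]] by (simp add: suminf_mult summable_mult)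
  ultimately show "(\<lambda>m. wave (f m) x t) sums wave (\<lambda>\<xi>. \<Sum>m. f m \<xi>) x t"
    unfolding wave_def inv_fourier_cis by (simp add: sums_divide)
qed

lemma ennreal_term_le_suminf: "f j \<le> (\<Sum>j. f j)" for f :: "nat \<Rightarrow> ennreal"
  using sum_le_suminf[of f "{j}"] by simp

text \<open>A Cauchy-Schwarz inequality for series with weights \<open>4 ^ j\<close>: each term is
  at most \<open>(1 / 2) ^ j\<close> times the square root of the weighted sum, and the geometric
  series contributes 2, squared to 4. If the weighted sum is infinite the claim is trivial.\<close>

lemma norm_suminf_sq_le: "ennreal ((norm (\<Sum>j. z j :: complex))\<^sup>2) \<le> 4 * (\<Sum>j. ennreal (4 ^ j * (norm (z j))\<^sup>2))"
proof (cases "(\<Sum>j. ennreal (4 ^ j * (norm (z j))\<^sup>2))")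
  case (real v)
  have term_le: "norm (z j) \<le> (1 / 2) ^ j * sqrt v" for j
  proof -
    have "ennreal (4 ^ j * (norm (z j))\<^sup>2) \<le> ennreal v"
      using ennreal_term_le_suminf[of "\<lambda>j. ennreal (4 ^ j * (norm (z j))\<^sup>2)" j] unfolding real(2) .
    then have "4 ^ j * (norm (z j))\<^sup>2 \<le> v" using real(1) by simp
    then have "(1 / 4) ^ j * (4 ^ j * (norm (z j))\<^sup>2) \<le> (1 / 4) ^ j * v" by (rule mult_left_mono) simp
    moreover have "(1 / 4) ^ j * (4 ^ j * (norm (z j))\<^sup>2) = (norm (z j))\<^sup>2"
      by (simp add: mult.assoc[symmetric] power_mult_distrib[symmetric] del: power_divide)
    moreover have "((1 / 2) ^ j * sqrt v)\<^sup>2 = (1 / 4) ^ j * v"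
    proof -
      have "((1 / 2) ^ j)\<^sup>2 = ((1 / 2)\<^sup>2 :: real) ^ j" by (simp only: power_mult[symmetric] mult.commute)
      also have "(1 / 2)\<^sup>2 = (1 / 4 :: real)" by (simp add: power2_eq_square)
      finally show ?thesis using real(1) by (simp add: power_mult_distrib del: power_divide)
    qed
    ultimately have "(norm (z j))\<^sup>2 \<le> ((1 / 2) ^ j * sqrt v)\<^sup>2" by simp
    then show ?thesis by (rule power2_le_imp_le) (use real in auto)
  qed
  have g: "summable (\<lambda>j. (1 / 2) ^ j * sqrt v)" by (intro summable_mult2 summable_geometric) simp
  have s: "summable (\<lambda>j. norm (z j))" by (rule summable_comparison_test'[OF g]) (use term_le in auto)
  have "norm (\<Sum>j. z j) \<le> (\<Sum>j. norm (z j))" by (rule summable_norm[OF s])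
  also have "\<dots> \<le> (\<Sum>j. (1 / 2) ^ j * sqrt v)" by (intro suminf_le term_le s g)
  also have "\<dots> = 2 * sqrt v" by (subst suminf_mult2[symmetric]) (auto simp: suminf_geometric)
  finally have "(norm (\<Sum>j. z j))\<^sup>2 \<le> (2 * sqrt v)\<^sup>2" by (intro power_mono) auto
  also have "\<dots> = 4 * v" using real(1) by (simp add: power_mult_distrib)
  finally show ?thesis unfolding real(2) using real(1) by (simp add: ennreal_mult[symmetric] ennreal_leI flip: ennreal_numeral)
qed (simp add: ennreal_mult_top)

text \<open>The data on the Fourier side. Under the summability assumed below, the function in space
  is \<open>unit_bump x * profile N c (x \<bullet> e)\<close>.\<close>

definition packet :: "'a::euclidean_space \<Rightarrow> (nat \<Rightarrow> nat) \<Rightarrow> (nat \<Rightarrow> complex) \<Rightarrow> 'a \<Rightarrow> complex" where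
  "packet e N c \<xi> = (\<Sum>m. c m * indicator (frequency_cell e (N m)) \<xi>)"

definition profile :: "(nat \<Rightarrow> nat) \<Rightarrow> (nat \<Rightarrow> complex) \<Rightarrow> real \<Rightarrow> complex" where
  "profile N c y = (\<Sum>m. c m * cis (real (N m) * y))"

text \<open>\<open>S1_converges\<close> asserts the existence of a function and a version, so
  refuting it takes a statement about all of them. Versions agree only at almost every time, hence
  the nested quantifiers; the bump stays inside the series because summability is known for the
  product.\<close>

definition follows_profiles ::
  "'a::euclidean_space \<Rightarrow> (nat \<Rightarrow> nat) \<Rightarrow> (nat \<Rightarrow> nat \<Rightarrow> complex) \<Rightarrow> real \<Rightarrow> 'a distr \<Rightarrow> bool" where
  "follows_profiles e N c C u \<longleftrightarrow> (\<forall>f F. represents f u \<longrightarrow> S1_version u F \<longrightarrow>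
     (AE x in lborel. summable (\<lambda>j. unit_bump x * profile N (c j) (x \<bullet> e)) \<and>
        f x = (\<Sum>j. unit_bump x * profile N (c j) (x \<bullet> e))) \<and>
     (AE x in lborel. AE t in lborel. summable (\<lambda>j. unit_bump (x + t *\<^sub>R e) * profile N (c j) (x \<bullet> e + t)) \<and>
        norm (F x t - (\<Sum>j. unit_bump (x + t *\<^sub>R e) * profile N (c j) (x \<bullet> e + t))) \<le> C * \<bar>t\<bar>))"

lemma follows_profilesD:
  assumes "follows_profiles e N c C u" "represents f u" "S1_version u F"
  shows "AE x in lborel. summable (\<lambda>j. unit_bump x * profile N (c j) (x \<bullet> e)) \<and>
      f x = (\<Sum>j. unit_bump x * profile N (c j) (x \<bullet> e))"
    and "AE x in lborel. AE t in lborel. summable (\<lambda>j. unit_bump (x + t *\<^sub>R e) * profile N (c j) (x \<bullet> e + t)) \<and>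
      norm (F x t - (\<Sum>j. unit_bump (x + t *\<^sub>R e) * profile N (c j) (x \<bullet> e + t))) \<le> C * \<bar>t\<bar>"
  using assms unfolding follows_profiles_def by blast+

text \<open>The three bounds serve separate ends: \<open>c1\<close> makes every packet integrable;
  \<open>c2\<close> bounds the squared Sobolev norm of packet \<open>j\<close>, with a decay that
  outweighs the factor \<open>4 ^ j\<close> lost in summing over \<open>j\<close>; \<open>c3\<close>
  sums the errors of size \<open>1 / N\<close> of the translation approximation.\<close>

context
  fixes e :: "'a::euclidean_space" and N :: "nat \<Rightarrow> nat" and c :: "nat \<Rightarrow> nat \<Rightarrow> complex" and s K :: real
  assumes e: "e \<in> Basis" and N: "inj N" "\<And>m. N m \<ge> 1" and s: "s \<ge> 0" and K: "K > 0"
    and c1: "\<And>j. summable (\<lambda>m. norm (c j m))"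
    and c2: "\<And>j. (\<Sum>m. ennreal (real (N m) powr (2 * s) * (norm (c j m))\<^sup>2)) \<le> ennreal (K * (1 / 16) ^ j)"
    and c3: "\<And>j. (\<Sum>m. norm (c j m) / N m) \<le> K * (1 / 2) ^ j"
begin

lemma summable_cell: "summable (\<lambda>m. norm (c j m * indicator (frequency_cell e (N m)) \<xi>))"
  by (rule summable_comparison_test'[OF c1[of j]]) (auto simp: norm_mult indicator_def)

lemma integrable_cell: "integrable lborel (\<lambda>\<xi>. c j m * indicator (frequency_cell e (N m)) \<xi>)"
  by (intro integrable_mult_right integrable_frequency_cell)

lemma summable_integral_cell: "summable (\<lambda>m. LINT \<xi>|lborel. norm (c j m * indicator (frequency_cell e (N m)) \<xi>))"
proof -
  have "(LINT \<xi>|lborel. norm (c j m * indicator (frequency_cell e (N m)) \<xi>)) = norm (c j m)" for m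
  proof -
    have "norm (indicator (frequency_cell e (N m)) \<xi> :: complex) = indicator (frequency_cell e (N m)) \<xi>" for \<xi>
      by (simp split: split_indicator)
    then show ?thesis using emeasure_frequency_cell[of e "N m"] by (simp add: norm_mult measure_def)
  qed
  then show ?thesis using c1 by simp
qed

lemma integrable_packet: "integrable lborel (packet e N (c j))"
  unfolding packet_def[abs_def] by (rule integrable_series[OF integrable_cell summable_cell summable_integral_cell])

lemma measurable_packet [measurable]: "packet e N (c j) \<in> borel_measurable borel"
  using integrable_packet[of j] by simp

lemma wave_packet: "norm (wave (packet e N (c j)) x t - unit_bump (x + t *\<^sub>R e) * profile N (c j) (x \<bullet> e + t)) \<le> \<bar>t\<bar> * DIM('a) * K * (1 / 2) ^ j"
proof -
  have w1: "wave (\<lambda>\<xi>. a * f \<xi>) x t = a * wave f x t" for a and f :: "'a \<Rightarrow> complex"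
    unfolding wave_def inv_fourier_cis by (simp add: mult.left_commute[of _ a])
  have 1: "(\<lambda>m. c j m * wave (indicator (frequency_cell e (N m))) x t) sums wave (packet e N (c j)) x t"
    unfolding packet_def[abs_def] w1[symmetric]
    by (rule wave_series[OF integrable_cell summable_cell summable_integral_cell])
  have "summable (\<lambda>m. c j m * cis (real (N m) * (x \<bullet> e + t)))"
    by (rule summable_norm_cancel) (use c1 in \<open>simp add: norm_mult\<close>)
  then have 2: "(\<lambda>m. unit_bump (x + t *\<^sub>R e) * (c j m * cis (real (N m) * (x \<bullet> e + t)))) sums (unit_bump (x + t *\<^sub>R e) * profile N (c j) (x \<bullet> e + t))"
    unfolding profile_def by (intro sums_mult summable_sums)
  have d: "norm (c j m * wave (indicator (frequency_cell e (N m))) x t - unit_bump (x + t *\<^sub>R e) * (c j m * cis (real (N m) * (x \<bullet> e + t))))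
     \<le> \<bar>t\<bar> * DIM('a) * (norm (c j m) / N m)" for m
  proof -
    have "c j m * wave (indicator (frequency_cell e (N m))) x t - unit_bump (x + t *\<^sub>R e) * (c j m * cis (real (N m) * (x \<bullet> e + t)))
      = c j m * (wave (indicator (frequency_cell e (N m))) x t - cis (real (N m) * (x \<bullet> e + t)) * unit_bump (x + t *\<^sub>R e))"
      by (simp add: algebra_simps)
    also have "norm \<dots> \<le> norm (c j m) * (\<bar>t\<bar> * DIM('a) / N m)"
      unfolding norm_mult by (intro mult_left_mono wave_frequency_cell e N) auto
    finally show ?thesis by (simp add: mult_ac)
  qed
  have sm: "summable (\<lambda>m. norm (c j m) / N m)"
  proof (rule summable_comparison_test'[OF c1[of j], of 0])
    fix m show "norm (norm (c j m) / N m) \<le> norm (c j m)"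
      using N(2)[of m] by (simp add: divide_le_eq mult_le_cancel_left1)
  qed
  then have sm': "summable (\<lambda>m. \<bar>t\<bar> * DIM('a) * (norm (c j m) / N m))" by (rule summable_mult)
  have "norm (wave (packet e N (c j)) x t - unit_bump (x + t *\<^sub>R e) * profile N (c j) (x \<bullet> e + t)) \<le> (\<Sum>m. \<bar>t\<bar> * DIM('a) * (norm (c j m) / N m))"
    unfolding sums_unique[OF sums_diff[OF 1 2]] by (rule norm_suminf_le[OF d sm'])
  also have "\<dots> = \<bar>t\<bar> * DIM('a) * (\<Sum>m. norm (c j m) / N m)" by (rule suminf_mult[OF sm])
  also have "\<dots> \<le> \<bar>t\<bar> * DIM('a) * (K * (1 / 2) ^ j)" by (intro mult_left_mono c3) auto
  finally show ?thesis by (simp add: mult.assoc)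
qed

text \<open>The cells are disjoint because \<open>N\<close> is injective, so at each frequency at
  most one term survives, and on cell \<open>N m\<close> the Sobolev weight is at most a constant
  times \<open>real (N m) powr (2 * s)\<close>.\<close>

lemma packet_weight:
  "(\<integral>\<^sup>+\<xi>. ennreal ((1 + (norm \<xi>)\<^sup>2) powr s * (norm (packet e N (c j) \<xi>))\<^sup>2) \<partial>lborel) \<le> ennreal ((DIM('a) + 2) powr (2 * s) * K * (1 / 16) ^ j)"
proof -
  let ?I = "\<lambda>m. indicator (frequency_cell e (N m)) :: 'a \<Rightarrow> ennreal"
  let ?D = "real (DIM('a) + 2) powr (2 * s)"
  have pw: "ennreal ((1 + (norm \<xi>)\<^sup>2) powr s * (norm (packet e N (c j) \<xi>))\<^sup>2)
     \<le> (\<Sum>m. ennreal (?D * (real (N m) powr (2 * s) * (norm (c j m))\<^sup>2)) * ?I m \<xi>)" for \<xi>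
  proof (cases "\<exists>m. \<xi> \<in> frequency_cell e (N m)")
    case True
    then obtain m where m: "\<xi> \<in> frequency_cell e (N m)" by blast
    have "(\<lambda>l. c j l * indicator (frequency_cell e (N l)) \<xi>) = (\<lambda>l. if l = m then c j l else 0)"
    proof
      fix l show "c j l * indicator (frequency_cell e (N l)) \<xi> = (if l = m then c j l else 0)"
        using m frequency_cell_unique[OF e _ m, of "N l"] injD[OF N(1), of l m] by (cases "l = m") (auto simp: indicator_def)
    qed
    then have p: "packet e N (c j) \<xi> = c j m" unfolding packet_def using sums_single[of m "c j"] by (simp add: sums_iff)
    have "1 + (norm \<xi>)\<^sup>2 \<le> (1 + norm \<xi>)\<^sup>2" by (simp add: power2_eq_square algebra_simps)
    also have "\<dots> \<le> (real (DIM('a) + 2) * real (N m))\<^sup>2"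
    proof (rule power_mono)
      have "1 + norm \<xi> \<le> 1 + (real (N m) + DIM('a))" using norm_frequency_cell_le[OF e m] by simp
      also have "\<dots> \<le> real (DIM('a) + 2) * real (N m)"
        using N(2)[of m] mult_left_mono[of 1 "real (N m)" "real DIM('a) + 1"] by (simp add: algebra_simps)
      finally show "1 + norm \<xi> \<le> real (DIM('a) + 2) * real (N m)" .
    qed simp
    finally have "(1 + (norm \<xi>)\<^sup>2) powr s \<le> ((real (DIM('a) + 2) * real (N m))\<^sup>2) powr s"
      using s by (intro powr_mono2) auto
    also have "\<dots> = ?D * real (N m) powr (2 * s)"
    proof -
      have "((y::real)\<^sup>2) powr s = y powr (2 * s)" if "y > 0" for y
      proof -
        have "y\<^sup>2 = y powr 2" using that by simp
        then show ?thesis by (simp only: powr_powr)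
      qed
      then have "(x * y)\<^sup>2 powr s = x powr (2 * s) * y powr (2 * s)" if "x > 0" "y > 0" for x y :: real
        using that by (simp add: powr_mult)
      then show ?thesis using N(2)[of m] by simp
    qed
    finally have "(1 + (norm \<xi>)\<^sup>2) powr s * (norm (packet e N (c j) \<xi>))\<^sup>2 \<le> ?D * real (N m) powr (2 * s) * (norm (c j m))\<^sup>2"
      unfolding p by (intro mult_right_mono) auto
    then have "ennreal ((1 + (norm \<xi>)\<^sup>2) powr s * (norm (packet e N (c j) \<xi>))\<^sup>2) \<le> ennreal (?D * (real (N m) powr (2 * s) * (norm (c j m))\<^sup>2)) * ?I m \<xi>"
      using m by (simp add: mult.assoc ennreal_leI)
    also have "\<dots> \<le> (\<Sum>m. ennreal (?D * (real (N m) powr (2 * s) * (norm (c j m))\<^sup>2)) * ?I m \<xi>)"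
      by (rule ennreal_term_le_suminf)
    finally show ?thesis .
  qed (simp add: packet_def)
  have "(\<integral>\<^sup>+\<xi>. ennreal ((1 + (norm \<xi>)\<^sup>2) powr s * (norm (packet e N (c j) \<xi>))\<^sup>2) \<partial>lborel) \<le>
    (\<integral>\<^sup>+\<xi>. (\<Sum>m. ennreal (?D * (real (N m) powr (2 * s) * (norm (c j m))\<^sup>2)) * ?I m \<xi>) \<partial>lborel)"
    by (intro nn_integral_mono pw)
  also have "\<dots> = (\<Sum>m. ennreal (?D * (real (N m) powr (2 * s) * (norm (c j m))\<^sup>2)))"
    by (subst nn_integral_suminf) (auto simp: nn_integral_cmult_indicator emeasure_frequency_cell)
  also have "\<dots> = ennreal ?D * (\<Sum>m. ennreal (real (N m) powr (2 * s) * (norm (c j m))\<^sup>2))"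
    by (simp add: ennreal_mult ennreal_suminf_cmult)
  also have "\<dots> \<le> ennreal ?D * ennreal (K * (1 / 16) ^ j)" by (intro mult_left_mono c2) auto
  also have "\<dots> = ennreal (?D * K * (1 / 16) ^ j)" using K by (simp add: ennreal_mult[symmetric] mult.assoc)
  finally show ?thesis by (simp add: add.commute)
qed

lemma weight_ge_1: "1 \<le> (1 + (norm (\<xi>::'a))\<^sup>2) powr s"
  using s by (intro ge_one_powr_ge_zero) auto

text \<open>The packets are added over \<open>j\<close> by means of their L^2 norms, not of their
  coefficients: the sum of the profiles is allowed to be unbounded, as the logarithmic example
  demands.\<close>

lemma ex_wave_packet_family:
  "\<exists>u \<in> (sobolev s :: 'a distr set). follows_profiles e N c (2 * DIM('a) * K) u"
proof -
  define H where "H \<xi> = (\<Sum>j. packet e N (c j) \<xi>)" for \<xi>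
  have [measurable]: "H \<in> borel_measurable borel" unfolding H_def by measurable
  let ?D = "real (DIM('a) + 2) powr (2 * s)"
  define a where "a j = sqrt (?D * K) * (1 / 4) ^ j" for j :: nat
  have a: "a j > 0" "summable a" for j
    unfolding a_def using K by (auto intro!: summable_mult summable_geometric mult_pos_pos)
  have a_sq: "(a j)\<^sup>2 = ?D * K * (1 / 16) ^ j" for j
  proof -
    have "((1 / 4) ^ j)\<^sup>2 = ((1 / 4)\<^sup>2 :: real) ^ j" by (simp only: power_mult[symmetric] mult.commute)
    also have "(1 / 4)\<^sup>2 = (1 / 16 :: real)" by (simp add: power2_eq_square)
    finally have q: "((1 / 4) ^ j)\<^sup>2 = (1 / 16 :: real) ^ j" .
    have "(sqrt (?D * K))\<^sup>2 = ?D * K" by (rule real_sqrt_pow2) (use K in simp)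
    with q show ?thesis unfolding a_def power_mult_distrib[of "sqrt _"] by (simp only:)
  qed
  have l2: "l2sq (packet e N (c j)) \<le> ennreal ((a j)\<^sup>2)" for j
  proof -
    have "l2sq (packet e N (c j)) \<le> (\<integral>\<^sup>+\<xi>. ennreal ((1 + (norm \<xi>)\<^sup>2) powr s * (norm (packet e N (c j) \<xi>))\<^sup>2) \<partial>lborel)"
      unfolding l2sq_def using mult_right_mono[OF weight_ge_1, of "(norm (packet e N (c j) _))\<^sup>2"]
      by (intro nn_integral_mono ennreal_leI) simp
    also have "\<dots> \<le> ennreal ((a j)\<^sup>2)" using packet_weight[of j] unfolding a_sq by (simp add: add.commute)
    finally show ?thesis .
  qed
  have Hw: "(\<integral>\<^sup>+\<xi>. ennreal ((1 + (norm \<xi>)\<^sup>2) powr s * (norm (H \<xi>))\<^sup>2) \<partial>lborel) < \<infinity>"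
  proof -
    have "ennreal ((1 + (norm \<xi>)\<^sup>2) powr s * (norm (H \<xi>))\<^sup>2) \<le> 4 * (\<Sum>j. ennreal (4 ^ j) * ennreal ((1 + (norm \<xi>)\<^sup>2) powr s * (norm (packet e N (c j) \<xi>))\<^sup>2))" for \<xi>
    proof -
      have "ennreal ((1 + (norm \<xi>)\<^sup>2) powr s * (norm (H \<xi>))\<^sup>2) = ennreal ((1 + (norm \<xi>)\<^sup>2) powr s) * ennreal ((norm (H \<xi>))\<^sup>2)"
        by (rule ennreal_mult) auto
      also have "\<dots> \<le> ennreal ((1 + (norm \<xi>)\<^sup>2) powr s) * (4 * (\<Sum>j. ennreal (4 ^ j * (norm (packet e N (c j) \<xi>))\<^sup>2)))"
        unfolding H_def by (intro mult_left_mono norm_suminf_sq_le) auto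
      also have "\<dots> = 4 * (\<Sum>j. ennreal ((1 + (norm \<xi>)\<^sup>2) powr s) * ennreal (4 ^ j * (norm (packet e N (c j) \<xi>))\<^sup>2))"
        unfolding ennreal_suminf_cmult by (simp only: mult.left_commute)
      also have "(\<lambda>j. ennreal ((1 + (norm \<xi>)\<^sup>2) powr s) * ennreal (4 ^ j * (norm (packet e N (c j) \<xi>))\<^sup>2)) =
        (\<lambda>j. ennreal (4 ^ j) * ennreal ((1 + (norm \<xi>)\<^sup>2) powr s * (norm (packet e N (c j) \<xi>))\<^sup>2))"
        by (simp add: ennreal_mult[symmetric] mult.left_commute)
      finally show ?thesis .
    qed
    then have "(\<integral>\<^sup>+\<xi>. ennreal ((1 + (norm \<xi>)\<^sup>2) powr s * (norm (H \<xi>))\<^sup>2) \<partial>lborel) \<le>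
      (\<integral>\<^sup>+\<xi>. 4 * (\<Sum>j. ennreal (4 ^ j) * ennreal ((1 + (norm \<xi>)\<^sup>2) powr s * (norm (packet e N (c j) \<xi>))\<^sup>2)) \<partial>lborel)"
      by (intro nn_integral_mono)
    also have "\<dots> = 4 * (\<Sum>j. ennreal (4 ^ j) * (\<integral>\<^sup>+\<xi>. ennreal ((1 + (norm \<xi>)\<^sup>2) powr s * (norm (packet e N (c j) \<xi>))\<^sup>2) \<partial>lborel))"
      by (simp add: nn_integral_cmult nn_integral_suminf)
    also have "\<dots> \<le> 4 * (\<Sum>j. ennreal (?D * K * (1 / 4) ^ j))"
    proof (intro mult_left_mono suminf_le)
      fix j
      have "ennreal (4 ^ j) * (\<integral>\<^sup>+\<xi>. ennreal ((1 + (norm \<xi>)\<^sup>2) powr s * (norm (packet e N (c j) \<xi>))\<^sup>2) \<partial>lborel) \<le> ennreal (4 ^ j) * ennreal (?D * K * (1 / 16) ^ j)"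
        using packet_weight[of j] by (intro mult_left_mono) (auto simp: add.commute)
      also have "\<dots> = ennreal (?D * K * (4 ^ j * (1 / 16) ^ j))" using K by (simp add: ennreal_mult[symmetric] mult_ac)
      also have "4 ^ j * (1 / 16) ^ j = ((1 / 4) ^ j :: real)" by (simp add: power_mult_distrib[symmetric])
      finally show "ennreal (4 ^ j) * (\<integral>\<^sup>+\<xi>. ennreal ((1 + (norm \<xi>)\<^sup>2) powr s * (norm (packet e N (c j) \<xi>))\<^sup>2) \<partial>lborel) \<le> ennreal (?D * K * (1 / 4) ^ j)" .
    qed auto
    also have "\<dots> < \<infinity>"
      using K by (subst suminf_ennreal2) (auto intro!: summable_mult summable_geometric mult_nonneg_nonneg simp: ennreal_mult_less_top)
    finally show ?thesis .
  qed
  have "l2sq H \<le> (\<integral>\<^sup>+\<xi>. ennreal ((1 + (norm \<xi>)\<^sup>2) powr s * (norm (H \<xi>))\<^sup>2) \<partial>lborel)"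
    unfolding l2sq_def using mult_right_mono[OF weight_ge_1, of "(norm (H _))\<^sup>2"]
    by (intro nn_integral_mono ennreal_leI) simp
  then have l2H: "l2sq H < \<infinity>" using Hw by (rule order_le_less_trans)
  define u where "u = inv_fourier_distr (distr_of_fun H)"
  have g: "represents H (fourier_distr u)"
    unfolding u_def by (rule represents_fourier_inv_fourier[OF _ l2H]) measurable
  have "integrable lborel (\<lambda>\<xi>. (1 + (norm \<xi>)\<^sup>2) powr s * (norm (H \<xi>))\<^sup>2)"
    by (rule integrableI_bounded) (use Hw in \<open>auto simp: abs_mult\<close>)
  then have u: "u \<in> sobolev s"
    using g tempered_inv_fourier_distr[OF _ l2H] by (auto simp: sobolev_def u_def)
  have gh: "AE \<xi> in lborel. H \<xi> = (\<Sum>j. packet e N (c j) \<xi>)" by (simp add: H_def)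
  have w_summable: "AE x in lborel. summable (\<lambda>j. norm (wave (packet e N (c j)) x t))" for t
  proof (rule AE_summable_l2_series[OF _ a])
    fix j
    have "l2sq (\<lambda>x. wave (packet e N (c j)) x t) \<le> l2sq (\<lambda>\<xi>. cis (t * norm \<xi>) * packet e N (c j) \<xi>)"
      unfolding wave_def by (intro l2sq_inv_fourier_le integrable_cis_mult integrable_packet) measurable
    also have "\<dots> = l2sq (packet e N (c j))" by (rule l2sq_cong_norm) (simp add: norm_mult)
    finally show "l2sq (\<lambda>x. wave (packet e N (c j)) x t) \<le> ennreal ((a j)\<^sup>2)" using l2 by (rule order_trans)
  qed measurable
  define E where "E j x t = wave (packet e N (c j)) x t - unit_bump (x + t *\<^sub>R e) * profile N (c j) (x \<bullet> e + t)" for j x t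
  have E_bound: "norm (E j x t) \<le> \<bar>t\<bar> * DIM('a) * K * (1 / 2) ^ j" for j x t
    unfolding E_def by (rule wave_packet)
  have gs: "summable (\<lambda>j. \<bar>t\<bar> * DIM('a) * K * (1 / 2) ^ j)" for t :: real
    by (intro summable_mult summable_geometric) simp
  have E_summable: "summable (\<lambda>j. norm (E j x t))" for x t
    by (rule summable_comparison_test'[OF gs]) (use E_bound in auto)
  have E_sum: "norm (\<Sum>j. E j x t) \<le> 2 * DIM('a) * K * \<bar>t\<bar>" for x t
  proof -
    have "norm (\<Sum>j. E j x t) \<le> (\<Sum>j. \<bar>t\<bar> * DIM('a) * K * (1 / 2) ^ j)"
      by (rule norm_suminf_le[OF E_bound gs])
    also have "\<dots> = 2 * DIM('a) * K * \<bar>t\<bar>"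
      by (subst suminf_mult) (auto simp: suminf_geometric summable_geometric)
    finally show ?thesis .
  qed
  have expand: "summable (\<lambda>j. unit_bump (x + t *\<^sub>R e) * profile N (c j) (x \<bullet> e + t)) \<and>
      norm ((\<Sum>j. wave (packet e N (c j)) x t) - (\<Sum>j. unit_bump (x + t *\<^sub>R e) * profile N (c j) (x \<bullet> e + t))) \<le> 2 * DIM('a) * K * \<bar>t\<bar>"
    if w: "summable (\<lambda>j. norm (wave (packet e N (c j)) x t))" for x t
  proof -
    note sE = summable_norm_cancel[OF E_summable[of x t]] and sw = summable_norm_cancel[OF w]
    have "summable (\<lambda>j. unit_bump (x + t *\<^sub>R e) * profile N (c j) (x \<bullet> e + t))"
      using summable_diff[OF sw sE] by (simp add: E_def)
    moreover from this have "(\<Sum>j. wave (packet e N (c j)) x t) - (\<Sum>j. unit_bump (x + t *\<^sub>R e) * profile N (c j) (x \<bullet> e + t)) = (\<Sum>j. E j x t)"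
      unfolding E_def by (rule suminf_diff[OF sw])
    ultimately show ?thesis using E_sum[of x t] by simp
  qed
  show ?thesis
    unfolding follows_profiles_def
  proof (intro bexI[OF _ u] allI impI conjI)
    fix f F assume f: "represents f u" and F: "S1_version u F"
    have "AE x in lborel. f x = (\<Sum>j. wave (packet e N (c j)) x 0)"
      by (rule represents_unique[OF f represents_series[OF g gh integrable_packet a l2] refl])
    with w_summable[of 0]
    show "AE x in lborel. summable (\<lambda>j. unit_bump x * profile N (c j) (x \<bullet> e)) \<and> f x = (\<Sum>j. unit_bump x * profile N (c j) (x \<bullet> e))"
    proof eventually_elim
      case (elim x) then show ?case using expand[of x 0] by simp
    qed
    have [measurable]: "(\<lambda>(x, t). F x t) \<in> borel_measurable (borel \<Otimes>\<^sub>M borel)"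
      using F by (simp add: S1_version_def borel_prod)
    \<comment> \<open>Summability is phrased by an extended nonnegative sum so that the predicate is
      measurable on the product; Fubini can then exchange almost every x and almost every t.\<close>
    define P where "P x t \<longleftrightarrow> F x t = (\<Sum>j. wave (packet e N (c j)) x t) \<and> (\<Sum>j. ennreal (norm (wave (packet e N (c j)) x t))) < \<infinity>" for x t
    have "AE x in lborel. P x t" for t
    proof -
      have "AE x in lborel. F x t = (\<Sum>j. wave (packet e N (c j)) x t)"
        using F by (intro represents_unique[OF _ S1_represents_series[OF g gh integrable_packet a l2] refl]) (simp add: S1_version_def)
      with w_summable[of t] show ?thesis
        unfolding P_def by eventually_elim (auto simp: suminf_ennreal2)
    qed
    then have "AE t in lborel. AE x in lborel. P x t" by simp
    moreover have "{z \<in> space (lborel \<Otimes>\<^sub>M lborel). P (fst z) (snd z)} \<in> sets (lborel \<Otimes>\<^sub>M lborel)"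
      unfolding P_def by measurable
    ultimately have "AE x in lborel. AE t in lborel. P x t"
      by (subst lborel_pair.AE_commute) auto
    then show "AE x in lborel. AE t in lborel. summable (\<lambda>j. unit_bump (x + t *\<^sub>R e) * profile N (c j) (x \<bullet> e + t)) \<and>
        norm (F x t - (\<Sum>j. unit_bump (x + t *\<^sub>R e) * profile N (c j) (x \<bullet> e + t))) \<le> 2 * DIM('a) * K * \<bar>t\<bar>"
    proof eventually_elim
      case (elim x)
      then show ?case
      proof eventually_elim
        case (elim t)
        then have "summable (\<lambda>j. norm (wave (packet e N (c j)) x t))"
          unfolding P_def by (intro summable_suminf_not_top) auto
        from expand[OF this] elim show ?case unfolding P_def by simp
      qed
    qed
  qed
qed

end


section \<open>Counterexamples\<close>

text \<open>Nonempty open sets are not negligible. Both the point x and the bad times t are selected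
  through this lemma.\<close>

lemma AE_lborel_ex_open:
  fixes U :: "'a::euclidean_space set"
  assumes "AE x in lborel. P x" "open U" "U \<noteq> {}"
  obtains x where "x \<in> U" "P x"
proof -
  obtain M where M: "{x \<in> space lborel. \<not> P x} \<subseteq> M" "M \<in> null_sets lborel"
    using assms(1) by (auto elim: AE_E3 AE_E simp: null_sets_def) 
  have "\<not> U \<subseteq> M"
  proof
    assume "U \<subseteq> M"
    moreover have "negligible M" using M(2) by (simp add: negligible_iff_null_sets null_sets_completionI)
    ultimately have "negligible U" by (rule negligible_subset[rotated])
    then show False using open_not_negligible[OF assms(2,3)] by contradiction
  qed
  then show ?thesis using that M(1) by auto
qed

text \<open>Intended are \<open>B = real R powr (- \<delta>)\<close> and
  \<open>A = real R powr (- (1 - \<delta>))\<close>. At times comparable to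
  \<open>R ^ (- k)\<close>, term \<open>k\<close> changes by at least \<open>B ^ k\<close>. Slower
  terms are bounded by their derivatives and give a geometric series in \<open>A\<close>, faster
  terms by their size and give one in \<open>B\<close>. The number 1/21 makes
  \<open>5 * A / (1 - A)\<close> at most 1/4 and \<open>2 * B / (1 - B)\<close> at most 1/10, which
  together stay below 1/2.\<close>

lemma lacunary_increment:
  fixes R :: nat and A B k y t
  defines "G \<equiv> \<lambda>y. \<Sum>m. complex_of_real (B ^ m) * cis (real (R ^ m) * y)"
  assumes A: "0 < A" "A \<le> 1 / 21" and B: "0 < B" "B \<le> 1 / 21" and R: "real R * A * B = 1"
    and t: "pi / 2 \<le> real (R ^ k) * t" "real (R ^ k) * t \<le> 3 * pi / 2"
  shows "B ^ k / 2 \<le> norm (G (y + t) - G y)" and "norm (G y) \<le> 2"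
proof -
  define z where "z m = complex_of_real (B ^ m) * cis (real (R ^ m) * (y + t)) - complex_of_real (B ^ m) * cis (real (R ^ m) * y)" for m
  have R0: "real R > 0" using R A B by (cases "R = 0") auto
  have Rk: "real (R ^ k) > 0" using R0 by simp
  have t0: "t \<ge> 0" using t(1) Rk pi_gt_zero by (smt (verit) zero_less_mult_pos pi_half_gt_zero)
  have gB: "summable (\<lambda>m. B ^ m)" using B by (intro summable_geometric) auto
  have sG: "summable (\<lambda>m. norm (complex_of_real (B ^ m) * cis (real (R ^ m) * y)))" for y
    using gB B by (simp add: norm_mult norm_power)
  show "norm (G y) \<le> 2"
  proof -
    have "norm (G y) \<le> (\<Sum>m. B ^ m)"
      unfolding G_def by (rule norm_suminf_le[OF _ gB]) (use B in \<open>simp add: norm_mult norm_power\<close>)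
    also have "\<dots> = 1 / (1 - B)" using B by (intro suminf_geometric) auto
    also have "\<dots> \<le> 2" using B by (simp add: divide_le_eq)
    finally show ?thesis .
  qed
  have z_sums: "z sums (G (y + t) - G y)"
    unfolding z_def G_def using sG[THEN summable_norm_cancel] by (intro sums_diff summable_sums)
  then have sz: "summable z" by (rule sums_summable)
  have norm_z: "norm (z m) = B ^ m * norm (cis (real (R ^ m) * t) - 1)" for m
  proof -
    have "z m = complex_of_real (B ^ m) * cis (real (R ^ m) * y) * (cis (real (R ^ m) * t) - 1)"
      by (simp add: z_def algebra_simps cis_mult)
    then show ?thesis using B by (simp add: norm_mult norm_power)
  qed
  have low: "norm (\<Sum>m<k. z m) \<le> B ^ k / 4"
  proof -
    have "norm (z m) \<le> 5 * B ^ k * A ^ (k - m)" if "m < k" for m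
    proof -
      have "norm (z m) \<le> B ^ m * (real (R ^ m) * t)"
        unfolding norm_z using norm_cis_minus_1_le[of "real (R ^ m) * t"] t0 B by (intro mult_left_mono) auto
      \<comment> \<open>Inserting a power of \<open>real R * A * B = 1\<close> trades
        \<open>R ^ m\<close> for \<open>R ^ k\<close>; the number 5 below bounds
        \<open>3 * pi / 2\<close>.\<close>
      also have "\<dots> = B ^ m * (real (R ^ m) * ((real R * A * B) ^ (k - m))) * t" by (simp add: R)
      also have "\<dots> = B ^ (m + (k - m)) * (real R ^ (m + (k - m)) * t) * A ^ (k - m)"
        by (simp add: power_mult_distrib power_add mult_ac)
      also have "\<dots> = B ^ k * (real (R ^ k) * t) * A ^ (k - m)" using that by simp
      also have "\<dots> \<le> B ^ k * 5 * A ^ (k - m)"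
        using t(2) pi_less_4 pi_approx A B by (intro mult_right_mono mult_left_mono) auto
      finally show ?thesis by (simp add: mult_ac)
    qed
    then have "norm (\<Sum>m<k. z m) \<le> (\<Sum>m<k. 5 * B ^ k * A ^ (k - m))" by (intro sum_norm_le) auto
    also have "\<dots> = (\<Sum>m<k. 5 * B ^ k * A * A ^ (k - Suc m))"
      by (intro sum.cong refl) (simp add: Suc_diff_Suc mult.assoc flip: power_Suc)
    also have "\<dots> = (\<Sum>m<k. 5 * B ^ k * A * A ^ m)" by (rule sum.nat_diff_reindex)
    also have "\<dots> = 5 * B ^ k * A * (\<Sum>m<k. A ^ m)" by (simp add: sum_distrib_left)
    also have "\<dots> \<le> 5 * B ^ k * A * (1 / (1 - A))"
    proof (rule mult_left_mono)
      have "(\<Sum>m<k. A ^ m) \<le> (\<Sum>m. A ^ m)" using A by (intro sum_le_suminf summable_geometric) auto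
      then show "(\<Sum>m<k. A ^ m) \<le> 1 / (1 - A)" using A by (simp add: suminf_geometric)
    qed (use A B in auto)
    also have "\<dots> = B ^ k * (5 * A / (1 - A))" by simp
    also have "\<dots> \<le> B ^ k * (1 / 4)" using A B by (intro mult_left_mono) (auto simp: divide_le_eq)
    finally show ?thesis by simp
  qed
  have high: "norm (\<Sum>m. z (m + Suc k)) \<le> B ^ k / 10"
  proof -
    have le: "norm (z (m + Suc k)) \<le> 2 * B ^ Suc k * B ^ m" for m
    proof -
      have "norm (cis (real (R ^ (m + Suc k)) * t) - 1) \<le> 2"
        using norm_triangle_ineq4[of "cis (real (R ^ (m + Suc k)) * t)" 1] by simp
      then have "norm (z (m + Suc k)) \<le> B ^ (m + Suc k) * 2" unfolding norm_z using B by (intro mult_left_mono) auto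
      then show ?thesis by (simp add: power_add mult_ac)
    qed
    have "norm (\<Sum>m. z (m + Suc k)) \<le> (\<Sum>m. 2 * B ^ Suc k * B ^ m)"
      by (rule norm_suminf_le[OF le summable_mult[OF gB]])
    also have "\<dots> = 2 * B ^ Suc k * (1 / (1 - B))" using B gB by (simp add: suminf_mult suminf_geometric)
    also have "\<dots> = B ^ k * (2 * B / (1 - B))" by simp
    also have "\<dots> \<le> B ^ k * (1 / 10)" using B by (intro mult_left_mono) (auto simp: divide_le_eq)
    finally show ?thesis by simp
  qed
  \<comment> \<open>On the half circle from \<open>pi / 2\<close> to \<open>3 * pi / 2\<close> the
    cosine is nonpositive, so \<open>cis\<close> has distance at least 1 from 1. This leaves a whole
    interval of admissible times.\<close>
  have mid: "norm (z k) \<ge> B ^ k"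
  proof -
    let ?\<theta> = "real (R ^ k) * t"
    have "cos ?\<theta> \<le> 0"
    proof (cases "?\<theta> \<le> pi")
      case True
      then have "cos ?\<theta> \<le> cos (pi / 2)" using t by (intro cos_monotone_0_pi_le) auto
      then show ?thesis by simp
    next
      case False
      have "cos ?\<theta> = cos (2 * pi - ?\<theta>)" by (simp add: cos_diff)
      also have "\<dots> \<le> cos (pi / 2)" using t False by (intro cos_monotone_0_pi_le) auto
      finally show ?thesis by simp
    qed
    then have "1 \<le> \<bar>Re (cis ?\<theta> - 1)\<bar>" by simp
    also have "\<dots> \<le> norm (cis ?\<theta> - 1)" by (rule abs_Re_le_cmod)
    finally have "B ^ k * 1 \<le> B ^ k * norm (cis ?\<theta> - 1)" using B by (intro mult_left_mono) auto
    then show ?thesis unfolding norm_z by simp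
  qed
  have "G (y + t) - G y = (\<Sum>m. z (m + Suc k)) + ((\<Sum>m<k. z m) + z k)"
    using suminf_split_initial_segment[OF sz, of "Suc k"] sums_unique[OF z_sums] by simp
  then have "z k = (G (y + t) - G y) - (\<Sum>m. z (m + Suc k)) - (\<Sum>m<k. z m)" by simp
  then have "norm (z k) \<le> norm (G (y + t) - G y) + norm (\<Sum>m. z (m + Suc k)) + norm (\<Sum>m<k. z m)"
    by (metis norm_triangle_ineq4 norm_triangle_le_diff order_trans add_right_mono)
  then show "B ^ k / 2 \<le> norm (G (y + t) - G y)" using low high mid zero_le_power[of B k] B by linarith
qed

text \<open>At times comparable to \<open>R ^ (- k)\<close> the profile changes by an amount of
  order \<open>B ^ k\<close>, that is |t| ^ \<delta>, whereas all errors are of order |t|, that is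
  \<open>A ^ k * B ^ k\<close>.\<close>

lemma S1_not_converges_below_exponent:
  assumes \<delta>: "0 < \<delta>" "\<delta> < 1" and s: "0 \<le> s" "s < \<delta>"
  shows "\<exists>u \<in> (sobolev s :: 'a::euclidean_space distr set). \<not> S1_converges \<delta> u"
proof -
  obtain e :: 'a where e: "e \<in> Basis" using nonempty_Basis by blast
  obtain R :: nat where R: "R \<ge> 2" "real R powr (- \<delta>) \<le> 1 / 21" "real R powr (- (1 - \<delta>)) \<le> 1 / 21"
  proof -
    have lim: "(\<lambda>R. real R powr (- \<delta>)) \<longlonglongrightarrow> 0" "(\<lambda>R. real R powr (- (1 - \<delta>))) \<longlonglongrightarrow> 0"
      using \<delta> by (auto intro!: tendsto_neg_powr filterlim_real_sequentially)
    have "\<forall>\<^sub>F R in sequentially. real R powr (- \<delta>) < 1 / 21" by (rule order_tendstoD(2)[OF lim(1)]) simp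
    moreover have "\<forall>\<^sub>F R in sequentially. real R powr (- (1 - \<delta>)) < 1 / 21" by (rule order_tendstoD(2)[OF lim(2)]) simp
    ultimately have "\<forall>\<^sub>F R in sequentially. R \<ge> 2 \<and> real R powr (- \<delta>) \<le> 1 / 21 \<and> real R powr (- (1 - \<delta>)) \<le> 1 / 21"
      using eventually_ge_at_top[of "2::nat"] by eventually_elim linarith
    from eventually_happens'[OF sequentially_bot this] obtain R :: nat
      where "R \<ge> 2 \<and> real R powr (- \<delta>) \<le> 1 / 21 \<and> real R powr (- (1 - \<delta>)) \<le> 1 / 21" by blast
    with that show ?thesis by blast
  qed
  define A B where "A = real R powr (- (1 - \<delta>))" and "B = real R powr (- \<delta>)"
  have AB: "0 < A" "A \<le> 1 / 21" "0 < B" "B \<le> 1 / 21" "real R * A * B = 1"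
  proof -
    have "real R powr 1 * A * B = 1" unfolding A_def B_def mult.assoc powr_add[symmetric] using R by simp
    then show "real R * A * B = 1" using R by simp
  qed (use R in \<open>auto simp: A_def B_def\<close>)
  define N where "N m = R ^ m" for m :: nat
  \<comment> \<open>A single packet carries the example; the family is 0 for positive
    \<open>j\<close>.\<close>
  define c where "c j m = (if j = 0 then complex_of_real (B ^ m) else 0)" for j m :: nat
  \<comment> \<open>Ratio of the geometric series for the squared Sobolev norm; it equals
    \<open>real R powr (2 * (s - \<delta>))\<close> and is below 1 because
    \<open>s < \<delta>\<close>.\<close>
  define q where "q = real R powr (2 * s) * B\<^sup>2"
  have q: "0 < q" "q < 1"
  proof -
    have "q = real R powr (2 * (s - \<delta>))"
      unfolding q_def B_def power2_eq_square powr_add[symmetric] by (simp add: algebra_simps)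
    then show "0 < q" "q < 1" using R s by (auto intro: powr_less_one)
  qed
  define K where "K = 1 / (1 - q) + 2"
  have K: "K > 0" "1 / (1 - q) \<le> K" "2 \<le> K" using q by (auto simp: K_def add_pos_pos)
  have gB: "summable (\<lambda>m. B ^ m)" using AB by (intro summable_geometric) auto
  have "\<exists>u \<in> (sobolev s :: 'a distr set). follows_profiles e N c (2 * DIM('a) * K) u"
  proof (rule ex_wave_packet_family[OF e _ _ s(1) K(1)])
    show "inj N" using R by (auto simp: N_def inj_on_def)
    show "N m \<ge> 1" for m using R by (simp add: N_def)
    show "summable (\<lambda>m. norm (c j m))" for j using gB AB by (cases "j = 0") (simp_all add: c_def norm_power)
    show "(\<Sum>m. ennreal (real (N m) powr (2 * s) * (norm (c j m))\<^sup>2)) \<le> ennreal (K * (1 / 16) ^ j)" for j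
    proof (cases "j = 0")
      case True
      have "real (N m) powr (2 * s) * (norm (c j m))\<^sup>2 = q ^ m" for m
      proof -
        have "real (N m) powr (2 * s) = (real R powr (2 * s)) ^ m"
          using R by (simp add: N_def powr_powr powr_realpow[symmetric] mult.commute)
        moreover have "(norm (c j m))\<^sup>2 = (B\<^sup>2) ^ m"
          using True AB by (simp add: c_def norm_power power_mult[symmetric] mult.commute)
        ultimately show ?thesis by (simp add: q_def power_mult_distrib)
      qed
      then have "(\<Sum>m. ennreal (real (N m) powr (2 * s) * (norm (c j m))\<^sup>2)) = ennreal (1 / (1 - q))"
        using q by (simp add: suminf_ennreal2 summable_geometric suminf_geometric)
      also have "\<dots> \<le> ennreal (K * (1 / 16) ^ j)" using K(2) True by (intro ennreal_leI) simp
      finally show ?thesis .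
    qed (simp add: c_def)
    show "(\<Sum>m. norm (c j m) / N m) \<le> K * (1 / 2) ^ j" for j
    proof (cases "j = 0")
      case True
      have le: "norm (c j m) / N m \<le> B ^ m" for m
      proof -
        have "B ^ m / real (R ^ m) \<le> B ^ m / 1" using AB R by (intro divide_left_mono) auto
        then show ?thesis using True AB by (simp add: c_def norm_power N_def)
      qed
      then have "(\<Sum>m. norm (c j m) / N m) \<le> (\<Sum>m. B ^ m)"
        by (intro suminf_le gB summable_comparison_test'[OF gB, of 0]) auto
      also have "\<dots> = 1 / (1 - B)" using AB by (intro suminf_geometric) auto
      also have "\<dots> \<le> 2" using AB by (simp add: divide_le_eq)
      finally show ?thesis using K True by simp
    qed (use K in \<open>simp add: c_def\<close>)
  qed
  then obtain u :: "'a distr" where u: "u \<in> sobolev s" and fam: "follows_profiles e N c (2 * DIM('a) * K) u" ..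
  define G where "G y = (\<Sum>m. complex_of_real (B ^ m) * cis (real (R ^ m) * y))" for y
  have prof: "(\<Sum>j. a * profile N (c j) y) = a * G y" for a y
  proof -
    have "(\<lambda>j. a * profile N (c j) y) = (\<lambda>j. if j = 0 then a * G y else 0)"
      by (auto simp: profile_def c_def G_def N_def)
    then show ?thesis using sums_single[of 0 "\<lambda>_. a * G y"] by (simp add: sums_iff)
  qed
  have "\<not> S1_converges \<delta> u"
  proof
    assume "S1_converges \<delta> u"
    then obtain f F where fF: "represents f u" "S1_version u F"
      and lim: "AE x in lborel. ((\<lambda>t. \<bar>t\<bar> powr (- \<delta>) *\<^sub>R (F x t - f x)) \<longlongrightarrow> 0) (at 0)"
      by (auto simp: S1_converges_def)
    have "AE x in lborel. ((\<lambda>t. \<bar>t\<bar> powr (- \<delta>) *\<^sub>R (F x t - f x)) \<longlongrightarrow> 0) (at 0) \<and>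
       f x = unit_bump x * G (x \<bullet> e) \<and>
       (AE t in lborel. norm (F x t - unit_bump (x + t *\<^sub>R e) * G (x \<bullet> e + t)) \<le> 2 * DIM('a) * K * \<bar>t\<bar>)"
      using lim follows_profilesD[OF fam fF] unfolding prof
    proof eventually_elim
      case (elim x)
      from elim(3) have "AE t in lborel. norm (F x t - unit_bump (x + t *\<^sub>R e) * G (x \<bullet> e + t)) \<le> 2 * DIM('a) * K * \<bar>t\<bar>"
        by (rule eventually_mono) blast
      with elim(1,2) show ?case by blast
    qed
    moreover have "open (ball (0::'a) (1 / (2 * DIM('a))))" "ball (0::'a) (1 / (2 * DIM('a))) \<noteq> {}" by auto
    ultimately obtain x where x: "x \<in> ball 0 (1 / (2 * DIM('a)))"
      and limx: "((\<lambda>t. \<bar>t\<bar> powr (- \<delta>) *\<^sub>R (F x t - f x)) \<longlongrightarrow> 0) (at 0)"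
      and fx: "f x = unit_bump x * G (x \<bullet> e)"
      and Fx: "AE t in lborel. norm (F x t - unit_bump (x + t *\<^sub>R e) * G (x \<bullet> e + t)) \<le> 2 * DIM('a) * K * \<bar>t\<bar>"
      by (rule AE_lborel_ex_open) blast
    define c0 where "c0 = 1 / (2 * (2 * pi) ^ DIM('a))"
    have c0: "c0 > 0" "norm (unit_bump x) \<ge> c0"
      using unit_bump_ge[of x] x by (auto simp: c0_def dist_norm)
    \<comment> \<open>40 is 5 times 8: as \<open>t powr \<delta>\<close> will be at most
      \<open>5 * B ^ k\<close>, this leaves \<open>c0 / 8 * B ^ k\<close>. With another
      \<open>c0 / 8\<close> from the errors linear in t it contradicts the lower bound
      \<open>c0 * (B ^ k / 2)\<close>.\<close>
    have "\<forall>\<^sub>F t in at 0. norm (\<bar>t\<bar> powr (- \<delta>) *\<^sub>R (F x t - f x)) < c0 / 40"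
      using tendstoD[OF limx, of "c0 / 40"] c0 by simp
    then obtain \<epsilon> where \<epsilon>: "\<epsilon> > 0" "\<And>t. t \<noteq> 0 \<Longrightarrow> \<bar>t\<bar> < \<epsilon> \<Longrightarrow> \<bar>t\<bar> powr (- \<delta>) * norm (F x t - f x) < c0 / 40"
      unfolding eventually_at by (auto simp: dist_norm)
    \<comment> \<open>Two errors are linear in t: the deviation of the wave from a translate, and
      the change of the bump over the distance t.\<close>
    define C where "C = 2 * DIM('a) * K + 2 * DIM('a)"
    have C: "C > 0" using K DIM_positive[where 'a='a] by (auto simp: C_def intro!: add_nonneg_pos)
    have R1: "real R > 1" using R by simp
    have RAB: "1 / real R = A * B" using AB(5) R1 by (simp add: field_simps)
    have lims: "(\<lambda>k. 5 * (1 / real R) ^ k) \<longlonglongrightarrow> 5 * 0" "(\<lambda>k. 5 * C * A ^ k) \<longlonglongrightarrow> 5 * C * 0"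
      using R1 AB by (intro tendsto_mult_left LIMSEQ_realpow_zero; simp)+
    have "\<forall>\<^sub>F k in sequentially. 5 * (1 / real R) ^ k < \<epsilon>" by (rule order_tendstoD(2)[OF lims(1)]) (use \<epsilon>(1) in simp)
    moreover have "\<forall>\<^sub>F k in sequentially. 5 * C * A ^ k < c0 / 8" by (rule order_tendstoD(2)[OF lims(2)]) (use c0 in simp)
    ultimately have "\<forall>\<^sub>F k in sequentially. 5 * (1 / real R) ^ k < \<epsilon> \<and> 5 * C * A ^ k < c0 / 8"
      by (rule eventually_conj)
    from eventually_happens'[OF sequentially_bot this] obtain k
      where k: "5 * (1 / real R) ^ k < \<epsilon>" "5 * C * A ^ k < c0 / 8" by blast
    let ?r = "(1 / real R) ^ k"
    have r: "?r > 0" using R1 by simp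
    have Rr: "real (R ^ k) * ?r = 1" using R1 by (simp add: power_one_over)
    \<comment> \<open>The time is picked from an open interval because \<open>F x t\<close> is under
      control only at almost every t.\<close>
    obtain t where t: "t \<in> {pi / 2 * ?r<..<3 * pi / 2 * ?r}"
      and Ft: "norm (F x t - unit_bump (x + t *\<^sub>R e) * G (x \<bullet> e + t)) \<le> 2 * DIM('a) * K * \<bar>t\<bar>"
      by (rule AE_lborel_ex_open[OF Fx, of "{pi / 2 * ?r<..<3 * pi / 2 * ?r}"]) (use r in auto)
    have t0: "t > 0" using t r by (auto intro: less_trans[rotated])
    have t5: "t \<le> 5 * ?r"
    proof -
      have "t \<le> 3 * pi / 2 * ?r" using t by simp
      also have "\<dots> \<le> 5 * ?r" using pi_approx r by (intro mult_right_mono) auto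
      finally show ?thesis .
    qed
    have tR: "pi / 2 \<le> real (R ^ k) * t" "real (R ^ k) * t \<le> 3 * pi / 2"
    proof -
      have Rk: "real (R ^ k) > 0" using R1 by simp
      have "real (R ^ k) * (pi / 2 * ?r) \<le> real (R ^ k) * t" using t Rk by (intro mult_left_mono) auto
      then show "pi / 2 \<le> real (R ^ k) * t" using Rr by (metis mult.left_commute mult.right_neutral)
      have "real (R ^ k) * t \<le> real (R ^ k) * (3 * pi / 2 * ?r)" using t Rk by (intro mult_left_mono) auto
      then show "real (R ^ k) * t \<le> 3 * pi / 2" using Rr by (metis mult.left_commute mult.right_neutral)
    qed
    note inc = lacunary_increment[OF AB tR, folded G_def]
    have rk: "?r = A ^ k * B ^ k" by (simp add: RAB power_mult_distrib)
    have Bk: "B ^ k > 0" using AB by simp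
    have td: "t powr \<delta> \<le> 5 * B ^ k"
    proof -
      have "t powr \<delta> \<le> (5 * ?r) powr \<delta>" using t0 t5 \<delta> by (intro powr_mono2) auto
      also have "\<dots> = 5 powr \<delta> * ?r powr \<delta>" using r by (simp add: powr_mult)
      also have "?r powr \<delta> = B ^ k"
        using R1 by (simp add: B_def power_one_over powr_minus_divide powr_divide powr_realpow[symmetric] powr_powr mult.commute)
      also have "5 powr \<delta> \<le> 5 powr 1" using \<delta> by (intro powr_mono) auto
      finally show ?thesis using Bk by simp
    qed
    have Ff: "norm (F x t - f x) \<le> c0 / 8 * B ^ k"
    proof -
      have "t powr (- \<delta>) * norm (F x t - f x) < c0 / 40" using \<epsilon>(2)[of t] t0 t5 k(1) by simp
      then have "norm (F x t - f x) \<le> c0 / 40 * t powr \<delta>"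
        using t0 by (simp add: powr_minus field_simps)
      also have "\<dots> \<le> c0 / 40 * (5 * B ^ k)" using td c0 by (intro mult_left_mono) auto
      finally show ?thesis by simp
    qed
    have bump: "norm ((unit_bump (x + t *\<^sub>R e) - unit_bump x) * G (x \<bullet> e + t)) \<le> 2 * DIM('a) * t"
    proof -
      have "norm (unit_bump (x + t *\<^sub>R e) - unit_bump x) \<le> DIM('a) * t / (2 * pi) ^ DIM('a)"
        using unit_bump_lipschitz[of "x + t *\<^sub>R e" x] t0 e by simp
      also have "\<dots> \<le> DIM('a) * t / 1"
        using t0 by (intro divide_left_mono two_pi_power_ge_1) auto
      finally have "norm (unit_bump (x + t *\<^sub>R e) - unit_bump x) * norm (G (x \<bullet> e + t)) \<le> (DIM('a) * t) * 2"
        by (intro mult_mono inc(2)) (use t0 in auto)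
      then show ?thesis by (simp add: norm_mult mult_ac)
    qed
    have "c0 * (B ^ k / 2) \<le> norm (unit_bump x) * norm (G (x \<bullet> e + t) - G (x \<bullet> e))"
      using c0 Bk by (intro mult_mono inc(1)) auto
    also have "\<dots> = norm (unit_bump x * (G (x \<bullet> e + t) - G (x \<bullet> e)))" by (simp add: norm_mult)
    also have "unit_bump x * (G (x \<bullet> e + t) - G (x \<bullet> e)) =
       (F x t - f x) - (F x t - unit_bump (x + t *\<^sub>R e) * G (x \<bullet> e + t)) - (unit_bump (x + t *\<^sub>R e) - unit_bump x) * G (x \<bullet> e + t)"
      by (simp add: fx algebra_simps)
    also have "norm \<dots> \<le> norm (F x t - f x) + norm (F x t - unit_bump (x + t *\<^sub>R e) * G (x \<bullet> e + t)) + norm ((unit_bump (x + t *\<^sub>R e) - unit_bump x) * G (x \<bullet> e + t))"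
      by (rule order_trans[OF norm_triangle_ineq4 add_right_mono[OF norm_triangle_ineq4]])
    also have "\<dots> \<le> c0 / 8 * B ^ k + C * t"
      using Ff Ft bump t0 by (simp add: C_def algebra_simps)
    also have "C * t \<le> C * (5 * (A ^ k * B ^ k))" using t5 C unfolding rk by (intro mult_left_mono) auto
    also have "\<dots> = (5 * C * A ^ k) * B ^ k" by simp
    also have "\<dots> \<le> c0 / 8 * B ^ k" using k(2) Bk by (intro mult_right_mono) auto
    finally have "c0 * B ^ k \<le> c0 * B ^ k / 2" by simp
    then show False using c0 Bk by (simp add: mult_le_cancel_left)
  qed
  with u show ?thesis by blast
qed


section \<open>Logarithmic peaks at order one half\<close>

lemma sums_neg_Ln:
  assumes "norm z < 1"
  shows "(\<lambda>m. z ^ Suc m / of_nat (Suc m)) sums (- Ln (1 - z))"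
proof -
  have "(\<lambda>n. - (z ^ n / of_nat n)) sums Ln (1 - z)" using Ln_series'[of "- z"] assms by simp
  from sums_minus[OF this] have "(\<lambda>n. z ^ n / of_nat n) sums (- Ln (1 - z))" by simp
  then show ?thesis by (subst sums_Suc_iff) simp
qed

lemma Re_neg_Ln:
  assumes "norm z < 1" shows "Re (- Ln (1 - z)) = - ln (norm (1 - z))"
  using assms by (subst Re_Ln[symmetric]) auto

text \<open>Peaks grow with their index, so centres of arbitrarily large index are needed in every
  interval. Removing finitely many values from an interval leaves a nonempty open set, which still
  contains a rational.\<close>

lemma ex_rational_enumeration:
  obtains q :: "nat \<Rightarrow> real" where "\<And>a b M. a < b \<Longrightarrow> \<exists>J\<ge>M. a < q J \<and> q J < b"
proof -
  define q :: "nat \<Rightarrow> real" where "q = from_nat_into \<rat>"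
  have "\<exists>J\<ge>M. a < q J \<and> q J < b" if ab: "a < b" for a b :: real and M
  proof -
    have "infinite {a<..<b}" using ab by simp
    then have "{a<..<b} - q ` {..<M} \<noteq> {}" by (metis finite.emptyI finite_Diff2 finite_imageI finite_lessThan)
    then obtain y where y: "y \<in> {a<..<b} - q ` {..<M}" by blast
    have "open ({a<..<b} - q ` {..<M})" by (intro open_Diff finite_imp_closed) auto
    with y obtain d where d: "d > 0" "ball y d \<subseteq> {a<..<b} - q ` {..<M}" by (meson open_contains_ball)
    obtain r where r: "r \<in> \<rat>" "y < r" "r < y + d" using Rats_dense_in_real[of y "y + d"] d(1) by auto
    obtain J where J: "q J = r" unfolding q_def using from_nat_into_surj[OF countable_rat r(1)] by blast
    have "r \<in> ball y d" using r by (simp add: dist_real_def)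
    then have "r \<in> {a<..<b}" "r \<notin> q ` {..<M}" using d(2) by auto
    then have "\<not> J < M" "a < q J" "q J < b" using J by auto
    then show ?thesis by (intro exI[of _ J]) auto
  qed
  then show ?thesis using that by blast
qed

lemma S1_not_converges_order_half:
  "\<exists>u \<in> (sobolev (1 / 2) :: 'a::euclidean_space distr set). \<not> S1_converges 0 u"
proof -
  obtain e :: 'a where e: "e \<in> Basis" using nonempty_Basis by blast
  obtain q :: "nat \<Rightarrow> real" where q: "\<And>a b M. a < b \<Longrightarrow> \<exists>J\<ge>M. a < q J \<and> q J < b"
    using ex_rational_enumeration by blast
  \<comment> \<open>The constants are coupled. With \<open>1 - r j = exp (- (64 ^ j))\<close> the
    logarithm has height about \<open>64 ^ j\<close>, and the series bounding its squared norm of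
    order 1/2 is at most \<open>64 ^ j\<close> as well. The factor \<open>(1 / 32) ^ j\<close> turns
    the height into \<open>2 ^ j\<close>, which is unbounded, and the squared norm into
    \<open>(1 / 16) ^ j\<close>, the decay required of packets.\<close>
  define r where "r j = (1 - exp (- (64 ^ j)) :: real)" for j :: nat
  have r: "0 < r j" "r j < 1" for j by (auto simp: r_def)
  define \<kappa> where "\<kappa> j = ((1 / 32) ^ j :: real)" for j :: nat
  have \<kappa>: "\<kappa> j > 0" for j :: nat by (simp add: \<kappa>_def)
  \<comment> \<open>The phase moves the peak to \<open>q j\<close>; the shift from \<open>m\<close>
    to \<open>Suc m\<close> excludes frequency 0.\<close>
  define c where "c j m = of_real (\<kappa> j * (r j ^ Suc m / Suc m)) * cis (- (Suc m * q j))" for j m :: nat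
  have norm_c: "norm (c j m) = \<kappa> j * (r j ^ Suc m / Suc m)" for j m
    using \<kappa>[of j] r[of j] by (simp add: c_def norm_mult norm_power norm_divide del: of_nat_Suc of_real_mult of_real_divide of_real_power)
  have r_sums: "(\<lambda>m. r j ^ Suc m / Suc m) sums (64 ^ j)" for j
  proof -
    have "norm (complex_of_real (r j)) < 1" using r[of j] by simp
    from sums_Re[OF sums_neg_Ln[OF this]] Re_neg_Ln[OF this]
    have "(\<lambda>m. Re (complex_of_real (r j) ^ Suc m / of_nat (Suc m))) sums (- ln (norm (1 - complex_of_real (r j))))" by simp
    moreover have "Re (complex_of_real (r j) ^ Suc m / of_nat (Suc m)) = r j ^ Suc m / Suc m" for m
    proof -
      have "complex_of_real (r j) ^ Suc m / of_nat (Suc m) = of_real (r j ^ Suc m / real (Suc m))" by simp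
      then show ?thesis by (simp only: Re_complex_of_real)
    qed
    moreover have "norm (1 - complex_of_real (r j)) = exp (- (64 ^ j))"
    proof -
      have "1 - complex_of_real (r j) = of_real (exp (- (64 ^ j)))" by (simp add: r_def)
      then show ?thesis by (simp only: norm_of_real) simp
    qed
    ultimately show ?thesis by simp
  qed
  define K where "K = pi\<^sup>2 / 6 + 1"
  have K: "K > 0" "1 \<le> K" "pi\<^sup>2 / 6 \<le> K" by (auto simp: K_def add_nonneg_pos)
  have "\<exists>u \<in> (sobolev (1 / 2) :: 'a distr set). follows_profiles e Suc c (2 * DIM('a) * K) u"
  proof (rule ex_wave_packet_family[OF e _ _ _ K(1)])
    show "summable (\<lambda>m. norm (c j m))" for j
      unfolding norm_c by (intro summable_mult sums_summable[OF r_sums])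
    show "(\<Sum>m. ennreal (real (Suc m) powr (2 * (1 / 2)) * (norm (c j m))\<^sup>2)) \<le> ennreal (K * (1 / 16) ^ j)" for j
    proof -
      \<comment> \<open>One of the two factors \<open>r j ^ Suc m\<close> is dropped, which leaves
        the logarithmic series itself.\<close>
      have le: "real (Suc m) powr (2 * (1 / 2)) * (norm (c j m))\<^sup>2 \<le> (\<kappa> j)\<^sup>2 * (r j ^ Suc m / Suc m)" for m
      proof -
        have "real (Suc m) powr (2 * (1 / 2)) * (norm (c j m))\<^sup>2 = (\<kappa> j)\<^sup>2 * (r j ^ Suc m / Suc m) * r j ^ Suc m"
          unfolding norm_c by (simp add: power2_eq_square field_simps del: of_nat_Suc power_Suc)
        also have "\<dots> \<le> (\<kappa> j)\<^sup>2 * (r j ^ Suc m / Suc m) * 1"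
          using r[of j] by (intro mult_left_mono power_le_one) auto
        finally show ?thesis by simp
      qed
      have "(\<Sum>m. ennreal (real (Suc m) powr (2 * (1 / 2)) * (norm (c j m))\<^sup>2)) \<le> (\<Sum>m. ennreal ((\<kappa> j)\<^sup>2 * (r j ^ Suc m / Suc m)))"
        by (intro suminf_le ennreal_leI le) auto
      also have "\<dots> = ennreal ((\<kappa> j)\<^sup>2 * 64 ^ j)"
      proof -
        have "(\<lambda>m. (\<kappa> j)\<^sup>2 * (r j ^ Suc m / Suc m)) sums ((\<kappa> j)\<^sup>2 * 64 ^ j)" by (rule sums_mult[OF r_sums])
        moreover have "0 \<le> (\<kappa> j)\<^sup>2 * (r j ^ Suc m / Suc m)" for m using r[of j] by (intro mult_nonneg_nonneg) auto
        ultimately show ?thesis by (subst suminf_ennreal2) (auto simp: sums_iff)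
      qed
      also have "(\<kappa> j)\<^sup>2 * 64 ^ j = (1 / 16) ^ j"
      proof -
        have "(\<kappa> j)\<^sup>2 = ((1 / 32)\<^sup>2) ^ j" unfolding \<kappa>_def by (simp only: power_mult[symmetric] mult.commute)
        then have "(\<kappa> j)\<^sup>2 * 64 ^ j = ((1 / 32)\<^sup>2 * 64) ^ j" by (simp only: power_mult_distrib)
        also have "(1 / 32)\<^sup>2 * 64 = (1 / 16 :: real)" by (simp add: power2_eq_square)
        finally show ?thesis .
      qed
      also have "ennreal ((1 / 16) ^ j) \<le> ennreal (K * (1 / 16) ^ j)"
        using mult_right_mono[OF K(2), of "(1 / 16) ^ j"] by (intro ennreal_leI) simp
      finally show ?thesis .
    qed
    show "(\<Sum>m. norm (c j m) / Suc m) \<le> K * (1 / 2) ^ j" for j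
    proof -
      have le: "norm (c j m) / Suc m \<le> \<kappa> j * (1 / (real m + 1)\<^sup>2)" for m
      proof -
        have "norm (c j m) / Suc m = \<kappa> j * (1 / (real m + 1)\<^sup>2) * r j ^ Suc m"
          unfolding norm_c by (simp add: power2_eq_square add.commute mult_ac del: power_Suc)
        also have "\<dots> \<le> \<kappa> j * (1 / (real m + 1)\<^sup>2) * 1"
          using r[of j] \<kappa>[of j] by (intro mult_left_mono power_le_one) auto
        finally show ?thesis by simp
      qed
      have s: "(\<lambda>m. \<kappa> j * (1 / (real m + 1)\<^sup>2)) sums (\<kappa> j * (pi\<^sup>2 / 6))"
        using sums_mult[OF inverse_squares_sums] by (simp add: add.commute)
      have s': "summable (\<lambda>m. norm (c j m) / Suc m)"
        by (rule summable_comparison_test'[OF sums_summable[OF s], of 0]) (use le in simp)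
      have "(\<Sum>m. norm (c j m) / Suc m) \<le> (\<Sum>m. \<kappa> j * (1 / (real m + 1)\<^sup>2))"
        by (rule suminf_le[OF le s' sums_summable[OF s]])
      also have "\<dots> = \<kappa> j * (pi\<^sup>2 / 6)" by (rule sums_unique[OF s, symmetric])
      also have "\<dots> \<le> (1 / 2) ^ j * K"
        unfolding \<kappa>_def by (intro mult_mono K power_mono) auto
      finally show ?thesis by (simp add: mult.commute)
    qed
  qed auto
  then obtain u :: "'a distr" where u: "u \<in> sobolev (1 / 2)" and fam: "follows_profiles e Suc c (2 * DIM('a) * K) u" ..
  define P where "P j = profile Suc (c j)" for j
  have Re_P: "Re (P j y) = - \<kappa> j * ln (norm (1 - of_real (r j) * cis (y - q j)))" for j y
  proof -
    define z where "z = of_real (r j) * cis (y - q j)"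
    have z: "norm z < 1" using r[of j] by (simp add: z_def norm_mult)
    have "c j m * cis (real (Suc m) * y) = of_real (\<kappa> j) * (z ^ Suc m / of_nat (Suc m))" for m
    proof -
      have "z ^ Suc m = of_real (r j ^ Suc m) * (cis (- (Suc m * q j)) * cis (Suc m * y))"
      proof -
        have "cis (y - q j) ^ Suc m = cis (real (Suc m) * (y - q j))" by (rule Complex.DeMoivre)
        also have "real (Suc m) * (y - q j) = - (Suc m * q j) + Suc m * y" by (simp only: right_diff_distrib)
        finally show ?thesis unfolding z_def power_mult_distrib cis_mult by (simp only: of_real_power)
      qed
      then show ?thesis by (simp add: c_def mult_ac del: power_Suc of_nat_Suc)
    qed
    then have "P j y = of_real (\<kappa> j) * (- Ln (1 - z))"
      unfolding P_def profile_def using sums_unique[OF sums_mult[OF sums_neg_Ln[OF z], of "of_real (\<kappa> j)"]] by simp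
    then show ?thesis unfolding z_def[symmetric] using Re_neg_Ln[OF z] by simp
  qed
  have nz: "0 < norm (1 - of_real (r j) * cis \<theta>)" for j \<theta>
  proof -
    have "norm (of_real (r j) * cis \<theta>) \<noteq> 1" using r[of j] by (simp add: norm_mult)
    then show ?thesis by (metis eq_iff_diff_eq_0 norm_one zero_less_norm_iff)
  qed
  \<comment> \<open>The argument of the logarithm has modulus at most 2, and
    \<open>ln 2 < 1\<close>. The real parts are thus bounded below by summable amounts, so the other
    summands cannot cancel a peak.\<close>
  have P_lower: "Re (P j y) \<ge> - \<kappa> j" for j y
  proof -
    have "norm (1 - of_real (r j) * cis (y - q j)) \<le> 1 + r j"
      using norm_triangle_ineq4[of 1 "of_real (r j) * cis (y - q j)"] r[of j] by (simp add: norm_mult)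
    then have "norm (1 - of_real (r j) * cis (y - q j)) \<le> 2" using r[of j] by simp
    then have "ln (norm (1 - of_real (r j) * cis (y - q j))) \<le> ln 2" using nz by (intro ln_mono) auto
    also have "\<dots> \<le> 1" using ln_2_less_1 by simp
    finally show ?thesis unfolding Re_P using \<kappa>[of j] by (simp add: mult_left_le)
  qed
  \<comment> \<open>At this distance from the centre, the argument of the logarithm is at most twice
    \<open>1 - r j\<close>, so the height drops by at most \<open>ln 2\<close> before
    scaling.\<close>
  have P_peak: "Re (P j y) \<ge> 2 ^ j - 1" if y: "\<bar>y - q j\<bar> \<le> exp (- (64 ^ j))" for j y
  proof -
    have "norm (1 - of_real (r j) * cis (y - q j)) = norm (of_real (1 - r j) + of_real (r j) * (1 - cis (y - q j)))"
      by (simp add: algebra_simps)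
    also have "\<dots> \<le> norm (complex_of_real (1 - r j)) + norm (of_real (r j) * (1 - cis (y - q j)))" by (rule norm_triangle_ineq)
    also have "\<dots> \<le> exp (- (64 ^ j)) + 1 * \<bar>y - q j\<bar>"
      unfolding norm_mult norm_of_real using r[of j] norm_cis_minus_1_le[of "y - q j"]
      by (intro add_mono mult_mono) (auto simp: r_def norm_minus_commute)
    also have "\<dots> \<le> 2 * exp (- (64 ^ j))" using y by simp
    finally have "ln (norm (1 - of_real (r j) * cis (y - q j))) \<le> ln (2 * exp (- (64 ^ j)))" using nz by (intro ln_mono) auto
    also have "\<dots> = ln 2 - 64 ^ j" by (simp add: ln_mult)
    also have "\<dots> \<le> 1 - 64 ^ j" using ln_2_less_1 by simp
    finally have "\<kappa> j * ln (norm (1 - of_real (r j) * cis (y - q j))) \<le> \<kappa> j * (1 - 64 ^ j)"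
      using \<kappa>[of j] by (intro mult_left_mono) auto
    moreover have "\<kappa> j * (1 - 64 ^ j) \<le> 1 - 2 ^ j"
    proof -
      have "\<kappa> j * 64 ^ j = 2 ^ j" unfolding \<kappa>_def power_mult_distrib[symmetric] by simp
      moreover have "\<kappa> j \<le> 1" unfolding \<kappa>_def by (intro power_le_one) auto
      ultimately show ?thesis by (simp add: right_diff_distrib)
    qed
    ultimately show ?thesis unfolding Re_P by simp
  qed
  have \<kappa>_sum: "summable \<kappa>" "(\<Sum>j. \<kappa> j) \<le> 2"
    unfolding \<kappa>_def[abs_def] by (auto simp: suminf_geometric summable_geometric)
  \<comment> \<open>After adding \<open>\<kappa> j\<close> all real parts are nonnegative, so term
    \<open>J\<close> alone bounds the sum from below. The 3 consists of 1 from the peak and 2 from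
    the sum of \<open>\<kappa>\<close>.\<close>
  have P_sum: "2 ^ J - 3 \<le> norm (\<Sum>j. P j y)" if s: "summable (\<lambda>j. P j y)" and y: "\<bar>y - q J\<bar> \<le> exp (- (64 ^ J))" for J y
  proof -
    have sR: "summable (\<lambda>j. Re (P j y))" using s by (rule summable_Re)
    have "2 ^ J - 1 \<le> Re (P J y) + \<kappa> J" using P_peak[OF y] \<kappa>[of J] by simp
    also have "\<dots> \<le> (\<Sum>j. Re (P j y) + \<kappa> j)"
    proof -
      have nonneg: "0 \<le> Re (P j y) + \<kappa> j" for j using P_lower[of j y] by simp
      show ?thesis using sum_le_suminf[OF summable_add[OF sR \<kappa>_sum(1)], of "{J}"] nonneg by simp
    qed
    also have "\<dots> = Re (\<Sum>j. P j y) + (\<Sum>j. \<kappa> j)"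
      using suminf_add[OF sR \<kappa>_sum(1)] Re_suminf[OF s] by simp
    also have "\<dots> \<le> norm (\<Sum>j. P j y) + 2" using complex_Re_le_cmod[of "\<Sum>j. P j y"] \<kappa>_sum(2) by linarith
    finally show ?thesis by simp
  qed
  have "\<not> S1_converges 0 u"
  proof
    assume "S1_converges 0 u"
    then obtain f F where fF: "represents f u" "S1_version u F"
      and lim: "AE x in lborel. ((\<lambda>t. \<bar>t\<bar> powr (- 0) *\<^sub>R (F x t - f x)) \<longlongrightarrow> 0) (at 0)"
      by (auto simp: S1_converges_def)
    define C where "C = 2 * DIM('a) * K"
    have C: "C \<ge> 0" using K by (simp add: C_def)
    \<comment> \<open>Half the radius on which the bump is bounded below, so that \<open>x\<close>
      moved by a time below \<rho> still lies within it.\<close>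
    define \<rho> where "\<rho> = 1 / (4 * real DIM('a))"
    have \<rho>: "\<rho> > 0" using DIM_positive[where 'a='a] by (simp add: \<rho>_def)
    have "AE x in lborel. ((\<lambda>t. \<bar>t\<bar> powr (- 0) *\<^sub>R (F x t - f x)) \<longlongrightarrow> 0) (at 0) \<and>
      (AE t in lborel. summable (\<lambda>j. unit_bump (x + t *\<^sub>R e) * P j (x \<bullet> e + t)) \<and>
        norm (F x t - (\<Sum>j. unit_bump (x + t *\<^sub>R e) * P j (x \<bullet> e + t))) \<le> C * \<bar>t\<bar>)"
      using lim follows_profilesD(2)[OF fam fF] unfolding P_def C_def by eventually_elim (rule conjI)
    moreover have "open (ball (0::'a) \<rho>)" "ball (0::'a) \<rho> \<noteq> {}" using \<rho> by auto
    ultimately obtain x where x: "x \<in> ball 0 \<rho>"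
      and limx: "((\<lambda>t. \<bar>t\<bar> powr (- 0) *\<^sub>R (F x t - f x)) \<longlongrightarrow> 0) (at 0)"
      and Fx: "AE t in lborel. summable (\<lambda>j. unit_bump (x + t *\<^sub>R e) * P j (x \<bullet> e + t)) \<and>
        norm (F x t - (\<Sum>j. unit_bump (x + t *\<^sub>R e) * P j (x \<bullet> e + t))) \<le> C * \<bar>t\<bar>"
      by (rule AE_lborel_ex_open) blast
    define c0 where "c0 = 1 / (2 * (2 * pi) ^ DIM('a))"
    have c0: "c0 > 0" by (simp add: c0_def)
    have "\<forall>\<^sub>F t in at 0. norm (\<bar>t\<bar> powr (- 0) *\<^sub>R (F x t - f x)) < 1"
      using tendstoD[OF limx, of 1] by simp
    then obtain \<epsilon> where \<epsilon>: "\<epsilon> > 0" "\<And>t. t \<noteq> 0 \<Longrightarrow> \<bar>t\<bar> < \<epsilon> \<Longrightarrow> norm (F x t - f x) < 1"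
      unfolding eventually_at by (auto simp: dist_norm)
    define \<eta> where "\<eta> = min (min \<epsilon> 1) \<rho>"
    have \<eta>: "\<eta> > 0" "\<eta> \<le> \<epsilon>" "\<eta> \<le> 1" "\<eta> \<le> \<rho>" using \<epsilon>(1) \<rho> by (auto simp: \<eta>_def)
    obtain M where M: "(norm (f x) + 1 + C) / c0 + 3 < 2 ^ M" using real_arch_pow[of 2] by fastforce
    obtain J where J: "J \<ge> M" "x \<bullet> e < q J" "q J < x \<bullet> e + \<eta>" using q[of "x \<bullet> e" "x \<bullet> e + \<eta>" M] \<eta>(1) by auto
    \<comment> \<open>An open set of times, small enough for the assumed convergence and inside the
      peak around \<open>q J\<close>; it contains the time that leads to the centre itself.\<close>
    let ?U = "{0<..<\<eta>} \<inter> ball (q J - x \<bullet> e) (exp (- (64 ^ J)))"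
    have "q J - x \<bullet> e \<in> ?U" using J by simp
    then have U: "?U \<noteq> {}" "open ?U" by (blast, intro open_Int) auto
    obtain t where t: "t \<in> ?U" and s: "summable (\<lambda>j. unit_bump (x + t *\<^sub>R e) * P j (x \<bullet> e + t))"
      and Ft: "norm (F x t - (\<Sum>j. unit_bump (x + t *\<^sub>R e) * P j (x \<bullet> e + t))) \<le> C * \<bar>t\<bar>"
      by (rule AE_lborel_ex_open[OF Fx U(2,1)]) blast
    let ?b = "unit_bump (x + t *\<^sub>R e)"
    have "norm (x + t *\<^sub>R e) \<le> norm x + norm (t *\<^sub>R e)" by (rule norm_triangle_ineq)
    also have "\<dots> \<le> \<rho> + \<rho>" using x t e \<eta> by (intro add_mono) (auto simp: dist_norm)
    also have "\<rho> + \<rho> = 1 / (2 * DIM('a))" by (simp add: \<rho>_def)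
    finally have b: "c0 \<le> norm ?b" unfolding c0_def by (rule unit_bump_ge)
    \<comment> \<open>Dividing by the nonvanishing bump yields summability of the profiles
      themselves.\<close>
    then have "?b \<noteq> 0" using c0 by auto
    with s have sP: "summable (\<lambda>j. P j (x \<bullet> e + t))" by simp
    have near: "\<bar>x \<bullet> e + t - q J\<bar> \<le> exp (- (64 ^ J))" using t by (auto simp: dist_real_def)
    have "(2::real) ^ M \<le> 2 ^ J" using J(1) by (intro power_increasing) auto
    with M have "(norm (f x) + 1 + C) / c0 < 2 ^ J - 3" by linarith
    then have "norm (f x) + 1 + C < c0 * (2 ^ J - 3)" using c0 by (simp add: divide_less_eq mult.commute)
    also have "\<dots> \<le> c0 * norm (\<Sum>j. P j (x \<bullet> e + t))"
      using c0 by (intro mult_left_mono P_sum[OF sP near]) auto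
    also have "\<dots> \<le> norm ?b * norm (\<Sum>j. P j (x \<bullet> e + t))" using b by (intro mult_right_mono) auto
    also have "\<dots> = norm (\<Sum>j. ?b * P j (x \<bullet> e + t))" using suminf_mult[OF sP, of ?b] by (simp add: norm_mult)
    also have "\<dots> \<le> norm (f x) + norm (F x t - f x) + norm (F x t - (\<Sum>j. ?b * P j (x \<bullet> e + t)))"
    proof -
      have "(\<Sum>j. ?b * P j (x \<bullet> e + t)) = (f x + (F x t - f x)) - (F x t - (\<Sum>j. ?b * P j (x \<bullet> e + t)))" by simp
      also have "norm \<dots> \<le> norm (f x) + norm (F x t - f x) + norm (F x t - (\<Sum>j. ?b * P j (x \<bullet> e + t)))"
        by (rule order_trans[OF norm_triangle_ineq4 add_right_mono[OF norm_triangle_ineq]])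
      finally show ?thesis .
    qed
    also have "\<dots> \<le> norm (f x) + 1 + C"
    proof -
      have "norm (F x t - f x) \<le> 1" using \<epsilon>(2)[of t] t \<eta>(2) by auto
      moreover have "C * \<bar>t\<bar> \<le> C * 1" using t \<eta>(3) C by (intro mult_left_mono) auto
      ultimately show ?thesis using Ft by linarith
    qed
    finally show False by simp
  qed
  with u show ?thesis by blast
qed

theorem theorem1p6:
  fixes \<delta> s :: real
  assumes "0 \<le> \<delta>" and "\<delta> < 1"
  shows "(\<forall>u \<in> (sobolev s :: (real ^ 'n) distr set). S1_converges \<delta> u) \<longleftrightarrow> s > 1 / 2 \<and> s \<ge> \<delta>"
proof
  assume conv: "\<forall>u \<in> (sobolev s :: (real ^ 'n) distr set). S1_converges \<delta> u"
  have "s > 1 / 2"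
  proof (rule ccontr)
    assume "\<not> s > 1 / 2"
    \<comment> \<open>For \<open>s \<le> 1 / 2\<close> the space of order s contains that of order
      1/2, and convergence with rate \<delta> implies plain convergence; one example with rate 0
      settles all cases.\<close>
    moreover obtain u :: "(real ^ 'n) distr" where "u \<in> sobolev (1 / 2)" "\<not> S1_converges 0 u"
      using S1_not_converges_order_half by blast
    ultimately show False using conv sobolev_mono[of u "1 / 2" s] S1_converges_mono[of \<delta> u 0] assms by auto
  qed
  moreover have "s \<ge> \<delta>"
  proof (rule ccontr)
    assume "\<not> s \<ge> \<delta>"
    \<comment> \<open>The part just proved gives s > 1/2, hence \<open>0 \<le> s\<close> and
      \<open>0 < \<delta>\<close>, as the Weierstrass example requires.\<close>
    then show False using conv S1_not_converges_below_exponent[of \<delta> s, where 'a="real ^ 'n"] assms \<open>s > 1 / 2\<close> by auto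
  qed
  ultimately show "s > 1 / 2 \<and> s \<ge> \<delta>" ..
next
  assume "s > 1 / 2 \<and> s \<ge> \<delta>"
  then show "\<forall>u \<in> (sobolev s :: (real ^ 'n) distr set). S1_converges \<delta> u"
    using S1_converges_if assms(2) by blast
qed

end
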